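(* Let $A,B\in\mathbb{Z}$ satisfy $2\leq -A\leq B$ and $2|A|<B+3$, and let $T$ be the tile defined below. Then: (1) if $A=-2$ and $B\geq 2$, then $T$ is disk-like; (2) if $A\leq -3$ and $B\geq 4$, then $T$ is not disk-like.
   Context: Let $a(x,y)=(x+1,y)$ and $c(x,y)=(-x,-y)$. Let $g(\mathbf{x})=\begin{pmatrix}0&-B\\1&-A\end{pmatrix}\mathbf{x}+\left(\frac{B-1}{2},0\right)^T$, $\mathcal{D}=\{id,a,\dots,a^{B-2},c\}$ if $B\geq3$ and $\mathcal{D}=\{id,c\}$ if $B=2$, and let $T$ be the unique nonempty compact set with $g(T)=\bigcup_{\delta\in\mathcal{D}}\delta(T)$. Disk-like means homeomorphic to a closed disk. *)

theory Defs
  imports "HOL-Analysis.Analysis"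
begin

definition shift_a :: "real \<times> real \<Rightarrow> real \<times> real" where
  "shift_a p = (fst p + 1, snd p)"

definition refl_c :: "real \<times> real \<Rightarrow> real \<times> real" where
  "refl_c p = (- fst p, - snd p)"

text \<open>g(x) = M x + ((B-1)/2, 0) with M = [[0,-B],[1,-A]].\<close>
definition tile_g :: "int \<Rightarrow> int \<Rightarrow> real \<times> real \<Rightarrow> real \<times> real" where
  "tile_g A B p = (- of_int B * snd p + (of_int B - 1) / 2, fst p - of_int A * snd p)"

definition digits :: "int \<Rightarrow> (real \<times> real \<Rightarrow> real \<times> real) set" where
  "digits B = (if B \<ge> 3 then {shift_a ^^ k | k. k \<le> nat (B - 2)} \<union> {refl_c}
               else {id, refl_c})"

definition tile :: "int \<Rightarrow> int \<Rightarrow> (real \<times> real) set" where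
  "tile A B = (THE T. T \<noteq> {} \<and> compact T \<and>
                 tile_g A B ` T = (\<Union>\<delta>\<in>digits B. \<delta> ` T))"

definition disk_like :: "(real \<times> real) set \<Rightarrow> bool" where
  "disk_like S \<longleftrightarrow> S homeomorphic cball (0 :: real \<times> real) 1"

end

theory Submission
  imports Defs
begin

text \<open>Disk-like case. For \<open>A = -2\<close> we construct a piecewise affine homeomorphism \<open>\<psi>\<close> of the plane which has the
  same equivariance as \<open>g\<inverse>\<close> with respect to the crystallographic group generated by \<open>\<int>\<^sup>2\<close> and \<open>c\<close>, is a
  contraction for a Euclidean norm, and maps \<open>\<Union>\<delta>(P)\<close> onto \<open>P\<close> for a convex hexagon \<open>P\<close>. The limit \<open>K\<close> of \<open>\<psi>\<^sup>n \<circ> g\<^sup>n\<close>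
  exists because \<open>\<psi> \<circ> g - id\<close> is periodic, it commutes with the group and satisfies \<open>\<psi> \<circ> K \<circ> g = K\<close>; it is
  injective because \<open>g\<close> is expanding while \<open>K - id\<close> is bounded. So \<open>K(T)\<close> is the attractor \<open>P\<close> of the maps
  \<open>\<psi> \<circ> \<delta>\<close>, and \<open>T\<close> is homeomorphic to \<open>P\<close>.

  Other case. A disk is unicoherent, and \<open>g(T)\<close> is the union of the connected sets \<open>\<Union>a\<^sup>k(T)\<close> and \<open>c(T)\<close>. For
  \<open>A \<le> -3\<close> the intersection of these two sets is disconnected: a small part of \<open>c(T) \<inter> a(T)\<close> is separated from the
  rest, which follows from the bounds \<open>\<bar>y\<bar> < 1\<close> and \<open>\<bar>x - A y\<bar> < 1\<close> on \<open>T\<close>.\<close>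

text \<open>The affine pieces of \<open>\<psi>\<close> live on the triangles of a tiling by the
  lattice translates of a hexagon and of its opposite. What has to be supplied by hand is the
  hexagon and the images of its vertices: they must obey the equivariance, shrink every triangle in
  one common Euclidean norm, and keep \<open>\<psi>\<close> injective. The rational constants are
  not canonical; they are one solution of the finitely many inequalities that express this.
  Injectivity is the main obstacle. For \<open>B = 2\<close> and \<open>B = 3\<close> all affine
  pieces are close to one similarity. For larger \<open>B\<close> the map squeezes \<open>B\<close>
  hexagons into one, so the pieces become thin as \<open>B\<close> grows and such a comparison
  leaves no margin uniform in \<open>B\<close>. There the image of the row of tiles is cut by
  chords, and the boundary of the row is followed edge by edge. In the other case the bounds must be
  strict, since otherwise copies that have to be kept apart might touch. The pair
  \<open>- A = 3\<close>, \<open>B = 4\<close> is extremal: the trapping region used for all other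
  parameters has no slack there, and one incidence survives the bounds and needs an argument of its
  own.\<close>

section \<open>Self-affine attractors and the tile\<close>

text \<open>A point of \<open>X\<close> farthest from \<open>Y\<close>, measured after
  \<open>S\<close>, is the image under some \<open>f\<close> of another point of \<open>X\<close>;
  contraction bounds its distance by \<open>lam\<close> times itself, so the distance is 0. Since
  only inclusions are assumed, the lemma serves for uniqueness, for trapping regions and for
  locating single points. \<open>S\<close> encodes an adapted Euclidean norm.\<close>

lemma attractor_subset:
  fixes S :: "'a::euclidean_space \<Rightarrow> 'a" and F :: "('a \<Rightarrow> 'a) set"
  assumes S: "linear S" "inj S" and lam: "0 \<le> lam" "lam < 1"
    and con: "\<And>f p q. f \<in> F \<Longrightarrow> norm (S (f p - f q)) \<le> lam * norm (S (p - q))"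
    and X: "compact X" and Y: "compact Y" "Y \<noteq> {}"
    and eqX: "X \<subseteq> (\<Union>f\<in>F. f ` X)" and subY: "(\<Union>f\<in>F. f ` Y) \<subseteq> Y"
  shows "X \<subseteq> Y"
proof (cases "X = {}")
  case False
  have contS: "continuous_on A S" for A
    using S(1) linear_continuous_on linear_conv_bounded_linear by blast
  have SY: "closed (S ` Y)" "S ` Y \<noteq> {}"
    using Y compact_continuous_image[OF contS] compact_imp_closed by auto
  define e where "e = (\<lambda>x. infdist (S x) (S ` Y))"
  have "continuous_on X e"
    unfolding e_def by (intro continuous_on_infdist contS)
  then obtain x0 where x0: "x0 \<in> X" "\<And>x. x \<in> X \<Longrightarrow> e x \<le> e x0"
    using continuous_attains_sup[OF X False] by blast
  obtain f x' where f: "f \<in> F" "x' \<in> X" "x0 = f x'"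
    using eqX x0(1) by blast
  obtain y' where y': "y' \<in> Y" "infdist (S x') (S ` Y) = dist (S x') (S y')"
    using infdist_attains_inf[OF SY] by (metis imageE)
  have fy: "f y' \<in> Y" using subY f(1) y'(1) by blast
  have "e x0 \<le> dist (S (f x')) (S (f y'))"
    unfolding e_def f(3) using fy by (simp add: infdist_le)
  also have "\<dots> = norm (S (f x' - f y'))"
    by (simp add: dist_norm linear_diff S)
  also have "\<dots> \<le> lam * norm (S (x' - y'))" by (rule con[OF f(1)])
  also have "\<dots> = lam * e x'"
    using y'(2) by (simp add: e_def dist_norm linear_diff S)
  also have "\<dots> \<le> lam * e x0" using x0(2)[OF f(2)] lam by (simp add: mult_left_mono)
  finally have "e x0 * (1 - lam) \<le> 0" by (simp add: algebra_simps)
  then have e0: "e x0 \<le> 0" using lam by (simp add: mult_le_0_iff)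
  show ?thesis
  proof
    fix x assume "x \<in> X"
    then have "e x = 0"
      using x0(2) e0 infdist_nonneg[of "S x" "S ` Y"] unfolding e_def by (meson antisym order_trans)
    then have "S x \<in> S ` Y"
      using SY in_closed_iff_infdist_zero unfolding e_def by blast
    then show "x \<in> Y" using S(2) by (auto dest: injD)
  qed
qed simp

text \<open>The decreasing images of an invariant ball are intersected. For
  \<open>X \<subseteq> G X\<close> finiteness of \<open>F\<close> enters: one single
  \<open>f\<close> reaches the given point from infinitely many of the sets, hence from all of them,
  and the nested compact fibres have a common point.\<close>

lemma attractor_exists:
  fixes S :: "'a::euclidean_space \<Rightarrow> 'a" and F :: "('a \<Rightarrow> 'a) set"
  assumes S: "linear S" "inj S" and lam: "0 \<le> lam" "lam < 1"
    and con: "\<And>f p q. f \<in> F \<Longrightarrow> norm (S (f p - f q)) \<le> lam * norm (S (p - q))"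
    and F: "finite F" "F \<noteq> {}"
  shows "\<exists>X. X \<noteq> {} \<and> compact X \<and> X = (\<Union>f\<in>F. f ` X)"
proof -
  obtain b where b: "b > 0" "\<And>x. b * norm x \<le> norm (S x)"
    using linear_inj_bounded_below_pos[OF S] by blast
  have contS: "continuous_on A S" for A
    using S(1) linear_continuous_on linear_conv_bounded_linear by blast
  obtain c where c: "c > 0" "\<And>x. norm (S x) \<le> c * norm x"
    using linear_bounded_pos[OF S(1)] by (metis mult.commute)
  have contf: "continuous_on A f" if "f \<in> F" for f A
  proof -
    have "(lam * c / b)-lipschitz_on A f"
    proof (rule lipschitz_onI)
      fix p q
      have "b * norm (f p - f q) \<le> lam * (c * norm (p - q))"
        using b(2)[of "f p - f q"] con[OF that, of p q] mult_left_mono[OF c(2)[of "p - q"] lam(1)] by linarith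
      then show "dist (f p) (f q) \<le> lam * c / b * dist p q"
        using b(1) by (simp add: dist_norm field_simps)
    qed (use lam b c in simp)
    then show ?thesis by (rule lipschitz_on_continuous_on)
  qed
  define m where "m = Max ((\<lambda>f. norm (S (f 0))) ` F)"
  have m: "norm (S (f 0)) \<le> m" if "f \<in> F" for f unfolding m_def using F that by auto
  have m0: "m \<ge> 0" using m F norm_ge_zero order_trans by (metis all_not_in_conv)
  \<comment> \<open>The radius at which a ball about 0 is carried into itself, \<open>m\<close>
    bounding the images of 0.\<close>
  define R where "R = m / (1 - lam)"
  have R: "lam * R + m = R" unfolding R_def using lam by (simp add: field_simps)
  define C where "C = {p. norm (S p) \<le> R}"
  have R0: "R \<ge> 0" unfolding R_def using m0 lam by simp
  have "closed C" unfolding C_def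
    by (intro closed_Collect_le continuous_on_norm contS continuous_on_const)
  moreover have "bounded C"
    unfolding bounded_iff C_def by (rule exI[of _ "R / b"]) (use b in \<open>auto simp: field_simps intro: order_trans\<close>)
  ultimately have C: "compact C" by (simp add: compact_eq_bounded_closed)
  have C0: "0 \<in> C" unfolding C_def using R0 S(1) by (simp add: linear_0)
  have fC: "f ` C \<subseteq> C" if "f \<in> F" for f
  proof
    fix x assume "x \<in> f ` C"
    then obtain p where p: "x = f p" "norm (S p) \<le> R" unfolding C_def by auto
    have "norm (S (f p)) = norm (S (f p - f 0) + S (f 0))"
      using S(1) by (simp add: linear_diff)
    also have "\<dots> \<le> norm (S (f p - f 0)) + norm (S (f 0))" by (rule norm_triangle_ineq)
    also have "\<dots> \<le> lam * R + m"
      using con[OF that, of p 0] m[OF that] mult_left_mono[OF p(2) lam(1)] by simp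
    finally show "x \<in> C" unfolding C_def using R p by simp
  qed
  define G where "G = (\<lambda>X. \<Union>f\<in>F. f ` X)"
  define W where "W = (\<lambda>n. (G ^^ n) C)"
  have W0: "W 0 = C" and WS: "W (Suc n) = G (W n)" for n by (auto simp: W_def)
  have Gmono: "G X \<subseteq> G Y" if "X \<subseteq> Y" for X Y using that unfolding G_def by blast
  have Wdec: "W (Suc n) \<subseteq> W n" for n
  proof (induction n)
    case 0 then show ?case using fC by (auto simp: W0 WS G_def)
  next
    case (Suc n) then show ?case using Gmono WS by metis
  qed
  have Wc: "compact (W n)" for n
  proof (induction n)
    case (Suc n) then show ?case unfolding WS G_def
      by (intro compact_UN F compact_continuous_image contf)
  qed (simp add: W0 C)
  have Wn: "W n \<noteq> {}" for n
  proof (induction n)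
    case (Suc n) then show ?case unfolding WS G_def using F by auto
  qed (use C0 W0 in auto)
  have dec: "W m \<subseteq> W n" if "n \<le> m" for m n
    using lift_Suc_antimono_le[of W, OF Wdec that] .
  define X where "X = (\<Inter>n. W n)"
  have "X \<noteq> {}" unfolding X_def
    using compact_nest[of W] Wc Wn dec by auto
  moreover have "compact X" unfolding X_def
  proof -
    have "closed (\<Inter>n. W n)" by (intro closed_INT ballI compact_imp_closed Wc)
    moreover have "(\<Inter>n. W n) = W 0 \<inter> (\<Inter>n. W n)" by blast
    ultimately show "compact (\<Inter>n. W n)" using Wc compact_Int_closed by metis
  qed
  moreover have "X = G X"
  proof
    show "G X \<subseteq> X"
    proof -
      have "G X \<subseteq> W n" for n
        using Gmono[of X "W n"] WS Wdec unfolding X_def by blast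
      then show ?thesis unfolding X_def by blast
    qed
    show "X \<subseteq> G X"
    proof
      fix x assume x: "x \<in> X"
      define N where "N = (\<lambda>f. {n. \<exists>p\<in>W n. f p = x})"
      have "(\<Union>f\<in>F. N f) = UNIV"
      proof -
        have "\<exists>f\<in>F. n \<in> N f" for n
        proof -
          have "x \<in> W (Suc n)" using x unfolding X_def by blast
          then show ?thesis unfolding WS G_def N_def by auto
        qed
        then show ?thesis by blast
      qed
      then obtain f where f: "f \<in> F" "infinite (N f)"
        using F(1) by (metis finite_UN infinite_UNIV_nat)
      have ne: "{p \<in> W n. f p = x} \<noteq> {}" for n
      proof -
        obtain k where "k \<in> N f" "k \<ge> n"
          using f(2) by (meson finite_nat_set_iff_bounded_le nat_le_linear)
        then show ?thesis unfolding N_def using dec by blast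
      qed
      have "compact {p \<in> W n. f p = x}" for n
      proof -
        have "{p \<in> W n. f p = x} = W n \<inter> f -` {x}" by auto
        moreover have "closed (f -` {x})"
          using contf[OF f(1), of UNIV] by (simp add: continuous_closed_vimage continuous_on_eq_continuous_at)
        ultimately show ?thesis using Wc compact_Int_closed by metis
      qed
      then have "(\<Inter>n. {p \<in> W n. f p = x}) \<noteq> {}"
        using compact_nest[of "\<lambda>n. {p \<in> W n. f p = x}"] ne dec by blast
      then show "x \<in> G X" unfolding G_def X_def using f(1) by blast
    qed
  qed
  ultimately show ?thesis unfolding G_def by blast
qed

section \<open>The set equation of the tile as an iterated function system\<close>

definition tile_ginv :: "int \<Rightarrow> int \<Rightarrow> real \<times> real \<Rightarrow> real \<times> real" where
  "tile_ginv A B p = (snd p + of_int A * (((of_int B - 1) / 2 - fst p) / of_int B),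
                      ((of_int B - 1) / 2 - fst p) / of_int B)"

lemma tile_ginv_g: "B \<noteq> 0 \<Longrightarrow> tile_ginv A B (tile_g A B p) = p"
  by (cases p) (simp add: tile_ginv_def tile_g_def field_simps)

lemma tile_g_ginv: "B \<noteq> 0 \<Longrightarrow> tile_g A B (tile_ginv A B p) = p"
  by (cases p) (simp add: tile_ginv_def tile_g_def field_simps)

lemma tile_g_diff: "tile_g A B p - tile_g A B q
    = (- of_int B * snd (p - q), fst (p - q) - of_int A * snd (p - q))"
  by (simp add: tile_g_def prod_eq_iff algebra_simps)

definition Glin :: "real \<Rightarrow> real \<Rightarrow> real \<times> real \<Rightarrow> real \<times> real" where
  "Glin b k p = (snd p + b * fst p, k * fst p)"

lemma linear_Glin: "linear (Glin b k)"
  by (rule linearI) (auto simp: Glin_def algebra_simps)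

lemma inj_Glin: "k \<noteq> 0 \<Longrightarrow> inj (Glin b k)"
  by (rule injI) (auto simp: Glin_def prod_eq_iff)

lemma norm_pair_sq: "(norm (p :: real \<times> real))\<^sup>2 = (fst p)\<^sup>2 + (snd p)\<^sup>2"
  by (cases p) (simp add: norm_Pair)

text \<open>The quadratic form \<open>(y + b x)\<^sup>2 + k\<^sup>2 x\<^sup>2\<close> with \<open>b = n / (B + 1)\<close> is chosen so that the mixed
  term of its increment under the linear part of \<open>g\<close> vanishes.\<close>

lemma g_expands:
  fixes A B :: int
  assumes "B \<ge> 2" "\<bar>A\<bar> \<le> B"
  obtains S :: "real \<times> real \<Rightarrow> real \<times> real" and lam :: real
  where "linear S" "inj S" "0 < lam" "lam < 1"
    "\<And>p q. norm (S (p - q)) \<le> lam * norm (S (tile_g A B p - tile_g A B q))"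
proof -
  define N where "N = - real_of_int A"
  define b where "b = real_of_int B"
  define \<beta> where "\<beta> = N / (b + 1)"
  \<comment> \<open>The form is \<open>y^2 + 2 \<beta> x y + a x^2\<close>, and its increment under
    the linear part of \<open>g\<close> will be \<open>(1 - a) x^2 + c y^2\<close>. So
    \<open>a\<close> must lie below 1, but only slightly, to keep \<open>c\<close> positive.\<close>
  define a where "a = 1 - 1 / (b + 1)\<^sup>2"
  define k where "k = sqrt (a - \<beta>\<^sup>2)"
  have bN: "b \<ge> 2" "\<bar>N\<bar> \<le> b"
    using assms unfolding b_def N_def by linarith+
  have N2: "N\<^sup>2 \<le> b\<^sup>2" using bN by (metis abs_ge_zero power2_abs power_mono)
  have \<beta>2: "\<beta>\<^sup>2 \<le> b\<^sup>2 / (b+1)\<^sup>2"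
    unfolding \<beta>_def using N2 by (simp add: power_divide divide_right_mono)
  have "a - b\<^sup>2 / (b+1)\<^sup>2 = 2 * b / (b+1)\<^sup>2"
  proof -
    have nz: "(b+1)\<^sup>2 \<noteq> 0" using bN by simp
    have "a - b\<^sup>2 / (b+1)\<^sup>2 = ((b+1)\<^sup>2 - 1 - b\<^sup>2) / (b+1)\<^sup>2"
      unfolding a_def using nz by (simp add: diff_divide_distrib)
    also have "(b+1)\<^sup>2 - 1 - b\<^sup>2 = 2 * b" by (simp add: power2_eq_square algebra_simps)
    finally show ?thesis .
  qed
  moreover have "2 * b / (b+1)\<^sup>2 > 0" using bN by simp
  ultimately have k2: "a - \<beta>\<^sup>2 > 0" using \<beta>2 by linarith
  have ksq: "k\<^sup>2 = a - \<beta>\<^sup>2" and k0: "k > 0" unfolding k_def using k2 by auto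
  define c where "c = a * b\<^sup>2 - N\<^sup>2 * (b - 1) / (b + 1) - 1"
  \<comment> \<open>\<open>c\<close> decreases in \<open>\<bar>N\<bar>\<close>; at the extreme value
    \<open>\<bar>N\<bar> = b\<close> it is an explicit positive fraction.\<close>
  have "N\<^sup>2 * (b - 1) / (b + 1) \<le> b\<^sup>2 * (b - 1) / (b + 1)"
    using N2 bN by (intro divide_right_mono mult_right_mono) auto
  moreover have "a * b\<^sup>2 - b\<^sup>2 * (b - 1) / (b + 1) - 1 = (2 * b^3 - 2 * b - 1) / (b + 1)\<^sup>2"
  proof -
    have q: "b + 1 \<noteq> 0" using bN by simp
    define Z where "Z = b\<^sup>2 * (b - 1) / (b + 1)"
    have e1: "(b+1)\<^sup>2 * a = (b+1)\<^sup>2 - 1" unfolding a_def using q by (simp add: right_diff_distrib)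
    have e2: "(b+1)\<^sup>2 * Z = b\<^sup>2 * (b - 1) * (b + 1)" unfolding Z_def using q by (simp add: power2_eq_square)
    have "(a * b\<^sup>2 - Z - 1) * (b+1)\<^sup>2 = ((b+1)\<^sup>2 * a) * b\<^sup>2 - (b+1)\<^sup>2 * Z - (b+1)\<^sup>2"
      by (simp add: algebra_simps)
    also have "\<dots> = 2 * b^3 - 2 * b - 1"
      unfolding e1 e2 by (simp add: power2_eq_square power3_eq_cube algebra_simps)
    finally show ?thesis using q by (simp add: Z_def nonzero_eq_divide_eq)
  qed
  moreover have "2 * b^3 - 2 * b - 1 > 0"
  proof -
    have "b^3 \<ge> 4 * b"
    proof -
      have "b * (b * b - 4) \<ge> 0" using bN mult_mono[of 2 b 2 b] by (intro mult_nonneg_nonneg) auto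
      then show ?thesis by (simp add: power3_eq_cube algebra_simps)
    qed
    then show ?thesis using bN by linarith
  qed
  then have "(2 * b^3 - 2 * b - 1) / (b + 1)\<^sup>2 > 0" using bN by simp
  ultimately have c0: "c > 0" unfolding c_def by linarith
  define \<epsilon> where "\<epsilon> = 1 / (b+1)\<^sup>2"
  have e0: "\<epsilon> > 0" unfolding \<epsilon>_def using bN by simp
  \<comment> \<open>The form is at most \<open>3 (x^2 + y^2)\<close>, so with this
    \<open>\<mu>\<close> the increment is at least \<open>\<mu>\<close> times the form.\<close>
  define \<mu> where "\<mu> = min \<epsilon> c / 3"
  have mu0: "\<mu> > 0" unfolding \<mu>_def using e0 c0 by simp
  define lam where "lam = 1 / sqrt (1 + \<mu>)"
  have lam: "0 < lam" "lam < 1" unfolding lam_def using mu0 by auto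
  have key: "(1 + \<mu>) * (norm (Glin \<beta> k (x, y)))\<^sup>2 \<le> (norm (Glin \<beta> k (- b * y, x + N * y)))\<^sup>2" for x y
  proof -
    have b2: "\<beta> * (b + 1) = N" unfolding \<beta>_def using bN by simp
    have nn: "(norm (Glin \<beta> k (x, y)))\<^sup>2 = (y + \<beta> * x)\<^sup>2 + (a - \<beta>\<^sup>2) * x\<^sup>2" for x y
      unfolding norm_pair_sq Glin_def by (simp add: power_mult_distrib ksq)
    have "(norm (Glin \<beta> k (- b * y, x + N * y)))\<^sup>2 - (norm (Glin \<beta> k (x, y)))\<^sup>2
        = (1 - a) * x\<^sup>2 + 2 * (N - \<beta> * (b + 1)) * x * y + (a * b\<^sup>2 - 2 * \<beta> * b * N + N\<^sup>2 - 1) * y\<^sup>2"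
      unfolding nn by (simp add: power2_eq_square algebra_simps)
    also have "\<dots> = \<epsilon> * x\<^sup>2 + c * y\<^sup>2"
    proof -
      have "2 * \<beta> * b * N = N\<^sup>2 * (2 * b) / (b + 1)" unfolding \<beta>_def by (simp add: power2_eq_square)
      then have "a * b\<^sup>2 - 2 * \<beta> * b * N + N\<^sup>2 - 1 = c"
        unfolding c_def using bN by (simp add: field_simps)
      moreover have "1 - a = \<epsilon>" unfolding a_def \<epsilon>_def by simp
      ultimately show ?thesis using b2 by simp
    qed
    finally have d: "(norm (Glin \<beta> k (- b * y, x + N * y)))\<^sup>2 = (norm (Glin \<beta> k (x, y)))\<^sup>2 + (\<epsilon> * x\<^sup>2 + c * y\<^sup>2)"
      by linarith
    have "(norm (Glin \<beta> k (x, y)))\<^sup>2 \<le> 3 * (x\<^sup>2 + y\<^sup>2)"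
    proof -
      have "\<beta>\<^sup>2 \<le> 1"
      proof -
        have "b\<^sup>2 / (b+1)\<^sup>2 \<le> 1" using bN by (simp add: power_mono)
        then show ?thesis using \<beta>2 by linarith
      qed
      then have h1: "\<beta>\<^sup>2 * x\<^sup>2 \<le> x\<^sup>2" by (simp add: mult_left_le_one_le)
      have h2: "(a - \<beta>\<^sup>2) * x\<^sup>2 \<le> 1 * x\<^sup>2"
      proof -
        have "1 / (b+1)\<^sup>2 \<ge> 0" by simp
        then have "a - \<beta>\<^sup>2 \<le> 1" unfolding a_def using zero_le_power2[of \<beta>] by linarith
        then show ?thesis by (intro mult_right_mono) auto
      qed
      have h3: "(y + \<beta> * x)\<^sup>2 \<le> 2 * y\<^sup>2 + 2 * (\<beta>\<^sup>2 * x\<^sup>2)"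
        using zero_le_power2[of "y - \<beta> * x"] by (simp add: power2_eq_square algebra_simps)
      have "(y + \<beta> * x)\<^sup>2 + (a - \<beta>\<^sup>2) * x\<^sup>2 \<le> (2 * y\<^sup>2 + 2 * x\<^sup>2) + 1 * x\<^sup>2"
        using h3 h2 mult_left_mono[OF h1, of 2] by linarith
      also have "\<dots> \<le> 3 * (x\<^sup>2 + y\<^sup>2)" using zero_le_power2[of y] by (simp add: algebra_simps)
      finally show ?thesis unfolding nn .
    qed
    then have "\<mu> * (norm (Glin \<beta> k (x, y)))\<^sup>2 \<le> \<mu> * (3 * (x\<^sup>2 + y\<^sup>2))"
      using mu0 by (intro mult_left_mono) auto
    also have "\<dots> = min \<epsilon> c * x\<^sup>2 + min \<epsilon> c * y\<^sup>2" unfolding \<mu>_def by (simp add: algebra_simps)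
    also have "\<dots> \<le> \<epsilon> * x\<^sup>2 + c * y\<^sup>2" by (intro add_mono mult_right_mono) auto
    finally show ?thesis using d by (simp add: algebra_simps)
  qed
  show thesis
  proof (rule that[of "Glin \<beta> k" lam])
    show "linear (Glin \<beta> k)" by (rule linear_Glin)
    show "inj (Glin \<beta> k)" using k0 by (simp add: inj_Glin)
    show "0 < lam" "lam < 1" by (rule lam)+
    fix p q :: "real \<times> real"
    obtain x y where xy: "p - q = (x, y)" by (cases "p - q")
    have "tile_g A B p - tile_g A B q = (- b * y, x + N * y)"
      unfolding tile_g_diff xy b_def N_def by simp
    moreover have "norm (Glin \<beta> k (x, y)) \<le> lam * norm (Glin \<beta> k (- b * y, x + N * y))"
    proof -
      have "sqrt ((1 + \<mu>) * (norm (Glin \<beta> k (x, y)))\<^sup>2) \<le> norm (Glin \<beta> k (- b * y, x + N * y))"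
        using real_sqrt_le_mono[OF key[of x y]] by simp
      then have "sqrt (1 + \<mu>) * norm (Glin \<beta> k (x, y)) \<le> norm (Glin \<beta> k (- b * y, x + N * y))"
        by (simp add: real_sqrt_mult)
      then show ?thesis unfolding lam_def using mu0 by (simp add: field_simps)
    qed
    ultimately show "norm (Glin \<beta> k (p - q)) \<le> lam * norm (Glin \<beta> k (tile_g A B p - tile_g A B q))"
      by (simp add: xy)
  qed
qed

lemma shift_a_pow: "(shift_a ^^ k) p = (fst p + real k, snd p)"
  by (induction k) (auto simp: shift_a_def)

lemma digits_isometric: "\<delta> \<in> digits B \<Longrightarrow> \<delta> p - \<delta> q = p - q \<or> \<delta> p - \<delta> q = - (p - q)"
  by (auto simp: digits_def shift_a_pow refl_c_def prod_eq_iff split: if_splits)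

lemma digits_norm:
  assumes "linear S" "\<delta> \<in> digits B"
  shows "norm (S (\<delta> p - \<delta> q)) = norm (S (p - q))"
  using digits_isometric[OF assms(2), of p q]
proof
  assume e: "\<delta> p - \<delta> q = - (p - q)"
  show ?thesis unfolding e linear_neg[OF assms(1)] norm_minus_cancel ..
qed simp

lemma finite_digits: "finite (digits B)" and digits_nonempty: "digits B \<noteq> {}"
proof -
  have "{shift_a ^^ k |k. k \<le> nat (B - 2)} = (\<lambda>k. shift_a ^^ k) ` {..nat (B - 2)}" by auto
  then show "finite (digits B)" unfolding digits_def by simp
qed (auto simp: digits_def)

lemma UN_digits:
  assumes "B \<ge> 2"
  shows "(\<Union>\<delta>\<in>digits B. \<delta> ` T) = {(x + of_int k, y) |x y k. (x, y) \<in> T \<and> 0 \<le> k \<and> k \<le> B - 2} \<union> uminus ` T"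
    (is "?L = ?R")
proof -
  have D: "digits B = {shift_a ^^ k | k. k \<le> nat (B - 2)} \<union> {refl_c}"
  proof (cases "B \<ge> 3")
    case False
    then have "B = 2" using assms by simp
    then show ?thesis unfolding digits_def by auto
  qed (simp add: digits_def)
  have c: "refl_c ` T = uminus ` T" by (intro image_cong) (auto simp: refl_c_def prod_eq_iff)
  have a: "(shift_a ^^ k) ` T = {(x + real k, y) |x y. (x, y) \<in> T}" for k
    by (force simp: shift_a_pow image_iff)
  have "(\<Union>k\<in>{..nat (B - 2)}. {(x + real k, y) |x y. (x, y) \<in> T})
      = {(x + of_int k, y) |x y k. (x, y) \<in> T \<and> 0 \<le> k \<and> k \<le> B - 2}" (is "?U = ?V")
  proof
    show "?U \<subseteq> ?V"
    proof clarify
      fix k x y assume "k \<le> nat (B - 2)" "(x, y) \<in> T"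
      then show "\<exists>x' y' k'. (x + real k, y) = (x' + of_int k', y') \<and> (x', y') \<in> T \<and> 0 \<le> k' \<and> k' \<le> B - 2"
        using assms by (intro exI[of _ x] exI[of _ y] exI[of _ "int k"]) auto
    qed
    show "?V \<subseteq> ?U"
    proof clarify
      fix x y k assume "(x, y) \<in> T" "0 \<le> k" "k \<le> B - 2"
      then show "(x + of_int k, y) \<in> ?U"
        by (intro UN_I[of "nat k"]) auto
    qed
  qed
  moreover have "?L = (\<Union>k\<in>{..nat (B - 2)}. (shift_a ^^ k) ` T) \<union> refl_c ` T"
    unfolding D by auto
  ultimately show ?thesis unfolding a c by simp
qed

lemma tile_eq_iff:
  assumes "B \<noteq> 0"
  shows "tile_g A B ` T = (\<Union>\<delta>\<in>digits B. \<delta> ` T) \<longleftrightarrow> T = (\<Union>f\<in>(\<lambda>\<delta>. tile_ginv A B \<circ> \<delta>) ` digits B. f ` T)"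
    (is "?l = ?r \<longleftrightarrow> T = ?u")
proof -
  have u: "?u = tile_ginv A B ` ?r" by auto
  have 1: "tile_ginv A B ` (tile_g A B ` T) = T" "tile_g A B ` (tile_ginv A B ` R) = R" for R T
    using assms by (auto simp: tile_ginv_g tile_g_ginv image_comp)
  show ?thesis unfolding u using 1 by metis
qed

lemma tile_unique_exists:
  assumes "B \<ge> 2" "\<bar>A\<bar> \<le> B"
  shows "\<exists>!T. T \<noteq> {} \<and> compact T \<and> tile_g A B ` T = (\<Union>\<delta>\<in>digits B. \<delta> ` T)"
proof -
  obtain S :: "real \<times> real \<Rightarrow> real \<times> real" and lam where S: "linear S" "inj S" "0 < lam" "lam < 1"
    "\<And>p q. norm (S (p - q)) \<le> lam * norm (S (tile_g A B p - tile_g A B q))"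
    using g_expands[OF assms] by blast
  define F where "F = (\<lambda>\<delta>. tile_ginv A B \<circ> \<delta>) ` digits B"
  have B0: "B \<noteq> 0" using assms by auto
  have con: "norm (S (f p - f q)) \<le> lam * norm (S (p - q))" if "f \<in> F" for f p q
  proof -
    obtain \<delta> where \<delta>: "\<delta> \<in> digits B" "f = tile_ginv A B \<circ> \<delta>" using \<open>f \<in> F\<close> unfolding F_def by auto
    have "norm (S (f p - f q)) \<le> lam * norm (S (\<delta> p - \<delta> q))"
      using S(5)[of "f p" "f q"] B0 by (simp add: \<delta> tile_g_ginv)
    also have "norm (S (\<delta> p - \<delta> q)) = norm (S (p - q))"
      by (rule digits_norm[OF S(1) \<delta>(1)])
    finally show ?thesis .
  qed
  have F: "finite F" "F \<noteq> {}" unfolding F_def using finite_digits digits_nonempty by auto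
  have eq: "tile_g A B ` T = (\<Union>\<delta>\<in>digits B. \<delta> ` T) \<longleftrightarrow> T = (\<Union>f\<in>F. f ` T)" for T
    unfolding F_def by (rule tile_eq_iff[OF B0])
  obtain X where X: "X \<noteq> {}" "compact X" "X = (\<Union>f\<in>F. f ` X)"
    using attractor_exists[OF S(1,2) _ S(4) con F] S(3) by (metis less_imp_le)
  show ?thesis unfolding eq
  proof (rule ex1I[of _ X])
    fix Y assume Y: "Y \<noteq> {} \<and> compact Y \<and> Y = (\<Union>f\<in>F. f ` Y)"
    have "Y \<subseteq> X"
      by (rule attractor_subset[OF S(1,2) _ S(4) con]) (use X Y S(3) in auto)
    moreover have "X \<subseteq> Y"
      by (rule attractor_subset[OF S(1,2) _ S(4) con]) (use X Y S(3) in auto)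
    ultimately show "Y = X" by blast
  qed (use X in blast)
qed

lemma tile_props:
  assumes "B \<ge> 2" "\<bar>A\<bar> \<le> B"
  shows "tile A B \<noteq> {}" "compact (tile A B)"
    "tile_g A B ` tile A B = (\<Union>\<delta>\<in>digits B. \<delta> ` tile A B)"
  using theI'[OF tile_unique_exists[OF assms]] unfolding tile_def by auto

section \<open>Tiles that are not disk-like\<close>

text \<open>The device behind all bounds on the tile: a compact region that every piece map carries
  into itself traps the tile.\<close>

lemma tile_subset:
  assumes "B \<ge> 2" "\<bar>A\<bar> \<le> B" and K: "compact K" "K \<noteq> {}"
    and tr: "\<And>x y k. (x, y) \<in> K \<Longrightarrow> 0 \<le> k \<Longrightarrow> k \<le> B - 2 \<Longrightarrow> tile_ginv A B (x + of_int k, y) \<in> K"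
    and rf: "\<And>x y. (x, y) \<in> K \<Longrightarrow> tile_ginv A B (- x, - y) \<in> K"
  shows "tile A B \<subseteq> K"
proof -
  obtain S :: "real \<times> real \<Rightarrow> real \<times> real" and lam where S: "linear S" "inj S" "0 < lam" "lam < 1"
    "\<And>p q. norm (S (p - q)) \<le> lam * norm (S (tile_g A B p - tile_g A B q))"
    using g_expands[OF assms(1,2)] by blast
  define F where "F = (\<lambda>\<delta>. tile_ginv A B \<circ> \<delta>) ` digits B"
  have B0: "B \<noteq> 0" using assms by auto
  have con: "norm (S (f p - f q)) \<le> lam * norm (S (p - q))" if "f \<in> F" for f p q
  proof -
    obtain \<delta> where \<delta>: "\<delta> \<in> digits B" "f = tile_ginv A B \<circ> \<delta>" using \<open>f \<in> F\<close> unfolding F_def by auto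
    have "norm (S (f p - f q)) \<le> lam * norm (S (\<delta> p - \<delta> q))"
      using S(5)[of "f p" "f q"] B0 by (simp add: \<delta> tile_g_ginv)
    also have "norm (S (\<delta> p - \<delta> q)) = norm (S (p - q))"
      by (rule digits_norm[OF S(1) \<delta>(1)])
    finally show ?thesis .
  qed
  have "tile_g A B ` tile A B = (\<Union>\<delta>\<in>digits B. \<delta> ` tile A B)"
    by (rule tile_props[OF assms(1,2)])
  then have T: "tile A B = (\<Union>f\<in>F. f ` tile A B)"
    unfolding F_def using tile_eq_iff[OF B0] by blast
  have "(\<Union>f\<in>F. f ` K) = tile_ginv A B ` (\<Union>\<delta>\<in>digits B. \<delta> ` K)" unfolding F_def by auto
  also have "\<dots> \<subseteq> K" unfolding UN_digits[OF assms(1)] using tr rf by auto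
  finally have "(\<Union>f\<in>F. f ` K) \<subseteq> K" .
  then show ?thesis
    using attractor_subset[OF S(1,2) _ S(4) con tile_props(2)[OF assms(1,2)] K] T S(3) by auto
qed

section \<open>Strict bounds on the tile for \<open>n = - A \<ge> 3\<close>\<close>

locale steep_tile =
  fixes n B :: int
  assumes n3: "n \<ge> 3" and B4: "B \<ge> 4" and nB: "n \<le> B" and B2n: "2 * n < B + 3"
begin

abbreviation "T \<equiv> tile (- n) B"

lemma Bge: "B \<ge> 2" "\<bar>- n\<bar> \<le> B" using n3 B4 nB by auto

lemmas T_props = tile_props[OF Bge]

text \<open>The set equation at a single point: the pairs on the right are \<open>g (x, y)\<close>
  with the digit undone. Later case distinctions unfold points by this step.\<close>

lemma mem_T:
  "(x, y) \<in> T \<longleftrightarrow> (\<exists>k. 0 \<le> k \<and> k \<le> B - 2 \<and> (- of_int B * y + (of_int B - 1) / 2 - of_int k, x + of_int n * y) \<in> T)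
     \<or> (of_int B * y - (of_int B - 1) / 2, - x - of_int n * y) \<in> T"
proof -
  have inj: "inj (tile_g (- n) B)"
    using tile_ginv_g[of B "- n"] B4 by (intro inj_on_inverseI[of _ "tile_ginv (- n) B"]) auto
  have "(x, y) \<in> T \<longleftrightarrow> tile_g (- n) B (x, y) \<in> tile_g (- n) B ` T"
    using inj by (simp add: inj_image_mem_iff)
  also have "\<dots> \<longleftrightarrow> tile_g (- n) B (x, y) \<in> {(x + of_int k, y) |x y k. (x, y) \<in> T \<and> 0 \<le> k \<and> k \<le> B - 2}
      \<or> tile_g (- n) B (x, y) \<in> uminus ` T"
    unfolding T_props(3) UN_digits[OF Bge(1)] by blast
  also have "tile_g (- n) B (x, y) \<in> {(x + of_int k, y) |x y k. (x, y) \<in> T \<and> 0 \<le> k \<and> k \<le> B - 2}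
     \<longleftrightarrow> (\<exists>k. 0 \<le> k \<and> k \<le> B - 2 \<and> (- of_int B * y + (of_int B - 1) / 2 - of_int k, x + of_int n * y) \<in> T)" (is "?a \<longleftrightarrow> ?b")
  proof
    assume ?a
    then obtain x' y' k where k: "- of_int B * y + (of_int B - 1) / 2 = x' + of_int k" "x + of_int n * y = y'"
      "(x', y') \<in> T" "0 \<le> k" "k \<le> B - 2"
      by (auto simp: tile_g_def)
    then have "x' = - of_int B * y + (of_int B - 1) / 2 - of_int k" by simp
    then show ?b using k by blast
  next
    assume ?b
    then obtain k where "0 \<le> k" "k \<le> B - 2" "(- of_int B * y + (of_int B - 1) / 2 - of_int k, x + of_int n * y) \<in> T"
      by blast
    then show ?a unfolding tile_g_def
      by (intro CollectI exI[of _ "- of_int B * y + (of_int B - 1) / 2 - of_int k"] exI[of _ "x + of_int n * y"] exI[of _ k]) auto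
  qed
  also have "tile_g (- n) B (x, y) \<in> uminus ` T \<longleftrightarrow> (of_int B * y - (of_int B - 1) / 2, - x - of_int n * y) \<in> T" (is "?c \<longleftrightarrow> ?d")
  proof -
    have "?c \<longleftrightarrow> - tile_g (- n) B (x, y) \<in> T" by (metis add.inverse_inverse image_iff)
    then show ?thesis by (simp add: tile_g_def algebra_simps)
  qed
  finally show ?thesis .
qed

text \<open>The trapping region bounds \<open>x\<close>, \<open>y\<close> and \<open>x + n y\<close>
  together. At the image of \<open>(u, v)\<close> under the inverse of \<open>g\<close> the value of
  \<open>x + n y\<close> is \<open>v\<close>. So the bound on \<open>y\<close> renews the one on
  \<open>x + n y\<close>, the bound on \<open>x\<close> renews the one on \<open>y\<close>, and only
  the bound on \<open>x\<close> needs work.\<close>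

lemma abs_y_lt_1:
  assumes "(x, y) \<in> T"
  shows "\<bar>y\<bar> < 1"
proof (cases "n = 3 \<and> B = 4")
  case False
  define N where "N = real_of_int n"
  define b where "b = real_of_int B"
  have N: "N \<ge> 3" unfolding N_def using n3 by linarith
  have bN: "b \<ge> 2 * N - 2" unfolding b_def N_def using B2n by linarith
  have b4: "b \<ge> 4" unfolding b_def using B4 by linarith
  \<comment> \<open>The amount by which \<open>X\<close> stays below \<open>(b + 1) / 2\<close>, the
    value at which the bound \<open>W\<close> on \<open>y\<close> would reach 1.\<close>
  define \<eta> where "\<eta> = 1 / (2 * N)"
  have \<eta>: "0 < \<eta>" "\<eta> \<le> 1 / 6" unfolding \<eta>_def using N by (auto simp: field_simps)
  define X where "X = (b + 1) / 2 - \<eta>"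
  define W where "W = 1 - \<eta> / b"
  have W1: "W < 1" "0 < W" unfolding W_def using \<eta> b4 by (auto simp: field_simps)
  have W': "W = ((b - 1) / 2 + X) / b" unfolding W_def X_def using b4 by (simp add: field_simps)
  have X0: "X > 0" unfolding X_def using \<eta> b4 by (simp add: field_simps)
  define K where "K = {(x, y). \<bar>x\<bar> \<le> X \<and> \<bar>y\<bar> \<le> W \<and> \<bar>x + N * y\<bar> \<le> W}"
  have cK: "compact K"
  proof -
    have "K = cbox (- X, - W) (X, W) \<inter> {p. \<bar>fst p + N * snd p\<bar> \<le> W}"
      unfolding K_def by auto
    moreover have "closed {p :: real \<times> real. \<bar>fst p + N * snd p\<bar> \<le> W}"
      by (intro closed_Collect_le continuous_intros)
    ultimately show ?thesis by (simp add: compact_Int_closed)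
  qed
  have K0: "(0, 0) \<in> K" unfolding K_def using X0 W1 by simp
  \<comment> \<open>The new first coordinate is \<open>v - N y'\<close> with \<open>y'\<close> the
    new second one. Writing \<open>v\<close> as \<open>((x + N v) - x) / N\<close> brings in the
    bound on \<open>x + N v\<close> and lets the two contributions of \<open>x\<close> partly
    cancel, with coefficient \<open>N / b - 1 / N\<close>.\<close>
  have main: "\<bar>w / N + x * (N / b - 1 / N)\<bar> + N * (b - 1) / (2 * b) \<le> X" if "\<bar>x\<bar> \<le> X" "\<bar>w\<bar> \<le> W" for x w
  proof -
    have "\<bar>w / N\<bar> \<le> W / N" using that N by (simp add: divide_right_mono)
    moreover have "\<bar>x * (N / b - 1 / N)\<bar> \<le> X * \<bar>N / b - 1 / N\<bar>"
      using that by (simp add: abs_mult mult_right_mono)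
    ultimately have 1: "\<bar>w / N + x * (N / b - 1 / N)\<bar> \<le> W / N + X * \<bar>N / b - 1 / N\<bar>" by linarith
    have "W / N + X * \<bar>N / b - 1 / N\<bar> + N * (b - 1) / (2 * b) \<le> X"
    proof (cases "N / b \<ge> 1 / N")
      case True
      \<comment> \<open>This integer is \<open>2 N\<close> times the slack available for
        \<open>\<eta>\<close>. For \<open>n = 3\<close>, \<open>B = 4\<close> it is 0, which is why
        that pair is treated apart.\<close>
      have int: "(n + 1) * B - 2 * n * n + n - 1 \<ge> 1"
      proof (cases "n = 3")
        case True
        then show ?thesis using False B4 by auto
      next
        case nn: False
        have "(n + 1) * B \<ge> (n + 1) * (2 * n - 2)" using B2n n3 by (intro mult_left_mono) auto
        then show ?thesis using nn n3 by (simp add: algebra_simps)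
      qed
      have "(N + 1) * b - 2 * N * N + N - 1 \<ge> 1"
      proof -
        have "real_of_int ((n + 1) * B - 2 * n * n + n - 1) \<ge> 1" using int by linarith
        then show ?thesis unfolding N_def b_def by simp
      qed
      moreover have "((b + 1) / 2 - N + (b - 1) / (2 * N)) * (2 * N) = (N + 1) * b - 2 * N * N + N - 1"
        using N by (simp add: field_simps)
      ultimately have slack: "((b + 1) / 2 - N + (b - 1) / (2 * N)) * (2 * N) \<ge> 1" by linarith
      have nz: "N > 0" "b > 0" using N b4 by auto
      have c1: "N / b + 1 / (N * b) - 1 / N \<ge> 0"
      proof -
        have "1 / (N * b) \<ge> 0" using nz by simp
        then show ?thesis using True by linarith
      qed
      have "X - (W / N + X * (N / b - 1 / N) + N * (b - 1) / (2 * b))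
          = ((b + 1) / 2 - N + (b - 1) / (2 * N)) - \<eta> * (1 - (N / b + 1 / (N * b) - 1 / N))"
        unfolding X_def W_def using nz by (simp add: field_simps)
      moreover have "(b + 1) / 2 - N + (b - 1) / (2 * N) \<ge> \<eta>"
        unfolding \<eta>_def using slack nz by (simp add: pos_divide_le_eq)
      moreover have "\<eta> * (1 - (N / b + 1 / (N * b) - 1 / N)) \<le> \<eta> * 1"
        using c1 \<eta> by (intro mult_left_mono) auto
      ultimately show ?thesis using True by simp
    next
      case False2: False
      have nz: "N > 0" "b > 0" using N b4 by auto
      have "b > N * N" using False2 nz by (simp add: field_simps)
      then have b9: "b > 9" using N mult_mono[of 3 N 3 N] by simp
      have Xb: "X \<ge> b / 2 + 1 / 3" unfolding X_def using \<eta> by (simp add: field_simps)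
      have iN: "1 / N \<le> 1 / 3" using N by (simp add: field_simps)
      have "W / N \<le> 1 / 3"
      proof -
        have "W / N \<le> 1 / N" using W1 nz by (simp add: divide_right_mono)
        then show ?thesis using iN by linarith
      qed
      note h1 = this
      have h2: "N * (b - 1) / (2 * b) \<le> N / 2"
        using nz by (simp add: field_simps)
      have h3: "X * (N / b) \<ge> N / 2"
      proof -
        have "X * (N / b) \<ge> (b / 2) * (N / b)" using Xb nz by (intro mult_right_mono) auto
        then show ?thesis using nz by simp
      qed
      have h4: "X * (1 / N) \<le> X * (1 / 3)" using iN X0 by (intro mult_left_mono) auto
      have h5: "X * \<bar>N / b - 1 / N\<bar> = X * (1 / N) - X * (N / b)"
        using False2 by (simp add: algebra_simps)
      have "X * \<bar>N / b - 1 / N\<bar> \<le> X * (1 / 3) - N / 2" unfolding h5 by (rule diff_mono[OF h4 h3])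
      then have "W / N + X * \<bar>N / b - 1 / N\<bar> + N * (b - 1) / (2 * b) \<le> 1 / 3 + (X * (1 / 3) - N / 2) + N / 2"
        by (intro add_mono h1 h2)
      also have "\<dots> \<le> X" using Xb b9 by simp
      finally show ?thesis .
    qed
    then show ?thesis using 1 by linarith
  qed
  have yW: "\<bar>((b - 1) / 2 - u) / b\<bar> \<le> W" if "- X \<le> u" "u \<le> X + b - 2" for u
  proof -
    have "\<bar>(b - 1) / 2 - u\<bar> \<le> (b - 1) / 2 + X" using that by (simp add: abs_le_iff field_simps)
    then show ?thesis unfolding W' using b4 by (simp add: divide_right_mono)
  qed
  have step: "tile_ginv (- n) B (u, v) \<in> K"
    if "- X \<le> u" "u \<le> X + b - 2" "\<bar>v\<bar> \<le> W" "\<bar>v - N * (((b - 1) / 2 - u) / b)\<bar> \<le> X" for u v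
  proof -
    have "tile_ginv (- n) B (u, v) = (v - N * (((b - 1) / 2 - u) / b), ((b - 1) / 2 - u) / b)"
      unfolding tile_ginv_def N_def b_def by simp
    then show ?thesis using that yW[OF that(1,2)] unfolding K_def by simp
  qed
  have sub: "v - N * (((b - 1) / 2 - (x + k)) / b) = (x + N * v) / N + x * (N / b - 1 / N) + N * (2 * k - (b - 1)) / (2 * b)" for x v k
    using N b4 by (simp add: field_simps)
  have Fb: "\<bar>N * (2 * r - (b - 1)) / (2 * b)\<bar> \<le> N * (b - 1) / (2 * b)" if "0 \<le> r" "r \<le> b - 2" for r
    using that N b4 by (simp add: abs_mult divide_right_mono mult_left_mono abs_le_iff)
  have "T \<subseteq> K"
  proof (rule tile_subset[OF Bge cK])
    show "K \<noteq> {}" using K0 by auto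
  next
    fix x y k assume xy: "(x, y) \<in> K" and k: "0 \<le> k" "k \<le> B - 2"
    define r where "r = real_of_int k"
    have r: "0 \<le> r" "r \<le> b - 2" unfolding r_def b_def using k by auto
    have K: "\<bar>x\<bar> \<le> X" "\<bar>y\<bar> \<le> W" "\<bar>x + N * y\<bar> \<le> W" using xy unfolding K_def by auto
    have "\<bar>y - N * (((b - 1) / 2 - (x + r)) / b)\<bar> \<le> X"
      unfolding sub using main[OF K(1) K(3)] Fb[OF r] by linarith
    then show "tile_ginv (- n) B (x + of_int k, y) \<in> K"
      using step[of "x + r" y] K r unfolding r_def by (simp add: abs_le_iff)
  next
    fix x y assume xy: "(x, y) \<in> K"
    have K: "\<bar>x\<bar> \<le> X" "\<bar>y\<bar> \<le> W" "\<bar>x + N * y\<bar> \<le> W" using xy unfolding K_def by auto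
    have K': "\<bar>- x\<bar> \<le> X" "\<bar>- x + N * (- y)\<bar> \<le> W" using K by (auto simp: abs_le_iff)
    have "\<bar>- y - N * (((b - 1) / 2 - (- x + 0)) / b)\<bar> \<le> X"
      unfolding sub using main[OF K'] Fb[of 0] b4 by linarith
    then show "tile_ginv (- n) B (- x, - y) \<in> K"
      using step[of "- x" "- y"] K b4 by (simp add: abs_le_iff)
  qed
  then show ?thesis using assms W1 unfolding K_def by auto
next
  case True
  text \<open>Here the symmetric region above only gives \<open>\<bar>y\<bar> \<le> 1\<close>; the part of the tile coming from
    translations and the part coming from the reflection need separate bounds.\<close>
  define K1 where "K1 = {(x :: real, y :: real). - (23/10) \<le> x \<and> x \<le> 6/5 \<and> - (17/40) \<le> y \<and> y \<le> 19/20 \<and> - (17/40) \<le> x + 3 * y \<and> x + 3 * y \<le> 19/20}"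
  define K2 where "K2 = {(x :: real, y :: real). - (39/20) \<le> x \<and> x \<le> 6/5 \<and> - (17/40) \<le> y \<and> y \<le> 19/20 \<and> - (19/20) \<le> x + 3 * y \<and> x + 3 * y \<le> 17/40}"
  have c: "compact {(x :: real, y :: real). a \<le> x \<and> x \<le> b \<and> c \<le> y \<and> y \<le> d \<and> e \<le> x + 3 * y \<and> x + 3 * y \<le> f}" for a b c d e f
  proof -
    have "{(x :: real, y :: real). a \<le> x \<and> x \<le> b \<and> c \<le> y \<and> y \<le> d \<and> e \<le> x + 3 * y \<and> x + 3 * y \<le> f}
       = cbox (a, c) (b, d) \<inter> ({p. e \<le> fst p + 3 * snd p} \<inter> {p. fst p + 3 * snd p \<le> f})"
      by auto
    moreover have "closed ({p :: real \<times> real. e \<le> fst p + 3 * snd p} \<inter> {p. fst p + 3 * snd p \<le> f})"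
      by (intro closed_Int closed_Collect_le continuous_intros)
    ultimately show ?thesis by (simp add: compact_Int_closed)
  qed
  have g: "tile_ginv (- n) B (u, v) = (v + 3 / 4 * u - 9 / 8, 3 / 8 - u / 4)" for u v
    by (simp add: True tile_ginv_def field_simps)
  have "T \<subseteq> K1 \<union> K2"
  proof (rule tile_subset[OF Bge])
    show "compact (K1 \<union> K2)" unfolding K1_def K2_def by (intro compact_Un c)
    have "(0, 0) \<in> K1" unfolding K1_def by simp
    then show "K1 \<union> K2 \<noteq> {}" by blast
  next
    fix x y k assume xy: "(x, y) \<in> K1 \<union> K2" and k: "0 \<le> k" "k \<le> B - 2"
    have r: "0 \<le> real_of_int k" "real_of_int k \<le> 2" using k True by auto
    have "tile_ginv (- n) B (x + r, y) \<in> K1" if "0 \<le> r" "r \<le> 2" for r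
      using xy that unfolding g K1_def K2_def by (auto simp: add_divide_distrib)
    from this[OF r] have "tile_ginv (- n) B (x + of_int k, y) \<in> K1" .
    then show "tile_ginv (- n) B (x + of_int k, y) \<in> K1 \<union> K2" by blast
  next
    fix x y assume xy: "(x, y) \<in> K1 \<union> K2"
    have "tile_ginv (- n) B (- x, - y) \<in> K2"
      using xy unfolding g K1_def K2_def by (auto simp: add_divide_distrib diff_divide_distrib)
    then show "tile_ginv (- n) B (- x, - y) \<in> K1 \<union> K2" by blast
  qed
  then show ?thesis using assms unfolding K1_def K2_def by auto
qed

text \<open>By the set equation \<open>x + n y\<close> is, up to sign, the second coordinate of
  another point of the tile.\<close>

lemma abs_w_lt_1:
  assumes "(x, y) \<in> T"
  shows "\<bar>x + of_int n * y\<bar> < 1"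
proof -
  obtain a where "(a, x + of_int n * y) \<in> T \<or> (a, - x - of_int n * y) \<in> T" using assms mem_T[of x y] by blast
  then show ?thesis using abs_y_lt_1[of a "x + of_int n * y"] abs_y_lt_1[of a "- x - of_int n * y"] by auto
qed

text \<open>\<open>om\<close> is \<open>x + n y\<close> evaluated at the image under \<open>g\<close>.\<close>

definition om :: "real \<Rightarrow> real \<Rightarrow> real" where
  "om x y = - of_int B * y + (of_int B - 1) / 2 + of_int n * (x + of_int n * y)"

text \<open>On the piece with digit \<open>k\<close> the number \<open>om - k\<close> is a value of
  \<open>x + n y\<close> on the tile, on the reflected piece \<open>- om\<close> is. So
  \<open>om\<close> has distance less than 1 from the interval from 0 to
  \<open>B - 2\<close>.\<close>

lemma om_range:
  assumes "(x, y) \<in> T"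
  shows "- 1 < om x y" "om x y < of_int B - 1"
proof -
  have B: "real_of_int B \<ge> 4" using B4 by linarith
  have "- 1 < om x y \<and> om x y < of_int B - 1"
    using assms unfolding mem_T[of x y]
  proof (elim disjE exE conjE)
    fix k assume k: "0 \<le> k" "k \<le> B - 2" "(- of_int B * y + (of_int B - 1) / 2 - of_int k, x + of_int n * y) \<in> T"
    have "0 \<le> real_of_int k" "real_of_int k \<le> of_int B - 2" using k(1,2) by linarith+
    then show ?thesis using abs_w_lt_1[OF k(3)] unfolding om_def by (auto simp: abs_less_iff)
  next
    assume "(of_int B * y - (of_int B - 1) / 2, - x - of_int n * y) \<in> T"
    then have "\<bar>of_int B * y - (of_int B - 1) / 2 + of_int n * (- x - of_int n * y)\<bar> < 1" by (rule abs_w_lt_1)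
    moreover have "of_int B * y - (of_int B - 1) / 2 + of_int n * (- x - of_int n * y) = - om x y"
      unfolding om_def by (simp add: algebra_simps)
    ultimately show ?thesis using B by (auto simp: abs_less_iff)
  qed
  then show "- 1 < om x y" "om x y < of_int B - 1" by auto
qed

lemma om_affine: "om (x + s) (y + t) = om x y - of_int B * t + of_int n * (s + of_int n * t)"
  unfolding om_def by (simp add: algebra_simps)

lemma om_reflect: "om (s - x) (t - y) = of_int B - 1 - om x y - of_int B * t + of_int n * (s + of_int n * t)"
  unfolding om_def by (simp add: field_simps)

text \<open>The two values of \<open>om\<close> would add up to \<open>2 B - 1\<close>, and in the
  next lemma they would differ by \<open>B\<close>. Both are impossible in an open interval of
  length \<open>B\<close> with upper end \<open>B - 1\<close>.\<close>

lemma no_sum_n: "(x, y) \<in> T \<Longrightarrow> (of_int n - x, - 1 - y) \<in> T \<Longrightarrow> False"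
  using om_range[of x y] om_range[of "of_int n - x" "- 1 - y"] unfolding om_reflect by simp

lemma no_diff_n: "(x, y) \<in> T \<Longrightarrow> (x + of_int n, y - 1) \<in> T \<Longrightarrow> False"
  using om_range[of x y] om_range[of "x + of_int n" "y - 1"] om_affine[of x "of_int n" y "- 1"] by simp

lemma mem_T_cases:
  assumes "(x, y) \<in> T" "a = - of_int B * y + (of_int B - 1) / 2" "v = x + of_int n * y"
  obtains k where "0 \<le> k" "k \<le> B - 2" "(a - of_int k, v) \<in> T" | "(- a, - v) \<in> T"
  using assms mem_T[of x y] by (auto simp: algebra_simps)

lemma mem_T_shift:
  assumes "(a - of_int k, v) \<in> T" "0 \<le> k" "k \<le> B - 2"
    "a = - of_int B * y + (of_int B - 1) / 2" "v = x + of_int n * y"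
  shows "(x, y) \<in> T"
  using assms mem_T[of x y] by auto

lemma mem_T_refl:
  assumes "(- a, - v) \<in> T" "a = - of_int B * y + (of_int B - 1) / 2" "v = x + of_int n * y"
  shows "(x, y) \<in> T"
  using assms mem_T[of x y] by (auto simp: algebra_simps)

lemma w_bound: "(x, y) \<in> T \<Longrightarrow> - 1 < x + of_int n * y \<and> x + of_int n * y < 1"
  using abs_w_lt_1[of x y] by (auto simp: abs_less_iff)

section \<open>The extremal pair \<open>n = 3\<close>, \<open>B = 4\<close>\<close>

context
  assumes n_eq: "n = 3" and B_eq: "B = 4"
begin

lemma om_range_34: "(x, y) \<in> T \<Longrightarrow> - 1 < om x y \<and> om x y < 3"
  using om_range[of x y] by (simp add: B_eq)

lemma no_sum_4_m1: "(x, y) \<in> T \<Longrightarrow> (4 - x, - 1 - y) \<in> T \<Longrightarrow> False"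
  using om_range_34[of x y] om_range_34[of "4 - x" "- 1 - y"] unfolding om_reflect by (simp add: n_eq B_eq)

lemma no_sum_m4_1: "(x, y) \<in> T \<Longrightarrow> (- 4 - x, 1 - y) \<in> T \<Longrightarrow> False"
  using om_range_34[of x y] om_range_34[of "- 4 - x" "1 - y"] unfolding om_reflect by (simp add: n_eq B_eq)

lemma no_diff_4_m1: "(x, y) \<in> T \<Longrightarrow> (x + 4, y - 1) \<in> T \<Longrightarrow> False"
  using om_range_34[of x y] om_range_34[of "x + 4" "y - 1"] om_affine[of x 4 y "- 1"] by (simp add: n_eq B_eq)

lemma no_sum_3_m1: "(x, y) \<in> T \<Longrightarrow> (3 - x, - 1 - y) \<in> T \<Longrightarrow> False"
  using no_sum_n[of x y] by (simp add: n_eq)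

lemma no_diff_3_m1: "(x, y) \<in> T \<Longrightarrow> (x + 3, y - 1) \<in> T \<Longrightarrow> False"
  using no_diff_n[of x y] by (simp add: n_eq)

lemma w34: "(x, y) \<in> T \<Longrightarrow> - 1 < x + 3 * y \<and> x + 3 * y < 1"
  using w_bound[of x y] by (simp add: n_eq)

lemma cases34:
  assumes "(x, y) \<in> T" "a = 3 / 2 - 4 * y" "v = x + 3 * y"
  obtains "(a, v) \<in> T" | "(a - 1, v) \<in> T" | "(a - 2, v) \<in> T" | "(- a, - v) \<in> T"
proof (rule mem_T_cases[OF assms(1), of a v])
  show "a = - of_int B * y + (of_int B - 1) / 2" "v = x + of_int n * y" using assms n_eq B_eq by auto
next
  fix k assume k: "0 \<le> k" "k \<le> B - 2" "(a - of_int k, v) \<in> T"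
  then have "k = 0 \<or> k = 1 \<or> k = 2" using B_eq by auto
  then show thesis using k(3) that(1-3) by auto
qed (rule that(4))

text \<open>For this vector the range of \<open>om\<close> gives no contradiction, so both points
  are unfolded once. Of the sixteen pairs of pieces most violate the bound on
  \<open>x + 3 y\<close>; the others have sum \<open>(4, - 1)\<close> or \<open>(3, - 1)\<close>,
  which is already excluded.\<close>

lemma no_sum_2_m1:
  assumes P: "(x, y) \<in> T" and Q: "(2 - x, - 1 - y) \<in> T"
  shows False
proof -
  define a where "a = 3 / 2 - 4 * y"
  define v where "v = x + 3 * y"
  have Q': "7 - a = 3 / 2 - 4 * (- 1 - y)" "- 1 - v = 2 - x + 3 * (- 1 - y)"
    unfolding a_def v_def by auto
  show False
  proof (rule cases34[OF P a_def v_def])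
    assume p: "(a, v) \<in> T"
    show False
    proof (rule cases34[OF Q Q'])
      assume q: "(7 - a, - 1 - v) \<in> T"
      show False using w34[OF p] w34[OF q] by auto
    next
      assume q: "(7 - a - 1, - 1 - v) \<in> T"
      show False using w34[OF p] w34[OF q] by auto
    next
      assume q: "(7 - a - 2, - 1 - v) \<in> T"
      show False using w34[OF p] w34[OF q] by auto
    next
      assume q: "(- (7 - a), - (- 1 - v)) \<in> T"
      show False using w34[OF p] w34[OF q] by auto
    qed
  next
    assume p: "(a - 1, v) \<in> T"
    show False
    proof (rule cases34[OF Q Q'])
      assume q: "(7 - a, - 1 - v) \<in> T"
      show False using w34[OF p] w34[OF q] by auto
    next
      assume q: "(7 - a - 1, - 1 - v) \<in> T"
      show False using w34[OF p] w34[OF q] by auto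
    next
      assume q: "(7 - a - 2, - 1 - v) \<in> T"
      show False using no_sum_4_m1[OF p] q by (simp add: algebra_simps)
    next
      assume q: "(- (7 - a), - (- 1 - v)) \<in> T"
      show False using w34[OF p] w34[OF q] by auto
    qed
  next
    assume p: "(a - 2, v) \<in> T"
    show False
    proof (rule cases34[OF Q Q'])
      assume q: "(7 - a, - 1 - v) \<in> T"
      show False using w34[OF p] w34[OF q] by auto
    next
      assume q: "(7 - a - 1, - 1 - v) \<in> T"
      show False using no_sum_4_m1[OF p] q by (simp add: algebra_simps)
    next
      assume q: "(7 - a - 2, - 1 - v) \<in> T"
      show False using no_sum_3_m1[OF p] q by (simp add: algebra_simps)
    next
      assume q: "(- (7 - a), - (- 1 - v)) \<in> T"
      show False using w34[OF p] w34[OF q] by auto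
    qed
  next
    assume p: "(- a, - v) \<in> T"
    show False
    proof (rule cases34[OF Q Q'])
      assume q: "(7 - a, - 1 - v) \<in> T"
      show False using w34[OF p] w34[OF q] by auto
    next
      assume q: "(7 - a - 1, - 1 - v) \<in> T"
      show False using w34[OF p] w34[OF q] by auto
    next
      assume q: "(7 - a - 2, - 1 - v) \<in> T"
      show False using w34[OF p] w34[OF q] by auto
    next
      assume q: "(- (7 - a), - (- 1 - v)) \<in> T"
      show False using w34[OF p] w34[OF q] by auto
    qed
  qed
qed

text \<open>Of the sixteen pairs of pieces only one survives, and its points again differ by
  \<open>(2, - 1)\<close>. Such pairs do occur (\<open>special_points\<close>), so they can only be
  pinned down.\<close>

lemma diff_2_m1:
  assumes P: "(x, y) \<in> T" and Q: "(x + 2, y - 1) \<in> T"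
  shows "(3 / 2 - 4 * y, x + 3 * y) \<in> T \<and> (3 / 2 - 4 * y + 2, x + 3 * y - 1) \<in> T"
proof -
  define a where "a = 3 / 2 - 4 * y"
  define v where "v = x + 3 * y"
  have Q': "a + 4 = 3 / 2 - 4 * (y - 1)" "v - 1 = x + 2 + 3 * (y - 1)"
    unfolding a_def v_def by auto
  have "(a, v) \<in> T \<and> (a + 2, v - 1) \<in> T" (is ?g)
  proof (rule cases34[OF P a_def v_def])
    assume p: "(a, v) \<in> T"
    show ?g
    proof (rule cases34[OF Q Q'])
      assume q: "(a + 4, v - 1) \<in> T"
      show ?g using no_diff_4_m1[OF p] q by simp
    next
      assume q: "(a + 4 - 1, v - 1) \<in> T"
      show ?g using no_diff_3_m1[OF p] q by (simp add: algebra_simps)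
    next
      assume q: "(a + 4 - 2, v - 1) \<in> T"
      show ?g using p q by (simp add: algebra_simps)
    next
      assume q: "(- (a + 4), - (v - 1)) \<in> T"
      have e: "- (a + 4) = - 4 - a" "- (v - 1) = 1 - v" by simp_all
      show ?g using no_sum_m4_1[OF p] q unfolding e by blast
    qed
  next
    assume p: "(a - 1, v) \<in> T"
    show ?g
    proof (rule cases34[OF Q Q'])
      assume q: "(a + 4, v - 1) \<in> T"
      show ?g using w34[OF p] w34[OF q] by auto
    next
      assume q: "(a + 4 - 1, v - 1) \<in> T"
      show ?g using no_diff_4_m1[OF p] q by (simp add: algebra_simps)
    next
      assume q: "(a + 4 - 2, v - 1) \<in> T"
      show ?g using no_diff_3_m1[OF p] q by (simp add: algebra_simps)
    next
      assume q: "(- (a + 4), - (v - 1)) \<in> T"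
      show ?g using w34[OF p] w34[OF q] by auto
    qed
  next
    assume p: "(a - 2, v) \<in> T"
    show ?g
    proof (rule cases34[OF Q Q'])
      assume q: "(a + 4, v - 1) \<in> T"
      show ?g using w34[OF p] w34[OF q] by auto
    next
      assume q: "(a + 4 - 1, v - 1) \<in> T"
      show ?g using w34[OF p] w34[OF q] by auto
    next
      assume q: "(a + 4 - 2, v - 1) \<in> T"
      show ?g using no_diff_4_m1[OF p] q by (simp add: algebra_simps)
    next
      assume q: "(- (a + 4), - (v - 1)) \<in> T"
      show ?g using w34[OF p] w34[OF q] by auto
    qed
  next
    assume p: "(- a, - v) \<in> T"
    show ?g
    proof (rule cases34[OF Q Q'])
      assume q: "(a + 4, v - 1) \<in> T"
      show ?g using no_sum_4_m1[OF p] q by (simp add: algebra_simps)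
    next
      assume q: "(a + 4 - 1, v - 1) \<in> T"
      show ?g using no_sum_3_m1[OF p] q by (simp add: algebra_simps)
    next
      assume q: "(a + 4 - 2, v - 1) \<in> T"
      show ?g using no_sum_2_m1[OF p] q by (simp add: algebra_simps)
    next
      assume q: "(- (a + 4), - (v - 1)) \<in> T"
      show ?g using no_diff_4_m1[OF q] p by (simp add: algebra_simps)
    qed
  qed
  then show ?thesis unfolding a_def v_def .
qed

text \<open>The unfolded pair confines \<open>a + 3 v\<close> to the interval from 0 to 1, and then
  the bound on \<open>x + 3 y\<close> rules out every piece for the third point.\<close>

lemma no_triple_34:
  assumes P: "(x, y) \<in> T" and Q: "(x + 2, y - 1) \<in> T" and R: "(- 3 - x, 1 - y) \<in> T"
  shows False
proof -
  define a where "a = 3 / 2 - 4 * y"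
  define v where "v = x + 3 * y"
  have E: "(a, v) \<in> T" "(a + 2, v - 1) \<in> T" using diff_2_m1[OF P Q] unfolding a_def v_def by auto
  have R': "- 1 - a = 3 / 2 - 4 * (1 - y)" "- v = - 3 - x + 3 * (1 - y)"
    unfolding a_def v_def by auto
  show False
    apply (rule cases34[OF R R'])
    using w34[OF E(1)] w34[OF E(2)] w34[of "- 1 - a" "- v"] w34[of "- 1 - a - 1" "- v"] w34[of "- 1 - a - 2" "- v"]
      w34[of "- (- 1 - a)" "- (- v)"]
    by auto
qed

end

text \<open>With \<open>(a, v) = g(x, y)\<close>, the second hypothesis says that \<open>- (x, y) - (1, 0)\<close> lies in the piece of the
  tile with digit \<open>B - n\<close>; the conclusions say that \<open>- (x, y)\<close> meets no other part of the row.\<close>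

lemma separation:
  assumes P: "(x, y) \<in> T" and a: "a = - of_int B * y + (of_int B - 1) / 2" and v: "v = x + of_int n * y"
    and S: "(of_int n - 1 - a, - 1 - v) \<in> T"
  shows "(- x, - y) \<notin> T"
    and "\<And>l. 0 \<le> l \<Longrightarrow> l \<le> B - 2 \<Longrightarrow> l \<noteq> B - n \<Longrightarrow> (of_int B - 1 - a - of_int l, - 1 - v) \<notin> T"
    and "(a - (of_int B - 1), 1 + v) \<notin> T"
proof -
  define w where "w = a + of_int n * v"
  have B4': "real_of_int B \<ge> 4" using B4 by linarith
  \<comment> \<open>At the point in \<open>S\<close> the value of \<open>x + n y\<close> is
    \<open>- 1 - w\<close>, so \<open>w\<close> lies between -2 and 0. This leaves only digit 0 and
    the reflection for \<open>(x, y)\<close>, which in turn gives \<open>- 1 < w\<close>.\<close>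
  have w0: "- 2 < w" "w < 0" using w_bound[OF S] unfolding w_def by (auto simp: algebra_simps)
  have dig: "(a, v) \<in> T \<or> (- a, - v) \<in> T"
  proof (rule mem_T_cases[OF P a v])
    fix k assume k: "0 \<le> k" "k \<le> B - 2" "(a - of_int k, v) \<in> T"
    have "real_of_int k < 1" using w_bound[OF k(3)] w0 unfolding w_def by (auto simp: algebra_simps)
    then have "k = 0" using k(1) by linarith
    then show ?thesis using k(3) by simp
  qed auto
  then have w1: "- 1 < w" using w_bound[of a v] w_bound[of "- a" "- v"] unfolding w_def by auto
  show "(- x, - y) \<notin> T"
  proof
    assume "(- x, - y) \<in> T"
    moreover have "of_int B - 1 - a = - of_int B * (- y) + (of_int B - 1) / 2" "- v = - x + of_int n * (- y)"
      unfolding a v by (auto simp: field_simps)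
    ultimately show False
    proof (rule mem_T_cases)
      fix k assume k: "0 \<le> k" "k \<le> B - 2" "(of_int B - 1 - a - of_int k, - v) \<in> T"
      have "real_of_int k \<le> of_int B - 2" using k(2) by linarith
      then show False using w_bound[OF k(3)] w0 unfolding w_def by (auto simp: algebra_simps)
    next
      assume "(- (of_int B - 1 - a), - (- v)) \<in> T"
      from w_bound[OF this] show False using w0 B4' unfolding w_def by (auto simp: algebra_simps)
    qed
  qed
  show "(of_int B - 1 - a - of_int l, - 1 - v) \<notin> T" if l: "0 \<le> l" "l \<le> B - 2" "l \<noteq> B - n" for l
  proof
    assume Q: "(of_int B - 1 - a - of_int l, - 1 - v) \<in> T"
    \<comment> \<open>The value of \<open>x + n y\<close> at this point is the integer
      \<open>B - 1 - l - n\<close> minus \<open>w\<close>. As \<open>w\<close> lies between -1 and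
      0, the integer is -1, which means \<open>l = B - n\<close>, or 0, which leads to a sum or
      difference excluded above.\<close>
    have "- 1 < real_of_int B - 1 - of_int l - of_int n - w" "real_of_int B - 1 - of_int l - of_int n - w < 1"
      using w_bound[OF Q] unfolding w_def by (auto simp: algebra_simps)
    then have "real_of_int (B - 1 - l - n) < 1" "- 2 < real_of_int (B - 1 - l - n)" using w0 w1 by simp_all
    then have "B - 1 - l - n < 1" "- 2 < B - 1 - l - n" by linarith+
    then have "l = B - 1 - n" using l(3) by linarith
    then have e: "of_int B - 1 - a - of_int l = of_int n - a" by simp
    have "(of_int n - a, - 1 - v) \<in> T" using Q unfolding e .
    moreover have "(of_int n - a, - 1 - v) = (- a + of_int n, - v - 1)" by simp
    ultimately show False using dig no_sum_n[of a v] no_diff_n[of "- a" "- v"] by metis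
  qed
  show "(a - (of_int B - 1), 1 + v) \<notin> T"
  proof
    assume Q: "(a - (of_int B - 1), 1 + v) \<in> T"
    \<comment> \<open>The bound on \<open>x + n y\<close> is contradictory unless
      \<open>B - n < 2\<close>, and the hypotheses allow this only for \<open>n = 3\<close>,
      \<open>B = 4\<close>.\<close>
    have "- 1 < w - (of_int B - 1) + of_int n" using w_bound[OF Q] unfolding w_def by (auto simp: algebra_simps)
    then have "real_of_int (B - n) < 2" using w0 by simp
    then have "B - n < 2" by linarith
    then have e: "n = 3" "B = 4" using B2n n3 B4 by linarith+
    from dig show False
    proof
      assume "(a, v) \<in> T"
      moreover have "(2 - a, - 1 - v) \<in> T" using S e by simp
      ultimately show False using no_sum_2_m1[OF e] by blast
    next
      assume "(- a, - v) \<in> T"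
      moreover have "(of_int n - 1 - a, - 1 - v) = (- a + 2, - v - 1)" by (simp add: e)
      then have "(- a + 2, - v - 1) \<in> T" using S by metis
      moreover have "(a - (of_int B - 1), 1 + v) = (- 3 - (- a), 1 - (- v))" by (simp add: e)
      then have "(- 3 - (- a), 1 - (- v)) \<in> T" using Q by metis
      ultimately show False using no_triple_34[OF e] by blast
    qed
  qed
qed

end

section \<open>Points at which copies of the tile meet\<close>

lemma fixed_point_in_tile:
  assumes "B \<ge> 2" "\<bar>A\<bar> \<le> B" "0 \<le> k" "k \<le> B - 2" "tile_g A B (x, y) = (x + of_int k, y)"
  shows "(x, y) \<in> tile A B"
proof -
  obtain S :: "real \<times> real \<Rightarrow> real \<times> real" and lam where S: "linear S" "inj S" "0 < lam" "lam < 1"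
    "\<And>p q. norm (S (p - q)) \<le> lam * norm (S (tile_g A B p - tile_g A B q))"
    using g_expands[OF assms(1,2)] by blast
  have B0: "B \<noteq> 0" using assms by auto
  \<comment> \<open>The fixed point alone satisfies the inclusion asked for by
    \<open>attractor_subset\<close>, for the system that consists of this one map.\<close>
  define f where "f = (\<lambda>(x, y). tile_ginv A B (x + of_int k, y))"
  have "f (x, y) = (x, y)" unfolding f_def using assms(5) tile_ginv_g[OF B0] by (metis case_prod_conv)
  then have 1: "{(x, y)} \<subseteq> (\<Union>g\<in>{f}. g ` {(x, y)})" by simp
  have con: "norm (S (g p - g q)) \<le> lam * norm (S (p - q))" if "g \<in> {f}" for g p q
    using S(5)[of "f p" "f q"] that B0 by (cases p; cases q) (simp add: f_def tile_g_ginv)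
  have "(\<Union>g\<in>{f}. g ` tile A B) \<subseteq> tile A B"
  proof clarsimp
    fix u v assume "(u, v) \<in> tile A B"
    then have "(u + of_int k, v) \<in> tile_g A B ` tile A B"
      unfolding tile_props(3)[OF assms(1,2)] UN_digits[OF assms(1)] using assms(3,4) by blast
    then show "f (u, v) \<in> tile A B" unfolding f_def using tile_ginv_g[OF B0] by force
  qed
  then have "{(x, y)} \<subseteq> tile A B"
    using attractor_subset[OF S(1,2) _ S(4) con _ tile_props(2,1)[OF assms(1,2)] 1] S(3) by auto
  then show ?thesis by simp
qed

context steep_tile
begin

text \<open>The fixed points of the pieces with digits 0 and \<open>B - n + 1\<close>. All
  incidences needed below are obtained from this pair by pulling it back through
  \<open>g\<close>.\<close>

lemma special_points:
  obtains x y where "(x, y) \<in> T" "(x + of_int n - 1, y - 1) \<in> T"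
proof -
  have nB1: "n + 1 \<le> B" using n3 B4 B2n by linarith
  then have pos: "real_of_int B + 1 - of_int n > 0" by linarith
  define y where "y = (real_of_int B - 1) / 2 / (of_int B + 1 - of_int n)"
  define x where "x = (1 - of_int n) * y"
  have y: "y * (of_int B + 1 - of_int n) = (real_of_int B - 1) / 2" 
    unfolding y_def using pos by (metis less_irrefl nonzero_eq_divide_eq)
  have "tile_g (- n) B (x, y) = (x + of_int 0, y)"
    using y unfolding tile_g_def x_def by (simp add: field_simps)
  then have 1: "(x, y) \<in> T" using fixed_point_in_tile[OF Bge, of 0 x y] B4 by simp
  have "tile_g (- n) B (x + of_int n - 1, y - 1) = (x + of_int n - 1 + of_int (B - n + 1), y - 1)"
    using y unfolding tile_g_def x_def by (simp add: field_simps)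
  then have "(x + of_int n - 1, y - 1) \<in> T" using fixed_point_in_tile[OF Bge, of "B - n + 1"] nB1 n3 by simp
  with 1 show ?thesis by (rule that)
qed

lemma g_surj:
  fixes a v :: real
  obtains x y where "a = - of_int B * y + (of_int B - 1) / 2" "v = x + of_int n * y"
proof -
  have "real_of_int B \<noteq> 0" using B4 by simp
  then show ?thesis
    using that[of "((of_int B - 1) / 2 - a) / of_int B" "v - of_int n * (((of_int B - 1) / 2 - a) / of_int B)"] by auto
qed

text \<open>The linear part of \<open>g\<close> sends \<open>(1, 0)\<close> to
  \<open>(0, 1)\<close>. Adding the digits \<open>n - 1\<close> and 0 to the special pair produces
  two points with exactly this difference. Consequently neighbouring translates in the row
  meet.\<close>

lemma adjacent_points: obtains x y where "(x, y) \<in> T" "(x - 1, y) \<in> T"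
proof -
  obtain p q where pq: "(p, q) \<in> T" "(p + of_int n - 1, q - 1) \<in> T" by (rule special_points)
  obtain x y where xy: "p + of_int (n - 1) = - of_int B * y + (of_int B - 1) / 2" "q = x + of_int n * y"
    by (rule g_surj)
  have "(x, y) \<in> T" by (rule mem_T_shift[where k = "n - 1", OF _ _ _ xy]) (use pq(1) n3 B2n B4 in auto)
  moreover have "(x - 1, y) \<in> T"
    by (rule mem_T_shift[of "p + of_int (n - 1)" 0 "q - 1"]) (use pq(2) xy B4 in \<open>auto simp: algebra_simps\<close>)
  ultimately show ?thesis by (rule that)
qed

lemma symmetric_point: obtains x y where "(x, y) \<in> T" "(- x, - y) \<in> T"
proof -
  obtain p q where pq: "(p, q) \<in> T" "(p - 1, q) \<in> T" by (rule adjacent_points)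
  obtain x y where xy: "p + of_int (B - 2) = - of_int B * y + (of_int B - 1) / 2" "q = x + of_int n * y"
    by (rule g_surj)
  have "(x, y) \<in> T" by (rule mem_T_shift[where k = "B - 2", OF _ _ _ xy]) (use pq B4 in auto)
  moreover have "(- x, - y) \<in> T"
    by (rule mem_T_refl[of "1 - p" "- q"]) (use pq xy in \<open>auto simp: field_simps\<close>)
  ultimately show ?thesis by (rule that)
qed

theorem not_disk_like: "\<not> disk_like T"
proof
  assume "disk_like T"
  then have hom: "T homeomorphic cball (0 :: real \<times> real) 1" unfolding disk_like_def .
  have conT: "connected T" using homeomorphic_connectedness[OF hom] by simp
  have uniT: "unicoherent T" using homeomorphic_unicoherent_eq[OF hom] convex_imp_unicoherent by auto
  have clT: "closed T" using T_props(2) compact_imp_closed by blast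
  \<comment> \<open>With the sign changed, the reflected copy in the set equation is
    \<open>T\<close> itself and the row of translates becomes \<open>R\<close>.\<close>
  define \<phi> where "\<phi> = (\<lambda>p. - tile_g (- n) B p)"
  define U where "U = \<phi> ` T"
  define D where "D = (\<lambda>k::int. {(x, y). (- x - of_int k, - y) \<in> T})"
  define R where "R = (\<Union>k\<in>{0..B - 2}. D k)"
  have D_img: "D k = (\<lambda>p. - (p + (of_int k, 0))) ` T" for k
  proof -
    have "(x, y) \<in> (\<lambda>p. - (p + (of_int k, 0))) ` T" if "(- x - of_int k, - y) \<in> T" for x y
      using that by (intro image_eqI[of _ _ "(- x - of_int k, - y)"]) auto
    then show ?thesis unfolding D_def by force
  qed
  have conD: "connected (D k)" for k
    unfolding D_img by (intro connected_continuous_image conT continuous_intros)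
  have compD: "compact (D k)" for k
    unfolding D_img by (intro compact_continuous_image T_props(2) continuous_intros)
  have clD: "closed (D k)" for k using compD compact_imp_closed by blast
  have U_eq: "U = R \<union> T"
  proof -
    have "U = uminus ` (tile_g (- n) B ` T)" unfolding U_def \<phi>_def by auto
    also have "\<dots> = R \<union> T" unfolding T_props(3) UN_digits[OF Bge(1)]
    proof -
      have "uminus ` {(x + of_int k, y) |x y k. (x, y) \<in> T \<and> 0 \<le> k \<and> k \<le> B - 2} = R"
      proof
        show "uminus ` {(x + of_int k, y) |x y k. (x, y) \<in> T \<and> 0 \<le> k \<and> k \<le> B - 2} \<subseteq> R"
          unfolding R_def D_def by auto
        show "R \<subseteq> uminus ` {(x + of_int k, y) |x y k. (x, y) \<in> T \<and> 0 \<le> k \<and> k \<le> B - 2}"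
        proof
          fix p assume "p \<in> R"
          then obtain x y k where p: "p = (x, y)" "0 \<le> k" "k \<le> B - 2" "(- x - of_int k, - y) \<in> T"
            unfolding R_def D_def by auto
          have "p = - (- x - of_int k + of_int k, - y)" using p(1) by simp
          then show "p \<in> uminus ` {(x + of_int k, y) |x y k. (x, y) \<in> T \<and> 0 \<le> k \<and> k \<le> B - 2}"
            using p by blast
        qed
      qed
      then show "uminus ` ({(x + of_int k, y) |x y k. (x, y) \<in> T \<and> 0 \<le> k \<and> k \<le> B - 2} \<union> uminus ` T) = R \<union> T"
        by (simp add: image_Un image_image)
    qed
    finally show ?thesis .
  qed
  have "T homeomorphic U"
  proof (rule homeomorphic_compact[OF T_props(2)])
    show "continuous_on T \<phi>" unfolding \<phi>_def tile_g_def by (intro continuous_intros)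
    show "\<phi> ` T = U" unfolding U_def by simp
    have "B \<noteq> 0" using B4 by simp
    then show "inj_on \<phi> T" by (intro inj_on_inverseI[of _ "\<lambda>q. tile_ginv (- n) B (- q)"]) (simp add: \<phi>_def tile_ginv_g)
  qed
  then have uniU: "unicoherent U" using uniT homeomorphic_unicoherent_eq by blast
  obtain p q where adj: "(p, q) \<in> T" "(p - 1, q) \<in> T" by (rule adjacent_points)
  have conR: "connected R"
  proof -
    have "connected (\<Union>k\<in>{0..int m}. D k)" for m :: nat
    proof (induction m)
      case 0
      then show ?case using conD by simp
    next
      case (Suc m)
      have "{0..int (Suc m)} = insert (int (Suc m)) {0..int m}" by auto
      moreover have "(- p - of_int (int m), - q) \<in> D (int m)" "(- p - of_int (int m), - q) \<in> D (int (Suc m))"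
        using adj unfolding D_def by (auto simp: algebra_simps)
      moreover from this have "(- p - of_int (int m), - q) \<in> (\<Union>k\<in>{0..int m}. D k)" by (intro UN_I[of "int m"]) auto
      ultimately show ?case
        using connected_Un[OF conD[of "int (Suc m)"] Suc.IH] by auto
    qed
    from this[of "nat (B - 2)"] show ?thesis unfolding R_def using B4 by simp
  qed
  have clR: "closed R" unfolding R_def using clD by (intro closed_UN) auto
  have con: "connected (R \<inter> T)"
    by (rule unicoherentD[OF uniU conR conT U_eq]) (auto simp: U_eq clR clT intro!: closed_subset)
  define a where "a = (\<lambda>y::real. - of_int B * y + (of_int B - 1) / 2)"
  define v where "v = (\<lambda>x y::real. x + of_int n * y)"
  \<comment> \<open>\<open>E l\<close> collects the points \<open>p\<close> of \<open>T\<close> for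
    which \<open>- p - (1, 0)\<close> is in the piece with digit \<open>l\<close>, and
    \<open>F\<close> those for which it is in the reflected piece. Together with the points whose
    opposite is in \<open>T\<close> they exhaust \<open>R \<inter> T\<close>; the part that splits
    off is \<open>E (B - n)\<close>.\<close>
  define E where "E = (\<lambda>l::int. {(x, y). (x, y) \<in> T \<and> (of_int B - 1 - a y - of_int l, - 1 - v x y) \<in> T})"
  define F where "F = {(x, y). (x, y) \<in> T \<and> (a y - (of_int B - 1), 1 + v x y) \<in> T}"
  define Z where "Z = (\<Union>l\<in>{0..B - 2} - {B - n}. E l) \<union> F \<union> {(x, y). (x, y) \<in> T \<and> (- x, - y) \<in> T}"
  have clE: "closed (E l)" for l
  proof -
    have "E l = T \<inter> (\<lambda>p. (of_int B - 1 - a (snd p) - of_int l, - 1 - v (fst p) (snd p))) -` T"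
      unfolding E_def by auto
    moreover have "closed \<dots>" unfolding a_def v_def
      by (intro closed_Int clT closed_vimage continuous_intros)
    ultimately show ?thesis by simp
  qed
  have clF: "closed F"
  proof -
    have "F = T \<inter> (\<lambda>p. (a (snd p) - (of_int B - 1), 1 + v (fst p) (snd p))) -` T"
      unfolding F_def by auto
    moreover have "closed \<dots>" unfolding a_def v_def
      by (intro closed_Int clT closed_vimage continuous_intros)
    ultimately show ?thesis by simp
  qed
  have clS: "closed {(x, y). (x, y) \<in> T \<and> (- x, - y) \<in> T}"
  proof -
    have "{(x, y). (x, y) \<in> T \<and> (- x, - y) \<in> T} = T \<inter> (\<lambda>p. - p) -` T" by auto
    moreover have "closed \<dots>" by (intro closed_Int clT closed_vimage continuous_intros)
    ultimately show ?thesis by simp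
  qed
  have clZ: "closed Z" unfolding Z_def using clE clF clS by (intro closed_Un closed_UN) auto
  have Bn: "0 \<le> B - n" "B - n \<le> B - 2" using nB n3 by auto
  have cov: "R \<inter> T = E (B - n) \<union> Z"
  proof
    show "R \<inter> T \<subseteq> E (B - n) \<union> Z"
    proof
      fix p assume "p \<in> R \<inter> T"
      then obtain x y k where p: "p = (x, y)" "0 \<le> k" "k \<le> B - 2" "(- x - of_int k, - y) \<in> T" "(x, y) \<in> T"
        unfolding R_def D_def by auto
      \<comment> \<open>The values of \<open>x + n y\<close> at the two points add up to
        \<open>- k\<close>, and each has modulus below 1.\<close>
      have "real_of_int k < 2" using w_bound[OF p(4)] w_bound[OF p(5)] by simp
      then have "k = 0 \<or> k = 1" using p(2) by linarith
      then show "p \<in> E (B - n) \<union> Z"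
      proof
        assume "k = 0"
        then show ?thesis using p unfolding Z_def by simp
      next
        assume k1: "k = 1"
        have Q: "(- x - 1, - y) \<in> T" using p(4) k1 by simp
        have "of_int B - 1 - a y = - of_int B * (- y) + (of_int B - 1) / 2" "- 1 - v x y = - x - 1 + of_int n * (- y)"
          unfolding a_def v_def by (auto simp: field_simps)
        with Q show ?thesis
        proof (rule mem_T_cases)
          fix l assume "0 \<le> l" "l \<le> B - 2" "(of_int B - 1 - a y - of_int l, - 1 - v x y) \<in> T"
          then have "p \<in> E l" "l \<in> {0..B - 2}" using p unfolding E_def by auto
          then show ?thesis unfolding Z_def by (cases "l = B - n") auto
        next
          assume "(- (of_int B - 1 - a y), - (- 1 - v x y)) \<in> T"
          then have "p \<in> F" using p unfolding F_def by (simp add: algebra_simps)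
          then show ?thesis unfolding Z_def by auto
        qed
      qed
    qed
    have D1: "(x, y) \<in> R" if "(- x - 1, - y) \<in> T" for x y
      unfolding R_def D_def using that B4 by (intro UN_I[of 1]) auto
    have D0: "(x, y) \<in> R" if "(- x, - y) \<in> T" for x y
      unfolding R_def D_def using that B4 by (intro UN_I[of 0]) auto
    have eq: "of_int B - 1 - a y = - of_int B * (- y) + (of_int B - 1) / 2" "- 1 - v x y = - x - 1 + of_int n * (- y)" for x y
      unfolding a_def v_def by (auto simp: field_simps)
    have "E l \<subseteq> R \<inter> T" if "0 \<le> l" "l \<le> B - 2" for l
      unfolding E_def using D1 mem_T_shift[OF _ that eq] by auto
    moreover have "F \<subseteq> R \<inter> T"
    proof clarify
      fix x y assume "(x, y) \<in> F"
      then have f: "(x, y) \<in> T" "(a y - (of_int B - 1), 1 + v x y) \<in> T" unfolding F_def by auto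
      have e: "(- (of_int B - 1 - a y), - (- 1 - v x y)) = (a y - (of_int B - 1), 1 + v x y)" by simp
      have "(- x - 1, - y) \<in> T" by (rule mem_T_refl[OF _ eq]) (use f(2) in \<open>simp only: e\<close>)
      then show "(x, y) \<in> R \<inter> T" using D1 f(1) by blast
    qed
    moreover have "B - n \<in> {0..B - 2}" using Bn by simp
    moreover have "E l \<subseteq> R \<inter> T" if "l \<in> {0..B - 2}" for l using calculation(1)[of l] that by simp
    ultimately show "E (B - n) \<union> Z \<subseteq> R \<inter> T"
      unfolding Z_def using D0 by blast
  qed
  have disj: "E (B - n) \<inter> Z = {}"
  proof -
    have "(x, y) \<notin> Z" if "(x, y) \<in> E (B - n)" for x y
    proof -
      have 1: "(x, y) \<in> T" "(of_int n - 1 - a y, - 1 - v x y) \<in> T"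
        using that unfolding E_def by (auto simp: algebra_simps)
      have "a y = - of_int B * y + (of_int B - 1) / 2" "v x y = x + of_int n * y" by (simp_all add: a_def v_def)
      note sep = separation[OF 1(1) this 1(2)]
      show ?thesis using sep unfolding Z_def E_def F_def by auto
    qed
    then show ?thesis by auto
  qed
  obtain s t where st: "(s, t) \<in> T" "(- s, - t) \<in> T" by (rule symmetric_point)
  have Z0: "Z \<noteq> {}" using st unfolding Z_def by auto
  have E0: "E (B - n) \<noteq> {}"
  proof -
    obtain s t where st: "(s, t) \<in> T" "(s + of_int n - 1, t - 1) \<in> T" by (rule special_points)
    \<comment> \<open>The special pair pulled back: its first point through the reflected piece, its
      second through digit \<open>B - n\<close> of the opposite copy.\<close>
    obtain x y where xy: "- s = - of_int B * y + (of_int B - 1) / 2" "- t = x + of_int n * y" by (rule g_surj)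
    have "(x, y) \<in> T" by (rule mem_T_refl[OF _ xy]) (use st in simp)
    moreover have "a y = - s" "v x y = - t" unfolding a_def v_def using xy by auto
    ultimately have "(x, y) \<in> E (B - n)" using st unfolding E_def by (simp add: algebra_simps)
    then show ?thesis by auto
  qed
  have "\<exists>V W. closed V \<and> closed W \<and> R \<inter> T \<subseteq> V \<union> W \<and> V \<inter> W \<inter> (R \<inter> T) = {} \<and> V \<inter> (R \<inter> T) \<noteq> {} \<and> W \<inter> (R \<inter> T) \<noteq> {}"
    by (rule exI[of _ "E (B - n)"], rule exI[of _ Z]) (use clE clZ cov disj Z0 E0 in auto)
  then show False using con unfolding connected_closed by blast
qed

end

section \<open>Conjugating the expanding map to a contraction of the plane\<close>

text \<open>The three laws are those of the inverse of \<open>g\<close> for \<open>A = - 2\<close>: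
  a vertical unit shift becomes a horizontal one, a horizontal shift by \<open>B\<close> becomes
  \<open>(2, - 1)\<close>, and the half turn about \<open>((B - 1) / 2, 0)\<close> becomes the half
  turn about 0.\<close>

locale tile_model =
  fixes B :: int and \<psi> S :: "real \<times> real \<Rightarrow> real \<times> real" and lam :: real
  assumes B2: "B \<ge> 2" and S: "linear S" "inj S" and lam: "0 \<le> lam" "lam < 1"
    and shift_y: "\<And>p. \<psi> (p + (0, 1)) = \<psi> p + (1, 0)"
    and shift_B: "\<And>p. \<psi> (p + (of_int B, 0)) = \<psi> p + (2, - 1)"
    and reflect: "\<And>p. \<psi> ((of_int B - 1, 0) - p) = - \<psi> p"
    and lip: "\<And>p q. norm (S (\<psi> p - \<psi> q)) \<le> lam * norm (S (p - q))"
begin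

abbreviation "G \<equiv> tile_g (- 2) B"

lemma B0: "B \<noteq> 0" using B2 by auto

lemma AB: "\<bar>- 2 :: int\<bar> \<le> B" using B2 by auto

lemma shift_y_int: "\<psi> (p + (0, of_int k)) = \<psi> p + (of_int k, 0)"
proof (induction k rule: int_induct[of _ 0])
  case base
  then show ?case by (simp flip: zero_prod_def)
next
  case (step1 i)
  then show ?case using shift_y[of "p + (0, of_int i)"] by (simp add: add.assoc)
next
  case (step2 i)
  then show ?case using shift_y[of "p + (0, of_int (i - 1))"] by (simp add: add.assoc prod_eq_iff)
qed

lemma shift_B_int: "\<psi> (p + (of_int k * of_int B, 0)) = \<psi> p + (2 * of_int k, - of_int k)"
proof (induction k rule: int_induct[of _ 0])
  case base
  then show ?case by (simp flip: zero_prod_def)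
next
  case (step1 i)
  then show ?case using shift_B[of "p + (of_int i * of_int B, 0)"] by (simp add: add.assoc algebra_simps)
next
  case (step2 i)
  then show ?case using shift_B[of "p + (of_int (i - 1) * of_int B, 0)"]
    by (simp add: add.assoc algebra_simps prod_eq_iff)
qed

lemma psi_G_shift: "\<psi> (G (p + (of_int m, of_int l))) = \<psi> (G p) + (of_int m, of_int l)"
proof -
  have eq: "G (p + (of_int m, of_int l)) = G p + (of_int (- l) * of_int B, 0) + (0, of_int (m + 2 * l))"
    unfolding tile_g_def by (simp add: prod_eq_iff algebra_simps)
  show ?thesis unfolding eq shift_y_int shift_B_int by (simp add: prod_eq_iff)
qed

lemma S_below: obtains m where "0 < m" "\<And>v. m * norm v \<le> norm (S v)"
  using linear_inj_bounded_below_pos[OF S] by (metis mult.commute)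

lemma psi_cont: "continuous_on U \<psi>"
proof -
  obtain m where m: "0 < m" "\<And>v. m * norm v \<le> norm (S v)" using S_below by blast
  obtain C where C: "C > 0" "\<And>v. norm (S v) \<le> C * norm v"
    using linear_bounded_pos[OF S(1)] by (metis mult.commute)
  have "C-lipschitz_on U (\<lambda>x. m *\<^sub>R \<psi> x)"
  proof (rule lipschitz_onI)
    fix x y
    have "m * norm (\<psi> x - \<psi> y) \<le> norm (S (\<psi> x - \<psi> y))" by (rule m)
    also have "\<dots> \<le> lam * norm (S (x - y))" by (rule lip)
    also have "\<dots> \<le> 1 * norm (S (x - y))" using lam by (intro mult_right_mono) auto
    also have "\<dots> \<le> C * norm (x - y)" using C by simp
    finally show "dist (m *\<^sub>R \<psi> x) (m *\<^sub>R \<psi> y) \<le> C * dist x y"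
      using m(1) by (simp add: dist_norm flip: scaleR_diff_right)
  qed (use C in auto)
  then have "continuous_on U (\<lambda>x. (1 / m) *\<^sub>R (m *\<^sub>R \<psi> x))"
    by (intro continuous_intros lipschitz_on_continuous_on)
  then show ?thesis using m(1) by simp
qed

lemma G_cont: "continuous_on U G"
  unfolding tile_g_def by (intro continuous_intros)

lemma psi_G_bounded: obtains M where "M > 0" "\<And>x. norm (\<psi> (G x) - x) \<le> M"
proof -
  define c where "c = (\<lambda>x. \<psi> (G x) - x)"
  have "continuous_on (cbox (0, 0) (1, 1)) c" unfolding c_def
    by (intro continuous_intros continuous_on_compose2[OF psi_cont G_cont]) auto
  then have "bounded (c ` cbox (0, 0) (1, 1))"
    by (intro compact_imp_bounded compact_continuous_image) auto
  then obtain M where M: "M > 0" "\<And>x. x \<in> cbox (0, 0) (1, 1) \<Longrightarrow> norm (c x) \<le> M"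
    by (metis bounded_pos imageI)
  have "norm (c x) \<le> M" for x
  proof -
    define r where "r = (frac (fst x), frac (snd x))"
    have x: "x = r + (of_int \<lfloor>fst x\<rfloor>, of_int \<lfloor>snd x\<rfloor>)" unfolding r_def by (simp add: prod_eq_iff frac_def)
    have "c x = c r" unfolding c_def using psi_G_shift[of r "\<lfloor>fst x\<rfloor>" "\<lfloor>snd x\<rfloor>"] x by (metis add_diff_cancel_right)
    moreover have "r \<in> cbox (0, 0) (1, 1)" unfolding r_def by (auto simp: less_imp_le[OF frac_lt_1])
    ultimately show ?thesis using M by simp
  qed
  then show ?thesis using that M(1) unfolding c_def by blast
qed

text \<open>\<open>\<psi> \<circ> G\<close> moves every point by at most \<open>M\<close>, so
  Brouwer's theorem on the ball of radius \<open>M\<close> about \<open>q\<close> solves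
  \<open>\<psi> (G y) = q\<close>.\<close>

lemma psi_surj: "surj \<psi>"
proof -
  obtain M where M: "M > 0" "\<And>x. norm (\<psi> (G x) - x) \<le> M" using psi_G_bounded by blast
  have "\<exists>x. q = \<psi> x" for q
  proof -
    obtain y where "q - (\<psi> (G y) - y) = y"
    proof (rule brouwer_ball[of M q "\<lambda>y. q - (\<psi> (G y) - y)"])
      show "M > 0" by (rule M)
      show "continuous_on (cball q M) (\<lambda>y. q - (\<psi> (G y) - y))"
        by (intro continuous_intros continuous_on_compose2[OF psi_cont G_cont]) auto
      show "(\<lambda>y. q - (\<psi> (G y) - y)) \<in> cball q M \<rightarrow> cball q M" using M(2) by (auto simp: dist_norm)
    qed blast
    then have "q = \<psi> (G y)" by (simp add: algebra_simps)
    then show ?thesis by blast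
  qed
  then show ?thesis unfolding surj_def by blast
qed

definition Kn :: "nat \<Rightarrow> real \<times> real \<Rightarrow> real \<times> real" where
  "Kn n x = (\<psi> ^^ n) ((G ^^ n) x)"

lemma Kn_Suc: "Kn (Suc n) x = \<psi> (Kn n (G x))"
  unfolding Kn_def by (simp add: funpow_swap1)

lemma Kn_0: "Kn 0 x = x" unfolding Kn_def by simp

lemma psi_pow_lip: "norm (S ((\<psi> ^^ n) p - (\<psi> ^^ n) q)) \<le> lam ^ n * norm (S (p - q))"
proof (induction n)
  case (Suc n)
  have "norm (S ((\<psi> ^^ Suc n) p - (\<psi> ^^ Suc n) q)) \<le> lam * norm (S ((\<psi> ^^ n) p - (\<psi> ^^ n) q))"
    using lip by simp
  also have "\<dots> \<le> lam * (lam ^ n * norm (S (p - q)))" using Suc lam by (intro mult_left_mono) auto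
  finally show ?case by (simp add: mult.assoc)
qed simp

text \<open>Consecutive terms are images under the \<open>n\<close>-th iterate of
  \<open>\<psi>\<close> of two points at bounded distance, hence differ by a term of a geometric
  series. Its sum gives both uniform convergence and the bound on \<open>K x - x\<close>.\<close>

lemma Kn_limit:
  obtains K C where "\<And>x. (\<lambda>n. Kn n x) \<longlonglongrightarrow> K x" "uniform_limit UNIV Kn K sequentially"
    "\<And>x. norm (K x - x) \<le> C"
proof -
  obtain M where M: "M > 0" "\<And>x. norm (\<psi> (G x) - x) \<le> M" using psi_G_bounded by blast
  obtain m where m: "0 < m" "\<And>v. m * norm v \<le> norm (S v)" using S_below by blast
  obtain C where C: "C > 0" "\<And>v. norm (S v) \<le> C * norm v"
    using linear_bounded_pos[OF S(1)] by (metis mult.commute)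
  define R where "R = C * M / m"
  have R: "R \<ge> 0" unfolding R_def using C M m by simp
  have diff: "norm (Kn (Suc n) x - Kn n x) \<le> R * lam ^ n" for n x
  proof -
    have "Kn (Suc n) x - Kn n x = (\<psi> ^^ n) (\<psi> (G ((G ^^ n) x))) - (\<psi> ^^ n) ((G ^^ n) x)"
      unfolding Kn_def by (simp add: funpow_swap1)
    then have "norm (S (Kn (Suc n) x - Kn n x)) \<le> lam ^ n * norm (S (\<psi> (G ((G ^^ n) x)) - (G ^^ n) x))"
      using psi_pow_lip by simp
    also have "\<dots> \<le> lam ^ n * (C * M)"
      using lam C M by (intro mult_left_mono order_trans[OF C(2)]) auto
    finally have "m * norm (Kn (Suc n) x - Kn n x) \<le> lam ^ n * (C * M)"
      using m(2) order_trans by blast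
    then show ?thesis unfolding R_def using m(1) by (simp add: field_simps)
  qed
  have sm: "summable (\<lambda>n. R * lam ^ n)" using lam by (intro summable_mult summable_geometric) auto
  define K where "K = (\<lambda>x. x + (\<Sum>n. Kn (Suc n) x - Kn n x))"
  have tel: "x + (\<Sum>i<n. Kn (Suc i) x - Kn i x) = Kn n x" for n x
    using sum_lessThan_telescope[of "\<lambda>i. Kn i x" n] by (simp add: Kn_0)
  have "uniform_limit UNIV (\<lambda>n x. \<Sum>i<n. Kn (Suc i) x - Kn i x) (\<lambda>x. \<Sum>n. Kn (Suc n) x - Kn n x) sequentially"
    by (rule Weierstrass_m_test[OF diff sm])
  then have "uniform_limit UNIV (\<lambda>n x. x + (\<Sum>i<n. Kn (Suc i) x - Kn i x)) (\<lambda>x. x + (\<Sum>n. Kn (Suc n) x - Kn n x)) sequentially"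
    by (intro uniform_limit_add uniform_limit_const)
  then have u: "uniform_limit UNIV Kn K sequentially" unfolding tel K_def .
  then have "(\<lambda>n. Kn n x) \<longlonglongrightarrow> K x" for x by (rule tendsto_uniform_limitI) simp
  moreover have "norm (K x - x) \<le> (\<Sum>n. R * lam ^ n)" for x
    unfolding K_def using norm_suminf_le[OF diff sm] by simp
  ultimately show ?thesis using that u by blast
qed

text \<open>Passing to the limit of \<open>\<psi>\<^sup>n \<circ> G\<^sup>n\<close> conjugates \<open>G\<inverse>\<close> to \<open>\<psi>\<close>.\<close>

lemma conjugacy:
  obtains K where "continuous_on UNIV K" "\<And>x. \<psi> (K (G x)) = K x"
    "\<And>x m l. K (x + (of_int m, of_int l)) = K x + (of_int m, of_int l)" "\<And>x. K (- x) = - K x"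
    "inj \<psi> \<longrightarrow> inj K"
proof -
  obtain K C where K: "\<And>x. (\<lambda>n. Kn n x) \<longlonglongrightarrow> K x" "uniform_limit UNIV Kn K sequentially"
    "\<And>x. norm (K x - x) \<le> C" using Kn_limit by blast
  have contn: "continuous_on UNIV (Kn n)" for n
  proof (induction n)
    case 0
    have "Kn 0 = (\<lambda>x. x)" by (simp add: fun_eq_iff Kn_0)
    then show ?case by simp
  next
    case (Suc n)
    have "Kn (Suc n) = (\<lambda>x. \<psi> (Kn n (G x)))" by (simp add: fun_eq_iff Kn_Suc)
    then show ?case
      using continuous_on_compose2[OF psi_cont continuous_on_compose2[OF Suc G_cont]] by auto
  qed
  have cont: "continuous_on UNIV K"
    by (rule uniform_limit_theorem[OF _ K(2)]) (use contn in auto)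
  have conj: "\<psi> (K (G x)) = K x" for x
  proof -
    have "isCont \<psi> (K (G x))" using psi_cont[of UNIV] by (metis UNIV_I continuous_on_eq_continuous_at open_UNIV)
    then have "(\<lambda>n. \<psi> (Kn n (G x))) \<longlonglongrightarrow> \<psi> (K (G x))" using K(1) isCont_tendsto_compose by blast
    moreover have "(\<lambda>n. Kn (Suc n) x) \<longlonglongrightarrow> K x" using K(1) LIMSEQ_Suc by blast
    ultimately show ?thesis unfolding Kn_Suc using LIMSEQ_unique by blast
  qed
  have sh: "Kn n (x + (of_int m, of_int l)) = Kn n x + (of_int m, of_int l)" for n x m l
  proof (induction n arbitrary: x m l)
    case 0
    then show ?case by (simp add: Kn_0)
  next
    case (Suc n)
    have eq: "G (x + (of_int m, of_int l)) = G x + (of_int (- l * B), of_int (m + 2 * l))"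
      unfolding tile_g_def by (simp add: prod_eq_iff algebra_simps)
    have "Kn n (G (x + (of_int m, of_int l))) = Kn n (G x) + (of_int (- l * B), of_int (m + 2 * l))"
      unfolding eq by (rule Suc)
    also have "\<dots> = Kn n (G x) + (of_int (- l) * of_int B, 0) + (0, of_int (m + 2 * l))" by (simp add: prod_eq_iff)
    finally show ?case unfolding Kn_Suc
      by (simp only: shift_y_int shift_B_int) (simp add: prod_eq_iff)
  qed
  have "K (x + (of_int m, of_int l)) = K x + (of_int m, of_int l)" for x m l
  proof (rule LIMSEQ_unique[OF K(1)])
    show "(\<lambda>n. Kn n (x + (of_int m, of_int l))) \<longlonglongrightarrow> K x + (of_int m, of_int l)"
      unfolding sh by (intro tendsto_intros K)
  qed
  moreover
  have ng: "Kn n (- x) = - Kn n x" for n x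
  proof (induction n arbitrary: x)
    case 0
    then show ?case by (simp add: Kn_0)
  next
    case (Suc n)
    have "G (- x) = - G x + (of_int (B - 1), of_int 0)" unfolding tile_g_def by (simp add: prod_eq_iff field_simps)
    then have "Kn n (G (- x)) = (of_int B - 1, 0) - Kn n (G x)" using Suc sh[of n "- G x" "B - 1" 0] by simp
    then show ?case unfolding Kn_Suc using reflect by simp
  qed
  have "K (- x) = - K x" for x
  proof (rule LIMSEQ_unique[OF K(1)])
    show "(\<lambda>n. Kn n (- x)) \<longlonglongrightarrow> - K x" unfolding ng by (intro tendsto_intros K)
  qed
  moreover have "inj \<psi> \<longrightarrow> inj K"
  proof (intro impI injI)
    assume that: "inj \<psi>"
    fix x y assume xy: "K x = K y"
    have eq: "K ((G ^^ n) x) = K ((G ^^ n) y)" for n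
    proof (induction n)
      case (Suc n)
      have "\<psi> (K (G ((G ^^ n) x))) = \<psi> (K (G ((G ^^ n) y)))" unfolding conj using Suc .
      then show ?case using that by (simp add: inj_eq)
    qed (use xy in simp)
    obtain S' :: "real \<times> real \<Rightarrow> real \<times> real" and l where S': "linear S'" "inj S'" "0 < l" "l < 1"
      "\<And>p q. norm (S' (p - q)) \<le> l * norm (S' (G p - G q))"
      using g_expands[OF B2 AB] by blast
    obtain C' where C': "C' > 0" "\<And>v. norm (S' v) \<le> C' * norm v"
      using linear_bounded_pos[OF S'(1)] by (metis mult.commute)
    have ex: "norm (S' (x - y)) \<le> l ^ n * norm (S' ((G ^^ n) x - (G ^^ n) y))" for n
    proof (induction n)
      case (Suc n)
      have "l ^ n * norm (S' ((G ^^ n) x - (G ^^ n) y)) \<le> l ^ n * (l * norm (S' (G ((G ^^ n) x) - G ((G ^^ n) y))))"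
        using S' by (intro mult_left_mono) auto
      then show ?case using Suc by (simp add: algebra_simps)
    qed simp
    have "norm (S' (x - y)) \<le> l ^ n * (C' * (2 * C))" for n
    proof -
      let ?a = "(G ^^ n) x" and ?b = "(G ^^ n) y"
      have "norm (?a - ?b) \<le> norm (K ?a - ?a) + norm (K ?b - ?b)"
      proof -
        have "?a - ?b = (K ?b - ?b) - (K ?a - ?a)" using eq[of n] by simp
        then show ?thesis by (metis add.commute norm_triangle_ineq4)
      qed
      then have "norm (?a - ?b) \<le> 2 * C" using K(3)[of ?a] K(3)[of ?b] by linarith
      then have "norm (S' (?a - ?b)) \<le> C' * (2 * C)" using C' by (meson mult_left_mono order_trans less_imp_le)
      then have "l ^ n * norm (S' (?a - ?b)) \<le> l ^ n * (C' * (2 * C))" using S' by (intro mult_left_mono) auto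
      then show ?thesis using ex[of n] by linarith
    qed
    moreover have "(\<lambda>n. l ^ n * (C' * (2 * C))) \<longlonglongrightarrow> 0 * (C' * (2 * C))"
      using S' by (intro tendsto_intros LIMSEQ_realpow_zero) auto
    ultimately have "norm (S' (x - y)) \<le> 0 * (C' * (2 * C))" by (intro LIMSEQ_le_const) auto
    then have "norm (S' (x - y)) \<le> 0" by simp
    then have "S' (x - y) = S' 0" using linear_0[OF S'(1)] by simp
    then have "x - y = 0" using S'(2) by (simp only: inj_eq)
    then show "x = y" by simp
  qed
  ultimately show ?thesis using that[OF cont conj] by blast
qed

theorem tile_homeomorphic_model:
  assumes inj: "inj \<psi>" and P: "compact P" "P \<noteq> {}"
    and fix_P: "\<psi> ` ({(x + of_int k, y) |x y k. (x, y) \<in> P \<and> 0 \<le> k \<and> k \<le> B - 2} \<union> uminus ` P) = P"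
  shows "tile (- 2) B homeomorphic P"
proof -
  let ?T = "tile (- 2) B"
  note T = tile_props[OF B2 AB]
  obtain K where K: "continuous_on UNIV K" "\<And>x. \<psi> (K (G x)) = K x"
    "\<And>x m l. K (x + (of_int m, of_int l)) = K x + (of_int m, of_int l)" "\<And>x. K (- x) = - K x" "inj \<psi> \<longrightarrow> inj K"
    using conjugacy by blast
  define F where "F = (\<lambda>\<delta>. \<psi> \<circ> \<delta>) ` digits B"
  have con: "norm (S (f p - f q)) \<le> lam * norm (S (p - q))" if "f \<in> F" for f p q
  proof -
    obtain \<delta> where \<delta>: "\<delta> \<in> digits B" "f = \<psi> \<circ> \<delta>" using \<open>f \<in> F\<close> unfolding F_def by auto
    have "norm (S (f p - f q)) \<le> lam * norm (S (\<delta> p - \<delta> q))" using lip by (simp add: \<delta>)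
    also have "norm (S (\<delta> p - \<delta> q)) = norm (S (p - q))"
      by (rule digits_norm[OF S(1) \<delta>(1)])
    finally show ?thesis .
  qed
  have UF: "(\<Union>f\<in>F. f ` X) = \<psi> ` (\<Union>\<delta>\<in>digits B. \<delta> ` X)" for X unfolding F_def by auto
  have P_eq: "(\<Union>f\<in>F. f ` P) = P" unfolding UF UN_digits[OF B2] by (rule fix_P)
  have comm: "(\<Union>\<delta>\<in>digits B. \<delta> ` (K ` ?T)) = K ` (\<Union>\<delta>\<in>digits B. \<delta> ` ?T)"
  proof -
    have "\<delta> (K x) = K (\<delta> x)" if "\<delta> \<in> digits B" for \<delta> x
    proof -
      have "K (fst x + real k, snd x) = (fst (K x) + real k, snd (K x))" for k
      proof -
        have eq: "(fst x + real k, snd x) = x + (of_int (int k), of_int 0)" by (simp add: prod_eq_iff)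
        have "K (fst x + real k, snd x) = K x + (of_int (int k), of_int 0)" unfolding eq by (rule K(3))
        then show ?thesis by (simp add: prod_eq_iff)
      qed
      moreover have "K (- fst x, - snd x) = (- fst (K x), - snd (K x))" 
        using K(4)[of x] by (metis uminus_prod_def)
      ultimately show ?thesis using that by (auto simp: digits_def shift_a_pow refl_c_def split: if_splits)
    qed
    then show ?thesis by (auto simp: image_UN image_image)
  qed
  have KT: "(\<Union>f\<in>F. f ` (K ` ?T)) = K ` ?T"
  proof -
    have "(\<Union>f\<in>F. f ` (K ` ?T)) = \<psi> ` (K ` (G ` ?T))" unfolding UF comm T(3) ..
    also have "\<dots> = K ` ?T" unfolding image_image by (simp add: K(2))
    finally show ?thesis .
  qed
  have cK: "compact (K ` ?T)" using T(2) K(1) by (metis compact_continuous_image continuous_on_subset subset_UNIV)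
  have "K ` ?T = P"
  proof
    show "K ` ?T \<subseteq> P" 
      by (rule attractor_subset[OF S lam con cK P equalityD2[OF KT] equalityD1[OF P_eq]])
    show "P \<subseteq> K ` ?T" 
      by (rule attractor_subset[OF S lam con P(1) cK _ equalityD2[OF P_eq] equalityD1[OF KT]]) (simp_all add: T(1))
  qed
  then show ?thesis
    using homeomorphic_compact[OF T(2), of K P] K(1,5) inj continuous_on_subset[of UNIV K ?T] inj_on_subset[of K UNIV ?T] by simp
qed

end

section \<open>Piecewise affine maps on hexagonal tilings\<close>

text \<open>Twice the signed area of the triangle \<open>a b p\<close>; positive when
  \<open>p\<close> lies to the left of the directed line from \<open>a\<close> to
  \<open>b\<close>.\<close>

definition orient :: "real \<times> real \<Rightarrow> real \<times> real \<Rightarrow> real \<times> real \<Rightarrow> real" where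
  "orient a b p = (fst b - fst a) * (snd p - snd a) - (snd b - snd a) * (fst p - fst a)"

lemma orient_same [simp]: "orient a b a = 0" "orient a b b = 0" "orient a a b = 0"
  by (auto simp: orient_def)

lemma orient_rot: "orient b c a = orient a b c"
  by (simp add: orient_def algebra_simps)

lemma orient_swap: "orient a c b = - orient a b c"
  by (simp add: orient_def algebra_simps)

text \<open>Points of a hexagon are described by weights on its vertices. A map that is affine on
  triangles then keeps the weights and replaces the vertices by their images, and consistency along
  an edge becomes a statement about weights.\<close>

definition comb :: "(nat \<Rightarrow> real) \<Rightarrow> (nat \<Rightarrow> real \<times> real) \<Rightarrow> real \<times> real" where
  "comb c f = (\<Sum>i<6. c i *\<^sub>R f i)"

definition wts :: "(nat \<Rightarrow> real) \<Rightarrow> bool" where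
  "wts c \<longleftrightarrow> (\<forall>i<6. c i \<ge> 0) \<and> (\<Sum>i<6. c i) = 1"

lemma comb_cong: "(\<And>i. i < 6 \<Longrightarrow> c i = c' i) \<Longrightarrow> (\<And>i. i < 6 \<Longrightarrow> f i = g i) \<Longrightarrow> comb c f = comb c' g"
  unfolding comb_def by (intro sum.cong) auto

lemma comb_add_const: "wts c \<Longrightarrow> comb c (\<lambda>i. f i + t) = comb c f + t"
  unfolding comb_def wts_def by (simp add: scaleR_add_right sum.distrib flip: scaleR_left.sum)

lemma comb_neg: "comb c (\<lambda>i. - f i) = - comb c f"
  unfolding comb_def by (simp add: sum_negf)

lemma comb_diff: "comb c (\<lambda>i. f i - g i) = comb c f - comb c g"
  unfolding comb_def by (simp add: scaleR_diff_right sum_subtractf)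

lemma comb_linear: "linear L \<Longrightarrow> comb c (\<lambda>i. L (f i)) = L (comb c f)"
  unfolding comb_def by (simp add: linear_sum linear_cmul)

lemma orient_comb:
  assumes "wts c"
  shows "orient a b (comb c f) = (\<Sum>i<6. c i * orient a b (f i))"
proof -
  define u w k where "u = fst b - fst a" and "w = snd b - snd a" and "k = w * fst a - u * snd a"
  have o: "orient a b p = u * snd p - w * fst p + k" for p
    unfolding orient_def u_def w_def k_def by (simp add: algebra_simps)
  have "(\<Sum>i<6. c i * orient a b (f i)) = u * (\<Sum>i<6. c i * snd (f i)) - w * (\<Sum>i<6. c i * fst (f i)) + k * (\<Sum>i<6. c i)"
    unfolding o by (simp add: algebra_simps sum.distrib sum_subtractf sum_distrib_left)
  moreover have "snd (comb c f) = (\<Sum>i<6. c i * snd (f i))" "fst (comb c f) = (\<Sum>i<6. c i * fst (f i))"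
    unfolding comb_def by (simp_all add: fst_sum snd_sum)
  ultimately show ?thesis unfolding o using assms unfolding wts_def by simp
qed

definition sup_on :: "(nat \<Rightarrow> real) \<Rightarrow> nat \<times> nat \<times> nat \<Rightarrow> bool" where
  "sup_on c t = (case t of (p, q, r) \<Rightarrow> \<forall>l<6. l \<noteq> p \<and> l \<noteq> q \<and> l \<noteq> r \<longrightarrow> c l = 0)"

definition good_tri :: "nat \<times> nat \<times> nat \<Rightarrow> bool" where
  "good_tri t = (case t of (p, q, r) \<Rightarrow> p < q \<and> q < r \<and> r < 6)"

lemma sum_sup_on:
  fixes x :: "nat \<Rightarrow> 'a::real_vector"
  assumes "good_tri (p, q, r)" "sup_on c (p, q, r)"
  shows "(\<Sum>i<6. c i *\<^sub>R x i) = c p *\<^sub>R x p + c q *\<^sub>R x q + c r *\<^sub>R x r"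
proof -
  have "(\<Sum>i<6. c i *\<^sub>R x i) = (\<Sum>i\<in>{p, q, r}. c i *\<^sub>R x i)"
    using assms unfolding good_tri_def sup_on_def by (intro sum.mono_neutral_right) auto
  then show ?thesis using assms unfolding good_tri_def by (simp add: add.assoc)
qed

lemma sup_on_sum1:
  assumes "good_tri (p, q, r)" "sup_on c (p, q, r)" "wts c"
  shows "c p + c q + c r = 1"
  using sum_sup_on[OF assms(1,2), of "\<lambda>_. 1 :: real"] assms(3) unfolding wts_def by simp

definition adm :: "(nat \<times> nat \<times> nat) list \<Rightarrow> (nat \<Rightarrow> real) \<Rightarrow> bool" where
  "adm ts c \<longleftrightarrow> wts c \<and> (\<exists>t\<in>set ts. sup_on c t)"

text \<open>The triangles of a dissected hexagon are listed in an order in which each triangle \<open>(p, q, r)\<close>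
  is cut off from all later ones by its side \<open>p r\<close>.\<close>

fun peel :: "(nat \<times> nat \<times> nat) list \<Rightarrow> (nat \<Rightarrow> real \<times> real) \<Rightarrow> bool" where
  "peel [] f = True"
| "peel ((p, q, r) # ts) f \<longleftrightarrow> orient (f p) (f q) (f r) > 0
     \<and> (\<forall>(p', q', r')\<in>set ts. orient (f p) (f r) (f p') \<ge> 0 \<and> orient (f p) (f r) (f q') \<ge> 0 \<and> orient (f p) (f r) (f r') \<ge> 0)
     \<and> (ts \<noteq> [] \<longrightarrow> (\<exists>(p', q', r')\<in>set ts. p \<in> {p', q', r'} \<and> r \<in> {p', q', r'}))
     \<and> peel ts f"

text \<open>A point of the first triangle that also lies in a later one is on the cutting side
  \<open>p r\<close>; so its weight at \<open>q\<close> vanishes and its weights are admissible for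
  the rest of the list. If both weight functions belong to the first triangle, they are ratios of
  signed areas.\<close>

lemma peel_unique:
  assumes "peel ts f" "\<forall>t\<in>set ts. good_tri t" "adm ts c" "adm ts c'" "comb c f = comb c' f"
  shows "\<forall>i<6. c i = c' i"
  using assms
proof (induction ts)
  case Nil
  then show ?case by (simp add: adm_def)
next
  case (Cons t ts)
  obtain p q r where t: "t = (p, q, r)" by (cases t) auto
  have g: "good_tri (p, q, r)" using Cons.prems t by simp
  have w: "wts c" "wts c'" using Cons.prems unfolding adm_def by auto
  have pos: "orient (f p) (f q) (f r) > 0" using Cons.prems(1) t by simp
  have val: "orient a b (comb e f) = e p * orient a b (f p) + e q * orient a b (f q) + e r * orient a b (f r)"
    if "wts e" "sup_on e (p, q, r)" for a b e
    using orient_comb[OF that(1)] sum_sup_on[OF g that(2), of "\<lambda>i. orient a b (f i)"] by simp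
  have tail: "adm ts e" if e: "wts e" "sup_on e (p, q, r)" and e': "adm ts e'" and eq: "comb e f = comb e' f" for e e'
  proof -
    obtain p' q' r' where s: "(p', q', r') \<in> set ts" "sup_on e' (p', q', r')" and we: "wts e'"
      using e' unfolding adm_def by auto
    have gs: "good_tri (p', q', r')" using Cons.prems(2) s(1) by simp
    have "orient (f p) (f r) (comb e f) = e' p' * orient (f p) (f r) (f p') + e' q' * orient (f p) (f r) (f q') + e' r' * orient (f p) (f r) (f r')"
      unfolding eq using orient_comb[OF we] sum_sup_on[OF gs s(2), of "\<lambda>i. orient (f p) (f r) (f i)"] by simp
    moreover have "orient (f p) (f r) (f p') \<ge> 0 \<and> orient (f p) (f r) (f q') \<ge> 0 \<and> orient (f p) (f r) (f r') \<ge> 0"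
      using Cons.prems(1) s(1) t by auto
    moreover have "e' p' \<ge> 0" "e' q' \<ge> 0" "e' r' \<ge> 0" using we gs unfolding wts_def good_tri_def by auto
    ultimately have "orient (f p) (f r) (comb e f) \<ge> 0" by simp
    then have "e q * orient (f p) (f q) (f r) \<le> 0" unfolding val[OF e] by (simp add: orient_swap[of "f p" "f r" "f q"])
    moreover have "e q \<ge> 0" using e(1) g unfolding wts_def good_tri_def by auto
    ultimately have "e q = 0" using pos by (smt (verit) mult_pos_pos)
    moreover have "ts \<noteq> []" using s by auto
    then obtain p'' q'' r'' where "(p'', q'', r'') \<in> set ts" "p \<in> {p'', q'', r''}" "r \<in> {p'', q'', r''}"
      using Cons.prems(1) t by auto
    ultimately have "(p'', q'', r'') \<in> set ts" "sup_on e (p'', q'', r'')"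
      using e(2) unfolding sup_on_def by auto
    then show ?thesis using e(1) unfolding adm_def by blast
  qed
  have IH: "\<forall>i<6. c i = c' i" if "adm ts c" "adm ts c'" using Cons that t by simp
  show ?case
  proof (cases "sup_on c (p, q, r)")
    case False
    then have 1: "adm ts c" using Cons.prems(3) unfolding adm_def t by auto
    have "adm ts c'"
    proof (cases "sup_on c' (p, q, r)")
      case True
      then show ?thesis using tail[OF w(2) _ 1] Cons.prems(5) by simp
    qed (use Cons.prems(4) in \<open>auto simp: adm_def t\<close>)
    then show ?thesis using IH 1 by blast
  next
    case s: True
    show ?thesis
    proof (cases "sup_on c' (p, q, r)")
      case False
      then have 1: "adm ts c'" using Cons.prems(4) unfolding adm_def t by auto
      then have "adm ts c" using tail[OF w(1) s] Cons.prems(5) by simp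
      then show ?thesis using IH 1 by blast
    next
      case s': True
      have "orient (f p) (f q) (comb c f) = c r * orient (f p) (f q) (f r)"
        using val[OF w(1) s, of "f p" "f q"] by simp
      moreover have "orient (f p) (f q) (comb c' f) = c' r * orient (f p) (f q) (f r)"
        using val[OF w(2) s', of "f p" "f q"] by simp
      ultimately have "c r * orient (f p) (f q) (f r) = c' r * orient (f p) (f q) (f r)"
        using Cons.prems(5) by metis
      then have 1: "c r = c' r" using pos by simp
      have rot: "orient (f q) (f r) (f p) = orient (f p) (f q) (f r)" by (rule orient_rot)
      have "orient (f q) (f r) (comb c f) = c p * orient (f p) (f q) (f r)"
        using val[OF w(1) s, of "f q" "f r"] rot by simp
      moreover have "orient (f q) (f r) (comb c' f) = c' p * orient (f p) (f q) (f r)"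
        using val[OF w(2) s', of "f q" "f r"] rot by simp
      ultimately have "c p * orient (f p) (f q) (f r) = c' p * orient (f p) (f q) (f r)"
        using Cons.prems(5) by metis
      then have 2: "c p = c' p" using pos by simp
      have "c q = c' q" using 1 2 sup_on_sum1[OF g s w(1)] sup_on_sum1[OF g s' w(2)] by linarith
      then have "c i = c' i" if "i < 6" for i
        using 1 2 s s' that unfolding sup_on_def by (cases "i = p \<or> i = q \<or> i = r") auto
      then show ?thesis by blast
    qed
  qed
qed

section \<open>Convex hexagons and their dissections\<close>

definition hexagon :: "(nat \<Rightarrow> real \<times> real) \<Rightarrow> (real \<times> real) set" where
  "hexagon f = {x. orient (f 0) (f 1) x \<ge> 0 \<and> orient (f 1) (f 2) x \<ge> 0 \<and> orient (f 2) (f 3) x \<ge> 0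
     \<and> orient (f 3) (f 4) x \<ge> 0 \<and> orient (f 4) (f 5) x \<ge> 0 \<and> orient (f 5) (f 0) x \<ge> 0}"

definition convex6 :: "(nat \<Rightarrow> real \<times> real) \<Rightarrow> bool" where
  "convex6 f \<longleftrightarrow> (\<forall>i j k. i < j \<and> j < k \<and> k < 6 \<longrightarrow> orient (f i) (f j) (f k) > 0)"

text \<open>Five of the fourteen triangulations of a hexagon by diagonals, each listed in the order
  that \<open>peel\<close> asks for. The choice varies from tile to tile.\<close>

definition T0 :: "(nat \<times> nat \<times> nat) list" where "T0 = [(0,1,2), (0,2,3), (0,3,4), (0,4,5)]"
definition T1 :: "(nat \<times> nat \<times> nat) list" where "T1 = [(1,2,3), (0,1,3), (0,3,4), (0,4,5)]"
definition TF :: "(nat \<times> nat \<times> nat) list" where "TF = [(2,3,4), (1,2,4), (0,1,4), (0,4,5)]"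
definition TA :: "(nat \<times> nat \<times> nat) list" where "TA = [(1,2,3), (1,3,4), (0,1,4), (0,4,5)]"
definition TB :: "(nat \<times> nat \<times> nat) list" where "TB = [(2,3,4), (1,2,4), (1,4,5), (0,1,5)]"

lemmas T_defs = T0_def T1_def TF_def TA_def TB_def

lemma good_tri_T: "ts \<in> {T0, T1, TF, TA, TB} \<Longrightarrow> \<forall>t\<in>set ts. good_tri t"
  by (auto simp: T_defs good_tri_def)

lemma convex6_pos:
  assumes "convex6 f" "i < j" "j < k" "k < 6"
  shows "orient (f i) (f j) (f k) > 0" "orient (f j) (f k) (f i) > 0" "orient (f k) (f i) (f j) > 0"
proof -
  show 1: "orient (f i) (f j) (f k) > 0" using assms unfolding convex6_def by blast
  show 2: "orient (f j) (f k) (f i) > 0" by (subst orient_rot) (rule 1)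
  show "orient (f k) (f i) (f j) > 0" by (subst orient_rot) (rule 2)
qed

lemma convex6_peel:
  assumes "convex6 f" "ts \<in> {T0, T1, TF, TA, TB}"
  shows "peel ts f"
proof -
  note c = convex6_pos[OF assms(1)] convex6_pos[OF assms(1), THEN less_imp_le]
  show ?thesis using assms(2) by (auto simp: T_defs c)
qed

text \<open>Barycentric coordinates as ratios of signed areas.\<close>

lemma tri_cover:
  assumes g: "good_tri (p, q, r)" and pos: "orient (f p) (f q) (f r) > 0"
    and x: "orient (f p) (f q) x \<ge> 0" "orient (f q) (f r) x \<ge> 0" "orient (f r) (f p) x \<ge> 0"
  shows "\<exists>c. wts c \<and> sup_on c (p, q, r) \<and> x = comb c f"
proof -
  define D where "D = orient (f p) (f q) (f r)"
  define c where "c = (\<lambda>l. if l = p then orient (f q) (f r) x / D else if l = q then orient (f r) (f p) x / D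
    else if l = r then orient (f p) (f q) x / D else 0)"
  have D: "D > 0" using pos D_def by simp
  have ne: "p \<noteq> q" "q \<noteq> r" "p \<noteq> r" using g unfolding good_tri_def by auto
  have s: "sup_on c (p, q, r)" unfolding sup_on_def c_def by auto
  have sum: "orient (f q) (f r) x + orient (f r) (f p) x + orient (f p) (f q) x = D"
    unfolding D_def orient_def by (simp add: algebra_simps)
  have "(\<Sum>i<6. c i) = c p + c q + c r" using sum_sup_on[OF g s, of "\<lambda>_. 1 :: real"] by simp
  also have "\<dots> = 1" unfolding c_def using ne sum D by (simp add: field_simps)
  finally have "wts c" unfolding wts_def using x D by (auto simp: c_def)
  moreover have "comb c f = c p *\<^sub>R f p + c q *\<^sub>R f q + c r *\<^sub>R f r"
    unfolding comb_def by (rule sum_sup_on[OF g s])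
  moreover have "D *\<^sub>R x = orient (f q) (f r) x *\<^sub>R f p + orient (f r) (f p) x *\<^sub>R f q + orient (f p) (f q) x *\<^sub>R f r"
    unfolding D_def orient_def by (simp add: prod_eq_iff algebra_simps)
  then have "x = (1 / D) *\<^sub>R (orient (f q) (f r) x *\<^sub>R f p + orient (f r) (f p) x *\<^sub>R f q + orient (f p) (f q) x *\<^sub>R f r)"
    using D by (metis divide_self_if less_irrefl scaleR_one scaleR_scaleR times_divide_eq_left mult_1)
  then have "x = c p *\<^sub>R f p + c q *\<^sub>R f q + c r *\<^sub>R f r"
    unfolding c_def using ne by (simp add: scaleR_add_right)
  ultimately show ?thesis using s by auto
qed

lemma orient_nonneg_cases: "orient a b x \<ge> 0 \<or> orient b a x \<ge> 0"
  by (auto simp: orient_def algebra_simps)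

text \<open>The sides of the point with respect to the three diagonals of the dissection decide in
  which triangle it lies.\<close>

lemma hexagon_cover:
  assumes c: "convex6 f" and x: "x \<in> hexagon f" and ts: "ts \<in> {T0, T1, TF, TA, TB}"
  shows "\<exists>c. adm ts c \<and> x = comb c f"
proof -
  note h = x[unfolded hexagon_def mem_Collect_eq]
  have tri: "\<exists>c. adm ts c \<and> x = comb c f" if "(p, q, r) \<in> set ts"
    "orient (f p) (f q) x \<ge> 0" "orient (f q) (f r) x \<ge> 0" "orient (f r) (f p) x \<ge> 0" for p q r
  proof -
    have "good_tri (p, q, r)" using good_tri_T[OF ts] that(1) by blast
    moreover then have "orient (f p) (f q) (f r) > 0" using c unfolding convex6_def good_tri_def by auto
    ultimately show ?thesis using tri_cover[of p q r f x] that unfolding adm_def by blast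
  qed
  have o: "orient (f i) (f j) x \<ge> 0 \<or> orient (f j) (f i) x \<ge> 0" for i j by (rule orient_nonneg_cases)
  from ts consider "ts = T0" | "ts = T1" | "ts = TF" | "ts = TA" | "ts = TB" by blast
  then show ?thesis
  proof cases
    case 1
    then show ?thesis using tri[of 0 1 2] tri[of 0 2 3] tri[of 0 3 4] tri[of 0 4 5] o[of 0 2] o[of 0 3] o[of 0 4] h
      by (auto simp: T0_def)
  next
    case 2
    then show ?thesis using tri[of 1 2 3] tri[of 0 1 3] tri[of 0 3 4] tri[of 0 4 5] o[of 1 3] o[of 0 3] o[of 0 4] h
      by (auto simp: T1_def)
  next
    case 3
    then show ?thesis using tri[of 2 3 4] tri[of 1 2 4] tri[of 0 1 4] tri[of 0 4 5] o[of 2 4] o[of 1 4] o[of 0 4] h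
      by (auto simp: TF_def)
  next
    case 4
    then show ?thesis using tri[of 1 2 3] tri[of 1 3 4] tri[of 0 1 4] tri[of 0 4 5] o[of 1 3] o[of 1 4] o[of 0 4] h
      by (auto simp: TA_def)
  next
    case 5
    then show ?thesis using tri[of 2 3 4] tri[of 1 2 4] tri[of 1 4 5] tri[of 0 1 5] o[of 2 4] o[of 1 4] o[of 1 5] h
      by (auto simp: TB_def)
  qed
qed

lemma orient_affine: "orient a b ((1 - t) *\<^sub>R x + t *\<^sub>R y) = (1 - t) * orient a b x + t * orient a b y"
  by (simp add: orient_def algebra_simps)

lemma comb_in_hexagon:
  assumes "wts c" "\<And>i. i < 6 \<Longrightarrow> g i \<in> hexagon f"
  shows "comb c g \<in> hexagon f"
proof -
  have "orient a b (comb c g) \<ge> 0" if "\<And>i. i < 6 \<Longrightarrow> orient a b (g i) \<ge> 0" for a b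
    unfolding orient_comb[OF assms(1)] using that assms(1) unfolding wts_def by (intro sum_nonneg) auto
  then show ?thesis using assms(2) unfolding hexagon_def by auto
qed

lemma vertex_in_hexagon: "convex6 f \<Longrightarrow> i < 6 \<Longrightarrow> f i \<in> hexagon f"
proof -
  assume c: "convex6 f" and i: "i < 6"
  note p = convex6_pos[OF c] convex6_pos[OF c, THEN less_imp_le]
  have "i \<in> {0, 1, 2, 3, 4, 5}" using i by auto
  then show ?thesis unfolding hexagon_def by (auto simp: p)
qed

lemma continuous_on_orient [continuous_intros]:
  "continuous_on U g \<Longrightarrow> continuous_on U (\<lambda>x. orient a b (g x))"
  unfolding orient_def by (intro continuous_intros)

lemma closed_hexagon: "closed (hexagon f)"
  unfolding hexagon_def by (intro closed_Collect_conj closed_Collect_le continuous_intros)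

lemma compact_hexagon:
  assumes "convex6 f"
  shows "compact (hexagon f)"
proof -
  have "norm x \<le> (\<Sum>i<6. norm (f i))" if xH: "x \<in> hexagon f" for x
  proof -
    obtain c where c: "adm T0 c" "x = comb c f" using hexagon_cover[OF assms xH, of T0] by auto
    have w: "c i \<ge> 0" "c i \<le> 1" if "i < 6" for i
    proof -
      show 0: "c i \<ge> 0" using c(1) that unfolding adm_def wts_def by auto
      have "c i \<le> (\<Sum>i<6. c i)" using c(1) that unfolding adm_def wts_def by (intro member_le_sum) auto
      then show "c i \<le> 1" using c(1) unfolding adm_def wts_def by simp
    qed
    have "norm x \<le> (\<Sum>i<6. norm (c i *\<^sub>R f i))" unfolding c(2) comb_def by (rule norm_sum)
    also have "\<dots> \<le> (\<Sum>i<6. norm (f i))" using w by (intro sum_mono) (simp add: mult_left_le_one_le)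
    finally show ?thesis .
  qed
  then have "bounded (hexagon f)" by (meson bounded_iff)
  then show ?thesis using closed_hexagon compact_eq_bounded_closed by blast
qed

lemma convex_hexagon: "convex (hexagon f)"
  unfolding convex_alt hexagon_def by (auto simp: orient_affine)

definition hex_interior :: "(nat \<Rightarrow> real \<times> real) \<Rightarrow> (real \<times> real) set" where
  "hex_interior f = {x. orient (f 0) (f 1) x > 0 \<and> orient (f 1) (f 2) x > 0 \<and> orient (f 2) (f 3) x > 0
     \<and> orient (f 3) (f 4) x > 0 \<and> orient (f 4) (f 5) x > 0 \<and> orient (f 5) (f 0) x > 0}"

lemma hex_interior_nonempty:
  assumes "convex6 f"
  shows "\<exists>m. m \<in> hex_interior f"
proof -
  have w: "wts (\<lambda>_. 1 / 6)" unfolding wts_def by simp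
  note p = convex6_pos[OF assms] convex6_pos[OF assms, THEN less_imp_le]
  have "comb (\<lambda>_. 1 / 6) f \<in> hex_interior f"
    unfolding hex_interior_def mem_Collect_eq orient_comb[OF w]
    by (simp add: eval_nat_numeral add_pos_pos add_nonneg_pos p[simplified eval_nat_numeral])
  then show ?thesis by blast
qed

text \<open>Surjectivity onto the hexagon is obtained directly only for points off the edges;
  density of these and compactness give the rest.\<close>

lemma hexagon_subset_closure:
  assumes "convex6 f"
  shows "hexagon f \<subseteq> closure (hex_interior f)"
proof
  fix x assume x: "x \<in> hexagon f"
  obtain m where m: "m \<in> hex_interior f" using hex_interior_nonempty[OF assms] by blast
  define X where "X = (\<lambda>n::nat. (1 - inverse (real (Suc n))) *\<^sub>R x + inverse (real (Suc n)) *\<^sub>R m)"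
  have "X n \<in> hex_interior f" for n
  proof -
    have "inverse (real (Suc n)) > 0" "1 - inverse (real (Suc n)) \<ge> 0" by (auto simp: field_simps)
    then show ?thesis using x m unfolding X_def hex_interior_def hexagon_def mem_Collect_eq orient_affine
      by (intro conjI add_nonneg_pos mult_nonneg_nonneg mult_pos_pos) auto
  qed
  moreover have "X \<longlonglongrightarrow> (1 - 0) *\<^sub>R x + 0 *\<^sub>R m"
    unfolding X_def by (intro tendsto_intros LIMSEQ_inverse_real_of_nat)
  ultimately show "x \<in> closure (hex_interior f)" unfolding closure_sequential by auto
qed

lemma open_hex_interior: "open (hex_interior f)"
  unfolding hex_interior_def by (intro open_Collect_conj open_Collect_less continuous_intros)

lemma hexagon_disk_like: "convex6 f \<Longrightarrow> hexagon f homeomorphic cball (0 :: real \<times> real) 1"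
proof (rule homeomorphic_convex_compact_cball[OF convex_hexagon compact_hexagon])
  assume c: "convex6 f"
  have "hex_interior f \<subseteq> hexagon f" unfolding hex_interior_def hexagon_def by auto
  then have "hex_interior f \<subseteq> interior (hexagon f)" using open_hex_interior interior_maximal by blast
  then show "interior (hexagon f) \<noteq> {}" using hex_interior_nonempty[OF c] by blast
qed auto

section \<open>Tilings of the plane by a hexagon and its half turns\<close>

definition iv :: "int \<times> int \<Rightarrow> real \<times> real" where
  "iv v = (of_int (fst v), of_int (snd v))"

lemma iv_simps: "iv (u + v) = iv u + iv v" "iv (u - v) = iv u - iv v" "iv (- v) = - iv v" "iv 0 = 0"
  by (auto simp: iv_def prod_eq_iff)

lemma iv_eq_iff [simp]: "iv u = iv v \<longleftrightarrow> u = v"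
  by (auto simp: iv_def prod_eq_iff)

lemma all_less_6: "(\<forall>i<6. P i) \<longleftrightarrow> P 0 \<and> P 1 \<and> P 2 \<and> P 3 \<and> P 4 \<and> P (5::nat)"
proof -
  have "i < 6 \<longleftrightarrow> i \<in> {0, 1, 2, 3, 4, 5}" for i :: nat by auto
  then show ?thesis by auto
qed

text \<open>Lipschitz constant, in the norm of \<open>S\<close>, of the affine map between the
  triangles with vertices \<open>f\<close> and \<open>g\<close>, expressed by edge vectors so that
  translations drop out.\<close>

definition lipT :: "(real \<times> real \<Rightarrow> real \<times> real) \<Rightarrow> real \<Rightarrow> (nat \<Rightarrow> real \<times> real) \<Rightarrow> (nat \<Rightarrow> real \<times> real)
    \<Rightarrow> nat \<times> nat \<times> nat \<Rightarrow> bool" where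
  "lipT S L f g t = (case t of (p, q, r) \<Rightarrow> \<forall>b c. norm (S (b *\<^sub>R (g q - g p) + c *\<^sub>R (g r - g p)))
     \<le> L * norm (S (b *\<^sub>R (f q - f p) + c *\<^sub>R (f r - f p))))"

lemma lipT_comb:
  assumes "lipT S L f g t" "good_tri t" "sup_on c t" "sup_on c' t" "wts c" "wts c'"
  shows "norm (S (comb c g - comb c' g)) \<le> L * norm (S (comb c f - comb c' f))"
proof -
  obtain p q r where t: "t = (p, q, r)" by (cases t) auto
  have eq: "comb c h - comb c' h = (c q - c' q) *\<^sub>R (h q - h p) + (c r - c' r) *\<^sub>R (h r - h p)" for h
  proof -
    have 1: "c p = 1 - c q - c r" "c' p = 1 - c' q - c' r"
      using sup_on_sum1[of p q r c] sup_on_sum1[of p q r c'] assms t by auto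
    have 2: "comb c h = c p *\<^sub>R h p + c q *\<^sub>R h q + c r *\<^sub>R h r" "comb c' h = c' p *\<^sub>R h p + c' q *\<^sub>R h q + c' r *\<^sub>R h r"
      unfolding comb_def using sum_sup_on assms t by blast+
    show ?thesis unfolding 2 1 by (simp add: algebra_simps)
  qed
  show ?thesis using assms(1) unfolding eq lipT_def t by simp
qed

lemma lipT_const:
  assumes "lipT S L f g t" "\<And>i. i < 6 \<Longrightarrow> g' i = g i + k" "good_tri t"
  shows "lipT S L f g' t"
  using assms unfolding lipT_def good_tri_def by (auto simp: add_diff_cancel_right)

text \<open>Edges 01 and 12 have midpoints \<open>e1 / 2\<close> and \<open>(e1 + d) / 2\<close>,
  edges 45 and 34 have midpoints \<open>e2 / 2\<close> and \<open>(e2 + d) / 2\<close>, and edge 23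
  is edge 50 shifted by \<open>d\<close>. So four edges are glued by half turns and two by a
  translation, as in Conway's criterion.\<close>

definition pts :: "real \<times> real \<Rightarrow> real \<times> real \<Rightarrow> int \<times> int \<Rightarrow> int \<times> int \<Rightarrow> int \<times> int \<Rightarrow> nat \<Rightarrow> real \<times> real" where
  "pts w0 u0 d e1 e2 i = [w0, iv e1 - w0, w0 + iv d, u0 + iv d, iv e2 - u0, u0] ! i"

text \<open>The image of a lattice translate of \<open>w0\<close> or \<open>u0\<close>. As a
  vertical unit shift becomes a horizontal one, a family indexed by the first coordinate determines
  all of them.\<close>

definition av :: "(int \<Rightarrow> real \<times> real) \<Rightarrow> int \<times> int \<Rightarrow> real \<times> real" where
  "av \<alpha> v = \<alpha> (fst v) + (of_int (snd v), 0)"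

text \<open>Images of the six vertices of the tile shifted by \<open>v\<close>. Vertices 1 and 4
  arise from translates of \<open>w0\<close> and \<open>u0\<close> by the half turn about
  \<open>((B - 1) / 2, 0)\<close>, hence the sign and the reflected index.\<close>

definition vls :: "int \<Rightarrow> (int \<Rightarrow> real \<times> real) \<Rightarrow> (int \<Rightarrow> real \<times> real) \<Rightarrow> int \<times> int \<Rightarrow> int \<times> int \<Rightarrow> int \<times> int
    \<Rightarrow> int \<times> int \<Rightarrow> nat \<Rightarrow> real \<times> real" where
  "vls B \<alpha> \<beta> d e1 e2 v i = [av \<alpha> v, - av \<alpha> ((B - 1, 0) - e1 - v), av \<alpha> (v + d),
     av \<beta> (v + d), - av \<beta> ((B - 1, 0) - e2 - v), av \<beta> v] ! i"

text \<open>\<open>diff_int\<close> lists the translates of the hexagon that meet it and the edges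
  where they do, \<open>sum_int\<close> does so for translates of its opposite. Differences and sums
  are what comparing two representations of one point of the plane yields.\<close>

locale hex_tiling =
  fixes w0 u0 :: "real \<times> real" and d e1 e2 :: "int \<times> int"
  assumes conv: "convex6 (pts w0 u0 d e1 e2)"
    and diff_int: "\<And>p q z. p \<in> hexagon (pts w0 u0 d e1 e2) \<Longrightarrow> q \<in> hexagon (pts w0 u0 d e1 e2) \<Longrightarrow> p - q = iv z \<Longrightarrow>
      z = 0 \<or> z = d \<and> orient (w0 + iv d) (u0 + iv d) p = 0 \<and> orient u0 w0 q = 0
        \<or> z = - d \<and> orient u0 w0 p = 0 \<and> orient (w0 + iv d) (u0 + iv d) q = 0"
    and sum_int: "\<And>p q z. p \<in> hexagon (pts w0 u0 d e1 e2) \<Longrightarrow> q \<in> hexagon (pts w0 u0 d e1 e2) \<Longrightarrow> p + q = iv z \<Longrightarrow>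
      z = e1 \<and> orient w0 (iv e1 - w0) p = 0 \<and> orient w0 (iv e1 - w0) q = 0
      \<or> z = e1 + d \<and> orient (iv e1 - w0) (w0 + iv d) p = 0 \<and> orient (iv e1 - w0) (w0 + iv d) q = 0
      \<or> z = e2 \<and> orient (iv e2 - u0) u0 p = 0 \<and> orient (iv e2 - u0) u0 q = 0
      \<or> z = e2 + d \<and> orient (u0 + iv d) (iv e2 - u0) p = 0 \<and> orient (u0 + iv d) (iv e2 - u0) q = 0"
    and cover: "\<And>x. \<exists>v. x - iv v \<in> hexagon (pts w0 u0 d e1 e2) \<or> iv v - x \<in> hexagon (pts w0 u0 d e1 e2)"
begin

abbreviation "pt \<equiv> pts w0 u0 d e1 e2"
abbreviation "H \<equiv> hexagon pt"

lemma pt_simps [simp]: "pt 0 = w0" "pt 1 = iv e1 - w0" "pt (Suc 0) = iv e1 - w0" "pt 2 = w0 + iv d" "pt 3 = u0 + iv d" "pt 4 = iv e2 - u0" "pt 5 = u0"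
  by (simp_all add: pts_def)

lemma comb_H: "wts c \<Longrightarrow> comb c pt \<in> H"
  using comb_in_hexagon vertex_in_hexagon[OF conv] by blast

definition hedge :: "nat \<Rightarrow> nat \<Rightarrow> bool" where
  "hedge i j \<longleftrightarrow> (i, j) \<in> {(0,1), (1,2), (2,3), (3,4), (4,5), (5,0)}"

text \<open>The four other vertices lie strictly on one side of the edge, so they carry no
  weight.\<close>

lemma edge_sup:
  assumes c: "wts c" and e: "hedge i j" and o: "orient (pt i) (pt j) (comb c pt) = 0"
  shows "\<forall>l<6. l \<noteq> i \<and> l \<noteq> j \<longrightarrow> c l = 0"
proof -
  note p = convex6_pos[OF conv] 
  have pos: "orient (pt i) (pt j) (pt l) > 0" if "l < 6" "l \<noteq> i" "l \<noteq> j" for l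
  proof -
    have "l \<in> {0, 1, 2, 3, 4, 5}" using that by auto
    then show ?thesis using e that(2,3) unfolding hedge_def by (auto simp del: pt_simps simp: p)
  qed
  then have "orient (pt i) (pt j) (pt l) \<ge> 0" if "l < 6" for l
    using that by (cases "l = i \<or> l = j") (auto simp del: pt_simps intro: less_imp_le)
  then have nn: "\<forall>l\<in>{..<6}. c l * orient (pt i) (pt j) (pt l) \<ge> 0" using c unfolding wts_def by simp
  have "(\<Sum>l<6. c l * orient (pt i) (pt j) (pt l)) = 0" using o orient_comb[OF c] by simp
  then have "\<forall>l\<in>{..<6}. c l * orient (pt i) (pt j) (pt l) = 0"
    using nn by (subst (asm) sum_nonneg_eq_0_iff) auto
  then show ?thesis using pos by fastforce
qed

lemma edge_comb:
  assumes "wts c" "i < 6" "j < 6" "i \<noteq> j" "\<forall>l<6. l \<noteq> i \<and> l \<noteq> j \<longrightarrow> c l = 0"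
  shows "comb c f = c i *\<^sub>R f i + c j *\<^sub>R f j" "c i + c j = 1"
proof -
  have "(\<Sum>l<6. c l *\<^sub>R g l) = (\<Sum>l\<in>{i, j}. c l *\<^sub>R g l)" for g :: "nat \<Rightarrow> 'c::real_vector"
    using assms by (intro sum.mono_neutral_right) auto
  then have "(\<Sum>l<6. c l *\<^sub>R g l) = c i *\<^sub>R g i + c j *\<^sub>R g j" for g :: "nat \<Rightarrow> 'c::real_vector"
    using assms(4) by simp
  note this[of f] 
  then show "comb c f = c i *\<^sub>R f i + c j *\<^sub>R f j" unfolding comb_def .
next
  have "(\<Sum>l<6. c l) = (\<Sum>l\<in>{i, j}. c l)" using assms by (intro sum.mono_neutral_right) auto
  then show "c i + c j = 1" using assms unfolding wts_def by simp
qed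

lemma pt_distinct: "hedge i j \<Longrightarrow> pt i \<noteq> pt j"
proof
  assume e: "hedge i j" and eq: "pt i = pt j"
  note p = convex6_pos[OF conv]
  from e have "\<exists>l<6. orient (pt i) (pt j) (pt l) > 0"
    unfolding hedge_def
    apply (elim insertE emptyE)
         apply (auto simp del: pt_simps intro: exI[of _ 2] exI[of _ 0] exI[of _ 1] simp: p)
    done
  then show False unfolding eq by simp
qed

lemma hedge_less: "hedge i j \<Longrightarrow> i < 6 \<and> j < 6 \<and> i \<noteq> j"
  unfolding hedge_def by auto

text \<open>A half turn about the midpoint exchanges the ends of the edge and therefore the two
  weights. If the prescribed images are exchanged up to sign as well, the affine pieces on both
  sides fit together.\<close>

lemma edge_swap:
  assumes c: "wts c" "wts c'" and e: "hedge i j" and o: "orient (pt i) (pt j) (comb c pt) = 0" "orient (pt i) (pt j) (comb c' pt) = 0"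
    and z: "pt i + pt j = iv z" "comb c pt + comb c' pt = iv z"
    and g: "g' j = - g i" "g' i = - g j"
  shows "comb c g = - comb c' g'"
proof -
  note l = hedge_less[OF e]
  note s = edge_sup[OF c(1) e o(1)] edge_sup[OF c(2) e o(2)]
  note E = edge_comb[OF c(1) _ _ _ s(1), of] edge_comb[OF c(2) _ _ _ s(2)]
  have sums: "c i + c j = 1" "c' i + c' j = 1" using E(2,4) l by auto
  have "c i *\<^sub>R pt i + c j *\<^sub>R pt j + (c' i *\<^sub>R pt i + c' j *\<^sub>R pt j) = pt i + pt j"
    using z E(1)[of pt] E(3)[of pt] l by (simp del: pt_simps)
  moreover have "c j = 1 - c i" "c' j = 1 - c' i" using sums by auto
  ultimately have "(c i + c' i - 1) *\<^sub>R (pt i - pt j) = 0" by (simp add: algebra_simps del: pt_simps)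
  then have "c i + c' i = 1" using pt_distinct[OF e] by (simp del: pt_simps)
  then have "c' i = c j" "c' j = c i" using sums by auto
  then show ?thesis using E(1)[of g] E(3)[of g'] l g by simp
qed

end

text \<open>\<open>\<alpha>\<close> and \<open>\<beta>\<close> prescribe the images of the
  translates of \<open>w0\<close> and \<open>u0\<close>, and \<open>\<tau> k\<close> is the
  dissection used on the tile with index \<open>k\<close>. By \<open>per\<close> the indices
  \<open>0 \<le> k < B\<close> decide everything. \<open>contr\<close> shrinks each triangle, and
  \<open>val_H\<close> puts the image of the row of tiles inside the hexagon.\<close>

locale hex_model = hex_tiling +
  fixes B :: int and \<alpha> \<beta> :: "int \<Rightarrow> real \<times> real" and \<tau> :: "int \<Rightarrow> (nat \<times> nat \<times> nat) list"
    and S :: "real \<times> real \<Rightarrow> real \<times> real" and lam :: real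
  assumes B2: "B \<ge> 2" and S: "linear S" "inj S" and lam: "0 \<le> lam" "lam < 1"
    and per: "\<And>k. \<alpha> (k + B) = \<alpha> k + (2, - 1)" "\<And>k. \<beta> (k + B) = \<beta> k + (2, - 1)" "\<And>k. \<tau> (k + B) = \<tau> k"
    and tau: "\<And>k. \<tau> k \<in> {T0, T1, TF, TA, TB}"
    and contr: "\<And>k t. 0 \<le> k \<Longrightarrow> k < B \<Longrightarrow> t \<in> set (\<tau> k) \<Longrightarrow> lipT S lam (pts w0 u0 d e1 e2) (vls B \<alpha> \<beta> d e1 e2 (k, 0)) t"
    and val_H: "\<And>k i. 0 \<le> k \<Longrightarrow> k \<le> B - 2 \<Longrightarrow> i < 6 \<Longrightarrow> vls B \<alpha> \<beta> d e1 e2 (k, 0) i \<in> hexagon (pts w0 u0 d e1 e2)"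
      "\<And>i. i < 6 \<Longrightarrow> - vls B \<alpha> \<beta> d e1 e2 (B - 1, 0) i \<in> hexagon (pts w0 u0 d e1 e2)"
begin

abbreviation "vl \<equiv> vls B \<alpha> \<beta> d e1 e2"
abbreviation "bd \<equiv> (B - 1, 0 :: int)"

lemma vl_simps [simp]: "vl v 0 = av \<alpha> v" "vl v 1 = - av \<alpha> (bd - e1 - v)" "vl v (Suc 0) = - av \<alpha> (bd - e1 - v)" "vl v 2 = av \<alpha> (v + d)"
   "vl v 3 = av \<beta> (v + d)" "vl v 4 = - av \<beta> (bd - e2 - v)" "vl v 5 = av \<beta> v"
  by (simp_all add: vls_def)

lemma per_int: "\<alpha> (k + j * B) = \<alpha> k + (2 * of_int j, - of_int j)" "\<beta> (k + j * B) = \<beta> k + (2 * of_int j, - of_int j)" "\<tau> (k + j * B) = \<tau> k"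
proof -
  have "f (k + j * B) = f k + (2 * of_int j, - of_int j)" if "\<And>k. f (k + B) = f k + (2, - 1)" for f :: "int \<Rightarrow> real \<times> real"
  proof (induction j rule: int_induct[of _ 0])
    case base
    then show ?case by (simp flip: zero_prod_def)
  next
    case (step1 i)
    then show ?case using that[of "k + i * B"] by (simp add: algebra_simps prod_eq_iff)
  next
    case (step2 i)
    then show ?case using that[of "k + (i - 1) * B"] by (simp add: algebra_simps prod_eq_iff)
  qed
  then show "\<alpha> (k + j * B) = \<alpha> k + (2 * of_int j, - of_int j)" "\<beta> (k + j * B) = \<beta> k + (2 * of_int j, - of_int j)"
    using per by blast+
  show "\<tau> (k + j * B) = \<tau> k"
  proof (induction j rule: int_induct[of _ 0])
    case (step1 i)
    then show ?case using per(3)[of "k + i * B"] by (simp add: algebra_simps)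
  next
    case (step2 i)
    then show ?case using per(3)[of "k + (i - 1) * B"] by (simp add: algebra_simps)
  qed simp
qed

lemma av_shift: "av \<alpha> (v + (j * B, n)) = av \<alpha> v + iv (2 * j + n, - j)" "av \<beta> (v + (j * B, n)) = av \<beta> v + iv (2 * j + n, - j)"
  unfolding av_def iv_def by (simp_all add: per_int prod_eq_iff)

lemma vl_shift:
  assumes "i < 6"
  shows "vl (v + (j * B, n)) i = vl v i + iv (2 * j + n, - j)"
proof -
  define t where "t = (j * B, n)"
  define u where "u = iv (2 * j + n, - j)"
  have sh: "av \<alpha> (x + t) = av \<alpha> x + u" "av \<beta> (x + t) = av \<beta> x + u" for x
    unfolding t_def u_def by (rule av_shift)+
  have "bd - e - (v + t) + t = bd - e - v" for e by simp
  then have sh': "av \<alpha> (bd - e - v) = av \<alpha> (bd - e - (v + t)) + u" "av \<beta> (bd - e - v) = av \<beta> (bd - e - (v + t)) + u" for e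
    using sh[of "bd - e - (v + t)"] by simp_all
  have d: "v + t + d = v + d + t" by simp
  have "i \<in> {0, 1, 2, 3, 4, 5}" using assms by auto
  then have "vl (v + t) i = vl v i + u"
    by (elim insertE emptyE) (simp_all only: vl_simps d sh sh', simp_all)
  then show ?thesis unfolding t_def u_def .
qed

lemma comb_vl_shift: "wts c \<Longrightarrow> comb c (vl (v + (j * B, n))) = comb c (vl v) + iv (2 * j + n, - j)"
  using comb_add_const[of c "vl v" "iv (2 * j + n, - j)"] comb_cong[of c c "vl (v + (j * B, n))" "\<lambda>i. vl v i + iv (2 * j + n, - j)"]
  by (simp add: vl_shift)

text \<open>Well-definedness between translates: two representations of a point belong to one tile,
  where weights are unique, or to tiles glued along a translated edge, where the weights at
  corresponding ends coincide.\<close>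

lemma vl_agree:
  assumes c: "adm (\<tau> (fst v)) c" "adm (\<tau> (fst v')) c'" and eq: "comb c pt + iv v = comb c' pt + iv v'"
  shows "comb c (vl v) = comb c' (vl v')"
proof -
  have edge: "comb c (vl v) = comb c' (vl v')" if w: "wts c" "wts c'" and o: "orient (w0 + iv d) (u0 + iv d) (comb c pt) = 0"
    "orient u0 w0 (comb c' pt) = 0" and v: "v' = v + d" and eq: "comb c pt + iv v = comb c' pt + iv v'" for c c' v v'
  proof -
    have h: "hedge 2 3" "hedge 5 0" unfolding hedge_def by auto
    have o': "orient (pt 2) (pt 3) (comb c pt) = 0" "orient (pt 5) (pt 0) (comb c' pt) = 0" using o by auto
    note E = edge_comb[OF w(1) _ _ _ edge_sup[OF w(1) h(1) o'(1)]] edge_comb[OF w(2) _ _ _ edge_sup[OF w(2) h(2) o'(2)]]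
    have s: "c 2 + c 3 = 1" "c' 5 + c' 0 = 1" using E by auto
    have "comb c pt = c 2 *\<^sub>R w0 + c 3 *\<^sub>R u0 + (c 2 + c 3) *\<^sub>R iv d" using E(1)[of pt] by (simp add: algebra_simps)
    moreover have "comb c' pt = c' 5 *\<^sub>R u0 + c' 0 *\<^sub>R w0" using E(3)[of pt] by simp
    ultimately have "c 2 *\<^sub>R w0 + c 3 *\<^sub>R u0 = c' 5 *\<^sub>R u0 + c' 0 *\<^sub>R w0"
      using eq s unfolding v iv_simps by (simp add: algebra_simps)
    moreover have "c 3 = 1 - c 2" "c' 5 = 1 - c' 0" using s by auto
    ultimately have "(c 2 - c' 0) *\<^sub>R (w0 - u0) = 0" by (simp add: algebra_simps)
    moreover have "w0 \<noteq> u0" using pt_distinct[OF h(2)] by simp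
    ultimately have "c 2 = c' 0" by simp
    then have "c 3 = c' 5" using s by linarith
    then show ?thesis using E(1)[of "vl v"] E(3)[of "vl v'"] \<open>c 2 = c' 0\<close> v by simp
  qed
  have w: "wts c" "wts c'" using c unfolding adm_def by auto
  have "comb c pt - comb c' pt = iv (v' - v)" using eq unfolding iv_simps by (simp add: algebra_simps)
  from diff_int[OF comb_H[OF w(1)] comb_H[OF w(2)] this] show ?thesis
  proof (elim disjE conjE)
    assume "v' - v = 0"
    then have v: "v' = v" by simp
    have "\<forall>i<6. c i = c' i"
      by (rule peel_unique[OF convex6_peel[OF conv tau] good_tri_T[OF tau] c(1)]) (use c eq v in auto)
    then show ?thesis unfolding v by (intro comb_cong) auto
  next
    assume "v' - v = d" "orient (w0 + iv d) (u0 + iv d) (comb c pt) = 0" "orient u0 w0 (comb c' pt) = 0"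
    then show ?thesis using edge[OF w _ _ _ eq] by (simp add: algebra_simps)
  next
    assume "v' - v = - d" "orient u0 w0 (comb c pt) = 0" "orient (w0 + iv d) (u0 + iv d) (comb c' pt) = 0"
    then show ?thesis using edge[OF w(2,1) _ _ _ eq[symmetric]] by (simp add: algebra_simps)
  qed
qed

text \<open>Well-definedness between a tile and a half turn of a tile, which can only meet along one
  of the four centrally symmetric edges.\<close>

lemma vl_agree_reflect:
  assumes w: "wts c" "wts c'" and eq: "comb c pt + iv v = iv bd - (comb c' pt + iv v')"
  shows "comb c (vl v) = - comb c' (vl v')"
proof -
  have z: "comb c pt + comb c' pt = iv (bd - v - v')" using eq unfolding iv_simps by (simp add: algebra_simps)
  have h: "hedge 0 1" "hedge 1 2" "hedge 4 5" "hedge 3 4" unfolding hedge_def by auto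
  from sum_int[OF comb_H[OF w(1)] comb_H[OF w(2)] z] show ?thesis
  proof (elim disjE conjE)
    assume *: "bd - v - v' = e1" "orient w0 (iv e1 - w0) (comb c pt) = 0" "orient w0 (iv e1 - w0) (comb c' pt) = 0"
    have **: "bd - e1 - v = v'" "bd - e1 - v' = v" using *(1) by (auto simp: algebra_simps)
    show ?thesis by (rule edge_swap[OF w h(1) _ _ _ z]) (use * ** in \<open>simp_all add: algebra_simps\<close>)
  next
    assume *: "bd - v - v' = e1 + d" "orient (iv e1 - w0) (w0 + iv d) (comb c pt) = 0" "orient (iv e1 - w0) (w0 + iv d) (comb c' pt) = 0"
    have **: "bd - e1 - v = v' + d" "bd - e1 - v' = v + d" using *(1) by (auto simp: algebra_simps)
    show ?thesis by (rule edge_swap[OF w h(2) _ _ _ z]) (use * ** in \<open>simp_all add: iv_simps\<close>)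
  next
    assume *: "bd - v - v' = e2" "orient (iv e2 - u0) u0 (comb c pt) = 0" "orient (iv e2 - u0) u0 (comb c' pt) = 0"
    have **: "bd - e2 - v = v'" "bd - e2 - v' = v" using *(1) by (auto simp: algebra_simps)
    show ?thesis by (rule edge_swap[OF w h(3) _ _ _ z]) (use * ** in simp_all)
  next
    assume *: "bd - v - v' = e2 + d" "orient (u0 + iv d) (iv e2 - u0) (comb c pt) = 0" "orient (u0 + iv d) (iv e2 - u0) (comb c' pt) = 0"
    have **: "bd - e2 - v = v' + d" "bd - e2 - v' = v + d" using *(1) by (auto simp: algebra_simps)
    show ?thesis by (rule edge_swap[OF w h(4) _ _ _ z]) (use * ** in \<open>simp_all add: iv_simps\<close>)
  qed
qed

definition psi_rel :: "real \<times> real \<Rightarrow> real \<times> real \<Rightarrow> bool" where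
  "psi_rel x y \<longleftrightarrow> (\<exists>v c. adm (\<tau> (fst v)) c \<and>
     (x = comb c pt + iv v \<and> y = comb c (vl v) \<or> x = iv bd - (comb c pt + iv v) \<and> y = - comb c (vl v)))"

lemma psi_rel_unique:
  assumes "psi_rel x y" "psi_rel x y'"
  shows "y = y'"
proof -
  obtain v c v' c' where a: "adm (\<tau> (fst v)) c" "adm (\<tau> (fst v')) c'"
    and 1: "x = comb c pt + iv v \<and> y = comb c (vl v) \<or> x = iv bd - (comb c pt + iv v) \<and> y = - comb c (vl v)"
    and 2: "x = comb c' pt + iv v' \<and> y' = comb c' (vl v') \<or> x = iv bd - (comb c' pt + iv v') \<and> y' = - comb c' (vl v')"
    using assms unfolding psi_rel_def by blast
  have w: "wts c" "wts c'" using a unfolding adm_def by auto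
  from 1 2 show ?thesis
  proof (elim disjE conjE)
    assume "x = comb c pt + iv v" "y = comb c (vl v)" "x = comb c' pt + iv v'" "y' = comb c' (vl v')"
    then show ?thesis using vl_agree[OF a] by simp
  next
    assume "x = comb c pt + iv v" "y = comb c (vl v)" "x = iv bd - (comb c' pt + iv v')" "y' = - comb c' (vl v')"
    then show ?thesis using vl_agree_reflect[OF w, of v v'] by simp
  next
    assume "x = iv bd - (comb c pt + iv v)" "y = - comb c (vl v)" "x = comb c' pt + iv v'" "y' = comb c' (vl v')"
    then show ?thesis using vl_agree_reflect[OF w(2,1), of v' v] by simp
  next
    assume *: "x = iv bd - (comb c pt + iv v)" "y = - comb c (vl v)" "x = iv bd - (comb c' pt + iv v')" "y' = - comb c' (vl v')"
    have "comb c pt + iv v = comb c' pt + iv v'" using *(1,3) by (metis diff_diff_eq2 add_diff_cancel_left')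
    then show ?thesis using vl_agree[OF a] * by simp
  qed
qed

lemma psi_rel_total: "\<exists>y. psi_rel x y"
proof -
  obtain v where "x - iv v \<in> H \<or> iv v - x \<in> H" using cover by blast
  then show ?thesis
  proof
    assume "x - iv v \<in> H"
    then obtain c where "adm (\<tau> (fst v)) c" "x - iv v = comb c pt" using hexagon_cover[OF conv _ tau] by blast
    then show ?thesis unfolding psi_rel_def by (metis diff_add_cancel)
  next
    assume "iv v - x \<in> H"
    then obtain c where c: "adm (\<tau> (fst (bd - v))) c" "iv v - x = comb c pt" using hexagon_cover[OF conv _ tau] by blast
    then have "x = iv bd - (comb c pt + iv (bd - v))" unfolding iv_simps by (simp add: algebra_simps)
    then show ?thesis using c(1) unfolding psi_rel_def by blast
  qed
qed

definition psi :: "real \<times> real \<Rightarrow> real \<times> real" where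
  "psi x = (THE y. psi_rel x y)"

lemma psi_eq: "psi_rel x y \<Longrightarrow> psi x = y"
  unfolding psi_def using psi_rel_unique by blast

lemma psi_rel_psi: "psi_rel x (psi x)"
  using psi_rel_total psi_eq by metis

lemma psi_tile: "adm (\<tau> (fst v)) c \<Longrightarrow> psi (comb c pt + iv v) = comb c (vl v)"
  by (rule psi_eq) (unfold psi_rel_def, blast)

lemma psi_tile_reflect: "adm (\<tau> (fst v)) c \<Longrightarrow> psi (iv bd - (comb c pt + iv v)) = - comb c (vl v)"
  by (rule psi_eq) (unfold psi_rel_def, blast)

lemma psi_cases:
  obtains v c where "adm (\<tau> (fst v)) c" "x = comb c pt + iv v" "psi x = comb c (vl v)"
  | v c where "adm (\<tau> (fst v)) c" "x = iv bd - (comb c pt + iv v)" "psi x = - comb c (vl v)"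
  using psi_rel_psi[of x] unfolding psi_rel_def by blast

lemma psi_reflect: "psi (iv bd - x) = - psi x"
proof (rule psi_cases[of x])
  fix v c assume *: "adm (\<tau> (fst v)) c" "x = comb c pt + iv v" "psi x = comb c (vl v)"
  then show ?thesis using psi_tile_reflect[OF *(1)] by simp
next
  fix v c assume *: "adm (\<tau> (fst v)) c" "x = iv bd - (comb c pt + iv v)" "psi x = - comb c (vl v)"
  then have "iv bd - x = comb c pt + iv v" by simp
  then show ?thesis using psi_tile[OF *(1)] *(3) by simp
qed

lemma psi_shift: "psi (x + iv (j * B, n)) = psi x + iv (2 * j + n, - j)"
proof (rule psi_cases[of x])
  fix v c assume *: "adm (\<tau> (fst v)) c" "x = comb c pt + iv v" "psi x = comb c (vl v)"
  have "adm (\<tau> (fst (v + (j * B, n)))) c" using *(1) by (simp add: per_int)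
  from psi_tile[OF this] show ?thesis using * comb_vl_shift[of c v j n] by (simp add: iv_simps adm_def add.assoc)
next
  fix v c assume *: "adm (\<tau> (fst v)) c" "x = iv bd - (comb c pt + iv v)" "psi x = - comb c (vl v)"
  have "adm (\<tau> (fst (v + (- j * B, - n)))) c" using *(1) per_int(3)[of "fst v" "- j"] by simp
  from psi_tile_reflect[OF this]
  have "psi (iv bd - (comb c pt + iv (v + (- j * B, - n)))) = - (comb c (vl v) + iv (2 * - j + - n, - (- j)))"
    using *(1) comb_vl_shift[of c v "- j" "- n"] by (simp add: adm_def)
  moreover have "iv bd - (comb c pt + iv (v + (- j * B, - n))) = x + iv (j * B, n)"
    unfolding *(2) iv_simps by (simp add: iv_def prod_eq_iff)
  moreover have "- (comb c (vl v) + iv (2 * - j + - n, - (- j))) = psi x + iv (2 * j + n, - j)"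
    unfolding *(3) by (simp add: iv_def prod_eq_iff)
  ultimately show ?thesis by simp
qed

lemma tri_set_eq:
  assumes "good_tri (p, q, r)"
  shows "(\<exists>c. wts c \<and> sup_on c (p, q, r) \<and> x = comb c pt)
    \<longleftrightarrow> orient (pt p) (pt q) x \<ge> 0 \<and> orient (pt q) (pt r) x \<ge> 0 \<and> orient (pt r) (pt p) x \<ge> 0"
proof
  assume "\<exists>c. wts c \<and> sup_on c (p, q, r) \<and> x = comb c pt"
  then obtain c where c: "wts c" "sup_on c (p, q, r)" "x = comb c pt" by blast
  have o: "orient a b x = c p * orient a b (pt p) + c q * orient a b (pt q) + c r * orient a b (pt r)" for a b
    unfolding c(3) orient_comb[OF c(1)] using sum_sup_on[OF assms c(2), of "\<lambda>i. orient a b (pt i)"] by (simp del: pt_simps)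
  have "c p \<ge> 0" "c q \<ge> 0" "c r \<ge> 0" using c(1) assms unfolding wts_def good_tri_def by auto
  moreover have "p < q" "q < r" "r < 6" using assms unfolding good_tri_def by auto
  note convex6_pos[OF conv this, THEN less_imp_le]
  ultimately show "orient (pt p) (pt q) x \<ge> 0 \<and> orient (pt q) (pt r) x \<ge> 0 \<and> orient (pt r) (pt p) x \<ge> 0"
    unfolding o by (simp del: pt_simps)
next
  assume "orient (pt p) (pt q) x \<ge> 0 \<and> orient (pt q) (pt r) x \<ge> 0 \<and> orient (pt r) (pt p) x \<ge> 0"
  moreover have "orient (pt p) (pt q) (pt r) > 0" using assms conv unfolding good_tri_def convex6_def by auto
  ultimately show "\<exists>c. wts c \<and> sup_on c (p, q, r) \<and> x = comb c pt" using tri_cover[OF assms, of pt x] by blast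
qed

text \<open>A shift by a period adds a constant to the vertex images, so \<open>B\<close> tiles have
  to be checked. \<open>J\<close> will be 0 for contraction and a similarity for
  injectivity.\<close>

lemma lip_all_tiles:
  assumes J: "linear J" and h: "\<And>k t. 0 \<le> k \<Longrightarrow> k < B \<Longrightarrow> t \<in> set (\<tau> k) \<Longrightarrow> lipT S r pt (\<lambda>i. vl (k, 0) i - J (pt i)) t"
    and t: "t \<in> set (\<tau> (fst v))"
  shows "lipT S r pt (\<lambda>i. vl v i - J (pt i)) t"
proof -
  define k where "k = fst v mod B"
  define j where "j = fst v div B"
  have v: "v = (k, 0) + (j * B, snd v)" unfolding k_def j_def by (simp add: prod_eq_iff)
  have k: "0 \<le> k" "k < B" unfolding k_def using B2 by auto
  have fv: "fst v = k + j * B" unfolding k_def j_def by simp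
  have t': "t \<in> set (\<tau> k)" using t unfolding fv per_int .
  show ?thesis
  proof (rule lipT_const[OF h[OF k t']])
    show "vl v i - J (pt i) = vl (k, 0) i - J (pt i) + iv (2 * j + snd v, - j)" if "i < 6" for i
      using vl_shift[OF that, of "(k, 0)" j "snd v"] v by (metis add_diff_eq diff_add_eq)
    show "good_tri t" using t good_tri_T[OF tau] by blast
  qed
qed

text \<open>The segment from \<open>y\<close> to \<open>x\<close> is covered by finitely many closed
  parameter sets on which it stays in one triangle; the Lipschitz bounds on these combine to one on
  the whole interval.\<close>

lemma psi_lip:
  assumes J: "linear J" and r: "r \<ge> 0"
    and h: "\<And>k t. 0 \<le> k \<Longrightarrow> k < B \<Longrightarrow> t \<in> set (\<tau> k) \<Longrightarrow> lipT S r pt (\<lambda>i. vl (k, 0) i - J (pt i)) t"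
  shows "norm (S (psi x - J x - (psi y - J y))) \<le> r * norm (S (x - y))"
proof -
  define \<gamma> where "\<gamma> = (\<lambda>s::real. y + s *\<^sub>R (x - y))"
  define f where "f = (\<lambda>s. S (psi (\<gamma> s) - J (\<gamma> s)))"
  define M where "M = r * norm (S (x - y))"
  \<comment> \<open>Brings a point back to the reference hexagon, from a translate if
    \<open>b\<close> holds and from a half turn otherwise.\<close>
  define loc where "loc = (\<lambda>(b :: bool) v x. if b then x - iv v else iv bd - x - iv v)"
  define Tri where "Tri = (\<lambda>t. {z. \<exists>c. wts c \<and> sup_on c t \<and> z = comb c pt})"
  define U where "U = (\<lambda>((v, b), t). {s. loc b v (\<gamma> s) \<in> Tri t})"
  obtain m where m: "\<And>z. z \<in> H \<Longrightarrow> norm z \<le> m" using compact_imp_bounded[OF compact_hexagon[OF conv]] by (meson bounded_iff)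
  \<comment> \<open>Bounds the lattice vectors of all tiles that the segment meets, which makes the
    index set \<open>I\<close> finite.\<close>
  define Q where "Q = norm (iv bd) + norm x + 2 * norm y + m"
  define N where "N = \<lceil>Q\<rceil>"
  define I where "I = (SIGMA w:(({- N..N} \<times> {- N..N}) \<times> (UNIV :: bool set)). set (\<tau> (fst (fst w))))"
  have finI: "finite I" unfolding I_def by (intro finite_SigmaI finite_cartesian_product) auto
  have good: "good_tri t" if "t \<in> set (\<tau> k)" for t k using good_tri_T[OF tau] that by blast
  have lipU: "M-lipschitz_on (U i) f" if iI: "i \<in> I" for i
  proof -
    obtain v b t where i: "i = ((v, b), t)" by (cases i) auto
    have t: "t \<in> set (\<tau> (fst v))" using iI unfolding i I_def by auto
    show ?thesis
    proof (rule lipschitz_onI)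
      show "0 \<le> M" unfolding M_def using r by simp
      fix s s' assume "s \<in> U i" "s' \<in> U i"
      then obtain c c' where c: "wts c" "sup_on c t" "loc b v (\<gamma> s) = comb c pt"
        and c': "wts c'" "sup_on c' t" "loc b v (\<gamma> s') = comb c' pt"
        unfolding U_def i Tri_def by auto
      have a: "adm (\<tau> (fst v)) c" "adm (\<tau> (fst v)) c'" using c c' t unfolding adm_def by auto
      define g where "g = (\<lambda>i. vl v i - J (pt i))"
      have val: "psi (\<gamma> s) - J (\<gamma> s) = (if b then comb e g - J (iv v) else - comb e g - J (iv bd - iv v))"
        if "adm (\<tau> (fst v)) e" "loc b v (\<gamma> s) = comb e pt" for e s
      proof (cases b)
        case True
        then have x: "\<gamma> s = comb e pt + iv v" using that(2) unfolding loc_def by (simp add: algebra_simps)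
        show ?thesis unfolding x psi_tile[OF that(1)] g_def comb_diff comb_linear[OF J] using True by (simp add: linear_add[OF J])
      next
        case False
        then have x: "\<gamma> s = iv bd - (comb e pt + iv v)" using that(2) unfolding loc_def by (simp add: algebra_simps)
        show ?thesis unfolding x psi_tile_reflect[OF that(1)] g_def comb_diff comb_linear[OF J]
          using False by (simp add: linear_add[OF J] linear_diff[OF J])
      qed
      have "norm (f s - f s') = norm (S (comb c g - comb c' g))"
        unfolding f_def val[OF a(1) c(3)] val[OF a(2) c'(3)] linear_diff[OF S(1), symmetric]
        by (auto simp: linear_diff[OF S(1)] linear_neg[OF S(1)] norm_minus_commute)
      also have "\<dots> \<le> r * norm (S (comb c pt - comb c' pt))"
        unfolding g_def by (rule lipT_comb[OF lip_all_tiles[OF J h t] good[OF t] c(2) c'(2) c(1) c'(1)])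
      also have "comb c pt - comb c' pt = (if b then 1 else - 1) *\<^sub>R ((s - s') *\<^sub>R (x - y))"
        unfolding c(3)[symmetric] c'(3)[symmetric] loc_def \<gamma>_def by (simp add: algebra_simps)
      also have "norm (S ((if b then 1 else - 1) *\<^sub>R ((s - s') *\<^sub>R (x - y)))) = \<bar>s - s'\<bar> * norm (S (x - y))"
        by (simp add: linear_cmul[OF S(1)] linear_neg[OF S(1)] abs_minus_commute)
      finally show "dist (f s) (f s') \<le> M * dist s s'"
        unfolding M_def by (simp add: dist_norm dist_real_def mult_ac)
    qed
  qed
  have clU: "closed (U i)" if iI: "i \<in> I" for i
  proof -
    obtain v b p q r where i: "i = ((v, b), (p, q, r))" by (cases i) auto
    have g: "good_tri (p, q, r)" using iI good unfolding i I_def by auto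
    have cl: "continuous_on UNIV (\<lambda>s. loc b v (\<gamma> s))"
      unfolding loc_def \<gamma>_def by (cases b) (auto intro!: continuous_intros)
    have "U i = {s. orient (pt p) (pt q) (loc b v (\<gamma> s)) \<ge> 0 \<and> orient (pt q) (pt r) (loc b v (\<gamma> s)) \<ge> 0 \<and> orient (pt r) (pt p) (loc b v (\<gamma> s)) \<ge> 0}"
      unfolding U_def i Tri_def using tri_set_eq[OF g] by simp
    then show ?thesis
      by (simp only:) (intro closed_Collect_conj closed_Collect_le continuous_on_orient continuous_on_const cl)
  qed
  have cov: "{0..1} \<subseteq> (\<Union>i\<in>I. U i)"
  proof
    fix s :: real assume s: "s \<in> {0..1}"
    have ng: "norm (\<gamma> s) \<le> norm x + 2 * norm y"
    proof -
      have "norm (\<gamma> s) \<le> norm y + norm (s *\<^sub>R (x - y))" unfolding \<gamma>_def by (rule norm_triangle_ineq)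
      also have "norm (s *\<^sub>R (x - y)) \<le> norm (x - y)" using s by (simp add: mult_left_le_one_le)
      finally show ?thesis using norm_triangle_ineq4[of x y] by linarith
    qed
    obtain v c b where vc: "adm (\<tau> (fst v)) c" "loc b v (\<gamma> s) = comb c pt"
    proof (rule psi_cases[of "\<gamma> s"])
      fix v c assume "adm (\<tau> (fst v)) c" "\<gamma> s = comb c pt + iv v"
      then show ?thesis using that[of v c True] unfolding loc_def by simp
    next
      fix v c assume "adm (\<tau> (fst v)) c" "\<gamma> s = iv bd - (comb c pt + iv v)"
      then show ?thesis using that[of v c False] unfolding loc_def by simp
    qed
    then obtain t where t: "t \<in> set (\<tau> (fst v))" "sup_on c t" and w: "wts c" unfolding adm_def by auto
    have nc: "norm (comb c pt) \<le> m" using m comb_H[OF w] by blast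
    have "norm (iv v) \<le> Q"
    proof (cases b)
      case True
      then have "iv v = \<gamma> s - comb c pt" using vc(2) unfolding loc_def by (simp add: algebra_simps)
      then have "norm (iv v) \<le> norm (\<gamma> s) + norm (comb c pt)" by (simp add: norm_triangle_ineq4)
      then show ?thesis unfolding Q_def using ng nc norm_ge_zero[of "iv bd"] by linarith
    next
      case False
      then have "iv v = (iv bd - \<gamma> s) - comb c pt" using vc(2) unfolding loc_def by (simp add: algebra_simps)
      then have "norm (iv v) \<le> norm (iv bd - \<gamma> s) + norm (comb c pt)" by (simp add: norm_triangle_ineq4)
      also have "norm (iv bd - \<gamma> s) \<le> norm (iv bd) + norm (\<gamma> s)" by (rule norm_triangle_ineq4)
      finally show ?thesis unfolding Q_def using ng nc by linarith
    qed
    then have "\<bar>real_of_int (fst v)\<bar> \<le> Q" "\<bar>real_of_int (snd v)\<bar> \<le> Q"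
      using norm_fst_le[of "real_of_int (fst v)" "real_of_int (snd v)"] norm_snd_le[of "real_of_int (snd v)" "real_of_int (fst v)"]
      unfolding iv_def real_norm_def by linarith+
    then have "real_of_int \<bar>fst v\<bar> \<le> of_int N" "real_of_int \<bar>snd v\<bar> \<le> of_int N" unfolding N_def by linarith+
    then have "\<bar>fst v\<bar> \<le> N" "\<bar>snd v\<bar> \<le> N" by (simp_all only: of_int_le_iff)
    then have "v \<in> {- N..N} \<times> {- N..N}" by (cases v) auto
    then have "((v, b), t) \<in> I" unfolding I_def using t by auto
    moreover have "s \<in> U ((v, b), t)" unfolding U_def Tri_def using vc(2) w t(2) by auto
    ultimately show "s \<in> (\<Union>i\<in>I. U i)" by blast
  qed
  have "M-lipschitz_on {0..1} f"
    by (rule lipschitz_on_closed_Union[OF lipU clU finI _ cov]) (use r in \<open>auto simp: M_def\<close>)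
  then have "dist (f 1) (f 0) \<le> M * dist 1 (0 :: real)" by (rule lipschitz_onD) auto
  then show ?thesis unfolding f_def \<gamma>_def M_def by (simp add: dist_norm linear_diff[OF S(1)])
qed

sublocale tile_model B psi S lam
proof (rule tile_model.intro)
  show "psi (p + (0, 1)) = psi p + (1, 0)" for p using psi_shift[of p 0 1] by (simp add: iv_def)
  show "psi (p + (of_int B, 0)) = psi p + (2, - 1)" for p using psi_shift[of p 1 0] by (simp add: iv_def)
  show "psi ((of_int B - 1, 0) - p) = - psi p" for p using psi_reflect[of p] by (simp add: iv_def)
  show "norm (S (psi p - psi q)) \<le> lam * norm (S (p - q))" for p q
    using psi_lip[of "\<lambda>_. 0" lam p q] contr lam by (simp add: linear_zero)
qed (rule B2 S lam)+

text \<open>The union of the digit copies of the hexagon, which \<open>psi\<close> has to map onto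
  the hexagon for \<open>tile_homeomorphic_model\<close>.\<close>

definition row :: "(real \<times> real) set" where
  "row = {(x + of_int k, y) |x y k. (x, y) \<in> H \<and> 0 \<le> k \<and> k \<le> B - 2} \<union> uminus ` H"

lemma row_tile: "p \<in> H \<Longrightarrow> 0 \<le> k \<Longrightarrow> k \<le> B - 2 \<Longrightarrow> p + iv (k, 0) \<in> row"
  unfolding row_def iv_def by (cases p) auto

lemma row_neg: "p \<in> H \<Longrightarrow> - p \<in> row"
  unfolding row_def by auto

lemma row_cases:
  assumes "x \<in> row"
  obtains k p where "p \<in> H" "0 \<le> k" "k \<le> B - 2" "x = p + iv (k, 0)" | p where "p \<in> H" "x = - p"
  using assms unfolding row_def iv_def by fastforce

lemma psi_row_subset: "psi ` row \<subseteq> H"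
proof
  fix y assume "y \<in> psi ` row"
  then obtain x where x: "x \<in> row" "y = psi x" by auto
  from x(1) show "y \<in> H"
  proof (cases rule: row_cases)
    case (1 k p)
    obtain c where c: "adm (\<tau> (fst (k, 0 :: int))) c" "p = comb c pt" using hexagon_cover[OF conv 1(1) tau] by blast
    have "y = comb c (vl (k, 0))" using psi_tile[OF c(1)] x(2) 1(4) c(2) by simp
    then show ?thesis using comb_in_hexagon[of c "vl (k, 0)" pt] val_H(1)[OF 1(2,3)] c(1) unfolding adm_def by simp
  next
    case (2 p)
    obtain c where c: "adm (\<tau> (fst bd)) c" "p = comb c pt" using hexagon_cover[OF conv 2(1) tau] by blast
    \<comment> \<open>The copy \<open>- H\<close> is the half turn of the tile with index
      \<open>B - 1\<close>.\<close>
    have "x = iv bd - (comb c pt + iv bd)" using 2 c by simp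
    then have "y = - comb c (vl bd)" using psi_tile_reflect[OF c(1)] x(2) by simp
    then have "y = comb c (\<lambda>i. - vl bd i)" by (simp add: comb_neg)
    then show ?thesis using comb_in_hexagon[of c "\<lambda>i. - vl bd i" pt] val_H(2) c(1) unfolding adm_def by simp
  qed
qed

lemma compact_row: "compact row"
proof -
  have "row = (\<Union>k\<in>{0..B - 2}. (\<lambda>p. p + iv (k, 0)) ` H) \<union> uminus ` H"
  proof
    show "row \<subseteq> (\<Union>k\<in>{0..B - 2}. (\<lambda>p. p + iv (k, 0)) ` H) \<union> uminus ` H"
    proof
      fix x assume "x \<in> row"
      then show "x \<in> (\<Union>k\<in>{0..B - 2}. (\<lambda>p. p + iv (k, 0)) ` H) \<union> uminus ` H" by (cases rule: row_cases) auto
    qed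
  qed (use row_tile row_neg in auto)
  then show ?thesis
    using compact_hexagon[OF conv] by (auto intro!: compact_Un compact_UN compact_continuous_image continuous_intros)
qed

text \<open>Write an interior point \<open>p\<close> as \<open>psi x\<close>. Up to a shift by
  periods the tile of \<open>x\<close> is one whose image lies in \<open>H\<close> or in
  \<open>- H\<close>, so \<open>p\<close> differs from a point there by a lattice vector. For an
  interior point the tiling admits only \<open>H\<close> and the zero vector, and then
  \<open>x\<close> was in the row.\<close>

lemma psi_row_superset: "H \<subseteq> psi ` row"
proof -
  have "hex_interior pt \<subseteq> psi ` row"
  proof
    fix p assume p: "p \<in> hex_interior pt"
    then have pH: "p \<in> H" unfolding hex_interior_def hexagon_def by auto
    have ne: "orient w0 (iv e1 - w0) p \<noteq> 0" "orient (iv e1 - w0) (w0 + iv d) p \<noteq> 0" "orient (w0 + iv d) (u0 + iv d) p \<noteq> 0"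
       "orient (u0 + iv d) (iv e2 - u0) p \<noteq> 0" "orient (iv e2 - u0) u0 p \<noteq> 0" "orient u0 w0 p \<noteq> 0"
      using p unfolding hex_interior_def by auto
    have diff0: "z = 0" if "q \<in> H" "p - q = iv z" for q z using diff_int[OF pH that] ne by auto
    have sum0: False if "q \<in> H" "p + q = iv z" for q z using sum_int[OF pH that] ne by auto
    obtain x where x: "p = psi x" using psi_surj by (metis surjD)
    have dec: "\<exists>k j. 0 \<le> k \<and> k < B \<and> fst v = k + j * B" for v :: "int \<times> int"
      using B2 by (intro exI[of _ "fst v mod B"] exI[of _ "fst v div B"]) auto
    have main: "\<exists>k j. 0 \<le> k \<and> k < B \<and> v = (k, 0) + (j * B, snd v) \<and> comb c (vl v) = comb c (vl (k, 0)) + iv (2 * j + snd v, - j)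
       \<and> (k \<le> B - 2 \<longrightarrow> comb c (vl (k, 0)) \<in> H) \<and> (k = B - 1 \<longrightarrow> - comb c (vl (k, 0)) \<in> H)"
      if w: "wts c" for v c
    proof -
      obtain k j where kj: "0 \<le> k" "k < B" "fst v = k + j * B" using dec by blast
      have v: "v = (k, 0) + (j * B, snd v)" using kj(3) by (simp add: prod_eq_iff)
      have "comb c (vl v) = comb c (vl (k, 0)) + iv (2 * j + snd v, - j)" using comb_vl_shift[OF w, of "(k, 0)" j "snd v"] v by simp
      moreover have "k \<le> B - 2 \<longrightarrow> comb c (vl (k, 0)) \<in> H" using comb_in_hexagon[OF w] val_H(1) kj by blast
      moreover have "k = B - 1 \<longrightarrow> - comb c (vl (k, 0)) \<in> H"
        using comb_in_hexagon[OF w, of "\<lambda>i. - vl bd i" pt] val_H(2) by (auto simp: comb_neg)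
      ultimately show ?thesis using kj v by blast
    qed
    have zero: "j = 0 \<and> n = 0" if "(2 * j + n, - j) = (0 :: int \<times> int)" for j n :: int
      using that by (auto simp: zero_prod_def)
    show "p \<in> psi ` row"
    proof (rule psi_cases[of x])
      fix v c assume *: "adm (\<tau> (fst v)) c" "x = comb c pt + iv v" "psi x = comb c (vl v)"
      have w: "wts c" using *(1) unfolding adm_def by simp
      obtain k j where k: "0 \<le> k" "k < B" "v = (k, 0) + (j * B, snd v)" "comb c (vl v) = comb c (vl (k, 0)) + iv (2 * j + snd v, - j)"
        "k \<le> B - 2 \<longrightarrow> comb c (vl (k, 0)) \<in> H" "k = B - 1 \<longrightarrow> - comb c (vl (k, 0)) \<in> H" using main[OF w, of v] by blast
      have p': "p - comb c (vl (k, 0)) = iv (2 * j + snd v, - j)" using x *(3) k(4) by simp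
      show ?thesis
      proof (cases "k \<le> B - 2")
        case True
        then have "(2 * j + snd v, - j) = 0" using diff0[OF _ p'] k(5) by blast
        then have "j = 0" "snd v = 0" using zero by blast+
        then have "v = (k, 0)" using k(3) by (simp add: prod_eq_iff)
        then have "x \<in> row" using *(2) row_tile[OF comb_H[OF w] k(1) True] by simp
        then show ?thesis using x by blast
      next
        case False
        then have "k = B - 1" using k(2) by linarith
        then show ?thesis using sum0[of "- comb c (vl (k, 0))"] k(6) p' by auto
      qed
    next
      fix v c assume *: "adm (\<tau> (fst v)) c" "x = iv bd - (comb c pt + iv v)" "psi x = - comb c (vl v)"
      have w: "wts c" using *(1) unfolding adm_def by simp
      obtain k j where k: "0 \<le> k" "k < B" "v = (k, 0) + (j * B, snd v)" "comb c (vl v) = comb c (vl (k, 0)) + iv (2 * j + snd v, - j)"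
        "k \<le> B - 2 \<longrightarrow> comb c (vl (k, 0)) \<in> H" "k = B - 1 \<longrightarrow> - comb c (vl (k, 0)) \<in> H" using main[OF w, of v] by blast
      have p': "p + comb c (vl (k, 0)) = iv (- (2 * j + snd v, - j))" unfolding iv_simps using x *(3) k(4) by simp
      show ?thesis
      proof (cases "k \<le> B - 2")
        case True
        then show ?thesis using sum0[OF _ p'] k(5) by blast
      next
        case False
        then have kB: "k = B - 1" using k(2) by linarith
        have "p - (- comb c (vl (k, 0))) = iv (- (2 * j + snd v, - j))" using p' by simp
        then have "- (2 * j + snd v, - j) = 0" using diff0 k(6) kB by blast
        then have "(2 * j + snd v, - j) = 0" by (metis neg_equal_0_iff_equal)
        then have "j = 0" "snd v = 0" using zero by blast+
        then have "v = bd" using k(3) kB by (simp add: prod_eq_iff)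
        then have "x = - comb c pt" using *(2) by simp
        then have "x \<in> row" using row_neg[OF comb_H[OF w]] by simp
        then show ?thesis using x by blast
      qed
    qed
  qed
  moreover have "closed (psi ` row)"
    using compact_continuous_image[OF psi_cont compact_row] compact_imp_closed by blast
  ultimately have "closure (hex_interior pt) \<subseteq> psi ` row" by (rule closure_minimal)
  then show ?thesis using hexagon_subset_closure[OF conv] by blast
qed

theorem disk_like_if_inj:
  assumes "inj psi"
  shows "disk_like (tile (- 2) B)"
proof -
  have "tile (- 2) B homeomorphic H"
  proof (rule tile_homeomorphic_model[OF assms compact_hexagon[OF conv]])
    show "H \<noteq> {}" using vertex_in_hexagon[OF conv, of 0] by auto
    show "psi ` ({(x + of_int k, y) |x y k. (x, y) \<in> H \<and> 0 \<le> k \<and> k \<le> B - 2} \<union> uminus ` H) = H"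
      using psi_row_subset psi_row_superset unfolding row_def by blast
  qed
  then show ?thesis unfolding disk_like_def using hexagon_disk_like[OF conv] homeomorphic_trans by blast
qed

text \<open>\<open>psi\<close> is \<open>J\<close> plus a map with Lipschitz constant
  \<open>r\<close>, which cannot cancel the factor \<open>rho\<close> by which \<open>J\<close> at
  least stretches.\<close>

lemma inj_criterion:
  assumes J: "linear J" "\<And>z. rho * norm (S z) \<le> norm (S (J z))" and r: "0 \<le> r" "r < rho"
    and h: "\<And>k t. 0 \<le> k \<Longrightarrow> k < B \<Longrightarrow> t \<in> set (\<tau> k) \<Longrightarrow> lipT S r pt (\<lambda>i. vl (k, 0) i - J (pt i)) t"
  shows "inj psi"
proof (rule injI)
  fix x y assume "psi x = psi y"
  then have "psi x - J x - (psi y - J y) = - J (x - y)" by (simp add: linear_diff[OF J(1)])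
  then have "norm (S (J (x - y))) \<le> r * norm (S (x - y))"
    using psi_lip[OF J(1) r(1) h, of x y] by (simp add: linear_neg[OF S(1)])
  then have "(rho - r) * norm (S (x - y)) \<le> 0" using J(2)[of "x - y"] by (simp add: algebra_simps)
  then have "norm (S (x - y)) \<le> 0" using r by (simp add: mult_le_0_iff)
  then have "S (x - y) = S 0" using linear_0[OF S(1)] by simp
  then have "x - y = 0" using S(2) by (simp only: inj_eq)
  then show "x = y" by simp
qed

end

section \<open>Gram determinants and similarities\<close>

definition shear :: "real \<Rightarrow> real \<Rightarrow> real \<times> real \<Rightarrow> real \<times> real" where
  "shear s t p = (fst p + s * snd p, t * snd p)"
text \<open>The inner product of the images of \<open>u\<close> and \<open>v\<close> under
  \<open>shear s t\<close>.\<close>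

definition bil :: "real \<Rightarrow> real \<Rightarrow> real \<times> real \<Rightarrow> real \<times> real \<Rightarrow> real" where
  "bil s t u v = (fst u + s * snd u) * (fst v + s * snd v) + t * t * snd u * snd v"
text \<open>Positivity of the binary quadratic form that compares \<open>L^2\<close> times the
  squared length of \<open>b f1 + c f2\<close> with the squared length of
  \<open>b g1 + c g2\<close>: positive leading coefficient and nonnegative determinant. For rational
  data this is plain arithmetic.\<close>

definition gram_ok :: "real \<Rightarrow> real \<Rightarrow> real \<Rightarrow> real \<times> real \<Rightarrow> real \<times> real \<Rightarrow> real \<times> real \<Rightarrow> real \<times> real \<Rightarrow> bool" where
  "gram_ok s t L f1 f2 g1 g2 \<longleftrightarrow> L * L * bil s t f1 f1 - bil s t g1 g1 > 0 \<and>
     (L * L * bil s t f1 f2 - bil s t g1 g2) * (L * L * bil s t f1 f2 - bil s t g1 g2)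
      \<le> (L * L * bil s t f1 f1 - bil s t g1 g1) * (L * L * bil s t f2 f2 - bil s t g2 g2)"

lemma norm_shear: "(norm (shear s t u))\<^sup>2 = bil s t u u"
  unfolding norm_pair_sq by (simp add: shear_def bil_def power2_eq_square algebra_simps)

lemma linear_shear: "linear (shear s t)"
  by (rule linearI) (auto simp: shear_def algebra_simps)

lemma inj_shear: "t \<noteq> 0 \<Longrightarrow> inj (shear s t)"
  by (rule injI) (auto simp: shear_def prod_eq_iff)

lemma bil_comb: "bil s t (b *\<^sub>R u + c *\<^sub>R v) (b *\<^sub>R u + c *\<^sub>R v) = b * b * bil s t u u + 2 * b * c * bil s t u v + c * c * bil s t v v"
  by (simp add: bil_def algebra_simps)

lemma lipT_gram:
  assumes L: "L \<ge> 0" and g: "gram_ok s t L (f q - f p) (f r - f p) (g q - g p) (g r - g p)"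
  shows "lipT (shear s t) L f g (p, q, r)"
  unfolding lipT_def prod.case
proof (intro allI)
  fix b c :: real
  define A B C where "A = L * L * bil s t (f q - f p) (f q - f p) - bil s t (g q - g p) (g q - g p)"
    and "B = L * L * bil s t (f q - f p) (f r - f p) - bil s t (g q - g p) (g r - g p)"
    and "C = L * L * bil s t (f r - f p) (f r - f p) - bil s t (g r - g p) (g r - g p)"
  have AB: "A > 0" "B * B \<le> A * C" using g unfolding gram_ok_def A_def B_def C_def by auto
  have "A * (b * b * A + 2 * b * c * B + c * c * C) = (A * b + B * c)\<^sup>2 + (A * C - B * B) * (c * c)"
    by (simp add: power2_eq_square algebra_simps)
  also have "\<dots> \<ge> 0" using AB by simp
  finally have 0: "b * b * A + 2 * b * c * B + c * c * C \<ge> 0" using AB(1) by (simp add: zero_le_mult_iff)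
  let ?u = "b *\<^sub>R (f q - f p) + c *\<^sub>R (f r - f p)" and ?v = "b *\<^sub>R (g q - g p) + c *\<^sub>R (g r - g p)"
  have "L * L * bil s t ?u ?u - bil s t ?v ?v = b * b * A + 2 * b * c * B + c * c * C"
    unfolding bil_comb A_def B_def C_def by (simp add: algebra_simps)
  with 0 have "bil s t ?v ?v \<le> L * L * bil s t ?u ?u" by simp
  then have "(norm (shear s t ?v))\<^sup>2 \<le> (L * norm (shear s t ?u))\<^sup>2"
    by (simp only: power_mult_distrib norm_shear) (simp add: power2_eq_square)
  then show "norm (shear s t ?v) \<le> L * norm (shear s t ?u)"
    by (rule power2_le_imp_le) (use L in simp)
qed

text \<open>The similarity with matrix rows \<open>(p, - q)\<close> and \<open>(q, p)\<close>,
  conjugated by the shear. In the norm of the shear it stretches every vector by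
  \<open>sqrt (p^2 + q^2)\<close>.\<close>

definition rotS :: "real \<Rightarrow> real \<Rightarrow> real \<Rightarrow> real \<Rightarrow> real \<times> real \<Rightarrow> real \<times> real" where
  "rotS p q s t z = (p * (fst z + s * snd z) - q * t * snd z - s * ((q * (fst z + s * snd z) + p * t * snd z) / t),
     (q * (fst z + s * snd z) + p * t * snd z) / t)"

lemma linear_rotS: "linear (rotS p q s t)"
  by (rule linearI) (auto simp: rotS_def algebra_simps add_divide_distrib)

lemma norm_shear_rotS:
  assumes "t \<noteq> 0" "0 \<le> rho" "rho * rho \<le> p * p + q * q"
  shows "rho * norm (shear s t z) \<le> norm (shear s t (rotS p q s t z))"
proof -
  have "bil s t (rotS p q s t z) (rotS p q s t z) = (p * p + q * q) * bil s t z z"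
  proof -
    have 1: "fst (rotS p q s t z) + s * snd (rotS p q s t z) = p * (fst z + s * snd z) - q * t * snd z"
      by (simp add: rotS_def)
    have 2: "t * snd (rotS p q s t z) = q * (fst z + s * snd z) + p * t * snd z"
      using assms(1) by (simp add: rotS_def)
    have b: "bil s t u u = (fst u + s * snd u)\<^sup>2 + (t * snd u)\<^sup>2" for u
      by (simp add: bil_def power2_eq_square algebra_simps)
    show ?thesis unfolding b 1 2 by (simp add: power2_eq_square algebra_simps)
  qed
  moreover have "bil s t z z \<ge> 0" unfolding norm_shear[symmetric] by simp
  ultimately have "(rho * norm (shear s t z))\<^sup>2 \<le> (norm (shear s t (rotS p q s t z)))\<^sup>2"
    using assms(3) unfolding power_mult_distrib norm_shear by (simp add: power2_eq_square mult_right_mono)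
  then show ?thesis by (rule power2_le_imp_le) simp
qed

text \<open>Extends values prescribed for \<open>0 \<le> k < B\<close> in such a way that each
  period adds \<open>(2, - 1)\<close>.\<close>

definition qext :: "int \<Rightarrow> (int \<Rightarrow> real \<times> real) \<Rightarrow> int \<Rightarrow> real \<times> real" where
  "qext B f k = f (k mod B) + iv (2 * (k div B), - (k div B))"

lemma qext_period: "B \<noteq> 0 \<Longrightarrow> qext B f (k + B) = qext B f k + (2, - 1)"
  by (simp add: qext_def iv_def prod_eq_iff)

lemma qext_id: "0 \<le> k \<Longrightarrow> k < B \<Longrightarrow> qext B f k = f k"
  by (simp add: qext_def iv_def prod_eq_iff)

lemma convex6I:
  assumes "\<forall>(i, j, k)\<in>{(0,1,2),(0,1,3),(0,1,4),(0,1,5),(0,2,3),(0,2,4),(0,2,5),(0,3,4),(0,3,5),(0,4,5),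
    (1,2,3),(1,2,4),(1,2,5),(1,3,4),(1,3,5),(1,4,5),(2,3,4),(2,3,5),(2,4,5),(3,4,5)}. orient (f i) (f j) (f (k::nat)) > 0"
  shows "convex6 f"
  unfolding convex6_def
proof (intro allI impI)
  fix i j k :: nat assume "i < j \<and> j < k \<and> k < 6"
  then have "i \<in> {0, 1, 2, 3}" "j \<in> {1, 2, 3, 4}" "k \<in> {2, 3, 4, 5}" "i < j" "j < k" by auto
  then have "(i, j, k) \<in> {(0,1,2),(0,1,3),(0,1,4),(0,1,5),(0,2,3),(0,2,4),(0,2,5),(0,3,4),(0,3,5),(0,4,5),
    (1,2,3),(1,2,4),(1,2,5),(1,3,4),(1,3,5),(1,4,5),(2,3,4),(2,3,5),(2,4,5),(3,4,5)}"
    by (elim insertE emptyE) simp_all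
  from bspec[OF assms this] show "orient (f i) (f j) (f k) > 0" by simp
qed

text \<open>Normalised coordinates: the translation \<open>d\<close> becomes \<open>(1, 0)\<close> and the rotation centres of the
  four remaining edges become \<open>0\<close>, \<open>(1/2, 0)\<close>, \<open>(0, 1/2)\<close> and \<open>(1/2, 1/2)\<close>.\<close>

definition stdpts :: "real \<Rightarrow> real \<Rightarrow> real \<Rightarrow> real \<Rightarrow> nat \<Rightarrow> real \<times> real" where
  "stdpts a b s t i = [(a, b), (- a, - b), (a + 1, b), (s + 1, t), (- s, 1 - t), (s, t)] ! i"

definition nrm :: "int \<times> int \<Rightarrow> int \<times> int \<Rightarrow> int \<times> int \<Rightarrow> real \<times> real \<Rightarrow> real \<times> real" where
  "nrm e1 d e z = (1/2) *\<^sub>R iv e1 + fst z *\<^sub>R iv d + snd z *\<^sub>R iv e"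

text \<open>\<open>det\<close> makes \<open>d\<close>, \<open>e\<close> a positively oriented
  lattice basis, so lattice vectors become integer vectors in the normalised plane and signed areas
  are kept. The height of the hexagon and the pairs of opposite edge inequalities limit which tiles
  can touch. Covering is checked on the region of \<open>slab\<close>, which is fundamental for the
  translations and half turns.\<close>

lemma std_hex_tiling:
  fixes d e e1 :: "int \<times> int"
  assumes det: "fst d * snd e - snd d * fst e = 1" and b: "0 < b" "b < t" "t < 1/2"
    and conv: "convex6 (stdpts a b s t)"
    and slab: "\<And>X Y. 0 \<le> Y \<Longrightarrow> Y \<le> 1/2 \<Longrightarrow> orient (s, t) (a, b) (X, Y) \<ge> 0 \<Longrightarrow> orient (a + 1, b) (s + 1, t) (X, Y) \<ge> 0 \<Longrightarrow>
      (X, Y) \<in> hexagon (stdpts a b s t) \<or> (- X, - Y) \<in> hexagon (stdpts a b s t) \<or> (1 - X, - Y) \<in> hexagon (stdpts a b s t)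
      \<or> (- X, 1 - Y) \<in> hexagon (stdpts a b s t) \<or> (1 - X, 1 - Y) \<in> hexagon (stdpts a b s t)"
  shows "hex_tiling (nrm e1 d e (a, b)) (nrm e1 d e (s, t)) d e1 (e1 + e)"
proof -
  let ?n = "nrm e1 d e"
  let ?p = "pts (?n (a, b)) (?n (s, t)) d e1 (e1 + e)"
  let ?Q = "hexagon (stdpts a b s t)"
  define d1 d2 f1 f2 where "d1 = real_of_int (fst d)" and "d2 = real_of_int (snd d)" and "f1 = real_of_int (fst e)" and "f2 = real_of_int (snd e)"
  have "real_of_int (fst d * snd e - snd d * fst e) = 1" using det by simp
  then have det': "d1 * f2 - d2 * f1 = 1" unfolding d1_def d2_def f1_def f2_def by simp
  have nrm': "?n z = (of_int (fst e1) / 2 + fst z * d1 + snd z * f1, of_int (snd e1) / 2 + fst z * d2 + snd z * f2)" for z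
    unfolding nrm_def iv_def d1_def d2_def f1_def f2_def by simp
  have orient_nrm: "orient (?n u) (?n v) (?n z) = orient u v z" for u v z
  proof -
    have "orient (?n u) (?n v) (?n z) = (d1 * f2 - d2 * f1) * orient u v z"
      unfolding nrm' orient_def by (simp add: algebra_simps)
    then show ?thesis using det' by simp
  qed
  have surj: "\<exists>z. x = ?n z" for x
  proof -
    define u v where "u = fst x - of_int (fst e1) / 2" and "v = snd x - of_int (snd e1) / 2"
    have "u = (d1 * f2 - d2 * f1) * u" "v = (d1 * f2 - d2 * f1) * v" using det' by simp_all
    then have "u = (u * f2 - v * f1) * d1 + (d1 * v - d2 * u) * f1" "v = (u * f2 - v * f1) * d2 + (d1 * v - d2 * u) * f2"
      by (simp_all add: algebra_simps)
    then have "x = ?n (u * f2 - v * f1, d1 * v - d2 * u)" unfolding nrm' u_def v_def by (simp add: prod_eq_iff)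
    then show ?thesis by blast
  qed
  have n1: "iv e1 - ?n z = ?n (- z)" "iv (e1 + d) - ?n z = ?n ((1, 0) - z)" "iv (e1 + e) - ?n z = ?n ((0, 1) - z)"
    "iv (e1 + e + d) - ?n z = ?n ((1, 1) - z)" "?n z + iv d = ?n (z + (1, 0))" for z
    unfolding iv_simps nrm' by (simp_all add: iv_def d1_def d2_def f1_def f2_def prod_eq_iff field_simps)
  have nd: "?n (a, b) + iv d = ?n (a + 1, b)" "?n (s, t) + iv d = ?n (s + 1, t)"
    "iv e1 - ?n (a, b) = ?n (- a, - b)" "iv (e1 + e) - ?n (s, t) = ?n (- s, 1 - t)"
    using n1[of "(a, b)"] n1[of "(s, t)"] by simp_all
  have p: "?p i = ?n (stdpts a b s t i)" if "i < 6" for i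
  proof -
    have "i \<in> {0, 1, 2, 3, 4, 5}" using that by auto
    then show ?thesis using n1[of "(a, b)"] n1[of "(s, t)"] unfolding pts_def stdpts_def by (elim insertE emptyE) simp_all
  qed
  have H: "?n z \<in> hexagon ?p \<longleftrightarrow> z \<in> ?Q" for z
    unfolding hexagon_def by (simp add: p orient_nrm)
  have inj: "z = z'" if "?n z = ?n z'" for z z'
  proof -
    have "(fst z - fst z') * d1 + (snd z - snd z') * f1 = 0" "(fst z - fst z') * d2 + (snd z - snd z') * f2 = 0"
      using that unfolding nrm' by (auto simp: algebra_simps)
    then have "((fst z - fst z') * d1 + (snd z - snd z') * f1) * f2 - ((fst z - fst z') * d2 + (snd z - snd z') * f2) * f1 = 0"
      "((fst z - fst z') * d2 + (snd z - snd z') * f2) * d1 - ((fst z - fst z') * d1 + (snd z - snd z') * f1) * d2 = 0" by simp_all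
    then have "(fst z - fst z') * (d1 * f2 - d2 * f1) = 0" "(snd z - snd z') * (d1 * f2 - d2 * f1) = 0" by (simp_all add: algebra_simps)
    then show ?thesis using det' by (simp add: prod_eq_iff)
  qed
  have ints: "\<exists>m n. z = (m * fst d + n * fst e, m * snd d + n * snd e)" for z :: "int \<times> int"
  proof -
    have "fst z = (fst d * snd e - snd d * fst e) * fst z" "snd z = (fst d * snd e - snd d * fst e) * snd z" using det by simp_all
    then have "z = ((fst z * snd e - snd z * fst e) * fst d + (fst d * snd z - snd d * fst z) * fst e,
      (fst z * snd e - snd z * fst e) * snd d + (fst d * snd z - snd d * fst z) * snd e)"
      by (simp add: prod_eq_iff algebra_simps)
    then show ?thesis by blast
  qed
  have Q: "0 \<le> b * X - a * Y \<and> 0 \<le> (1 + 2 * a) * Y - 2 * b * X + b \<and> 0 \<le> (s - a) * (Y - b) - (t - b) * (X - a - 1)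
     \<and> 0 \<le> (1 + 2 * s) * (1/2 - Y) - (1 - 2 * t) * (X - 1/2) \<and> 0 \<le> - 2 * s * (1/2 - Y) + (1 - 2 * t) * X
     \<and> 0 \<le> (t - b) * (X - a) - (s - a) * (Y - b)" if "(X, Y) \<in> ?Q" for X Y
    using that unfolding hexagon_def stdpts_def orient_def by (simp add: algebra_simps)
  have Qo: "orient (a, b) (- a, - b) (X, Y) = 2 * (b * X - a * Y)" "orient (- a, - b) (a + 1, b) (X, Y) = (1 + 2 * a) * Y - 2 * b * X + b"
    "orient (a + 1, b) (s + 1, t) (X, Y) = (s - a) * (Y - b) - (t - b) * (X - a - 1)"
    "orient (s + 1, t) (- s, 1 - t) (X, Y) = (1 + 2 * s) * (1/2 - Y) - (1 - 2 * t) * (X - 1/2)"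
    "orient (- s, 1 - t) (s, t) (X, Y) = - 2 * s * (1/2 - Y) + (1 - 2 * t) * X"
    "orient (s, t) (a, b) (X, Y) = (t - b) * (X - a) - (s - a) * (Y - b)" for X Y
    unfolding orient_def by (simp_all add: algebra_simps)
  \<comment> \<open>The hexagon has height \<open>1 - t + b < 1\<close>, so two of its points cannot
    differ by an integer vector with nonzero second component.\<close>
  have Yb: "- b \<le> Y \<and> Y \<le> 1 - t" if "(X, Y) \<in> ?Q" for X Y
    using Q[OF that] by (simp add: algebra_simps)
  show ?thesis
  proof
    show "convex6 ?p"
      using conv p orient_nrm unfolding convex6_def by (simp add: order.strict_trans)
  next
    fix p q z assume pq: "p \<in> hexagon ?p" "q \<in> hexagon ?p" "p - q = iv z"
    obtain X Y where P: "p = ?n (X, Y)" using surj[of p] by auto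
    obtain X' Y' where P': "q = ?n (X', Y')" using surj[of q] by auto
    have QQ: "(X, Y) \<in> ?Q" "(X', Y') \<in> ?Q" using pq H P P' by simp_all
    obtain m n where z: "z = (m * fst d + n * fst e, m * snd d + n * snd e)" using ints[of z] by blast
    have "?n (X, Y) = ?n (X' + of_int m, Y' + of_int n)"
      using pq(3) unfolding P P' nrm' z iv_def d1_def d2_def f1_def f2_def by (simp add: algebra_simps)
    then have e: "X = X' + of_int m" "Y = Y' + of_int n" using inj by auto
    have "\<bar>real_of_int n\<bar> < 1" using Yb[OF QQ(1)] Yb[OF QQ(2)] e b by linarith
    then have n: "n = 0" by linarith
    \<comment> \<open>Adding the inequalities of the parallel edges 50 and 23, one at each point,
      confines \<open>m\<close>; the values 1 and -1 turn both into equalities.\<close>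
    have "(t - b) * of_int m \<le> (t - b) * 1" "(t - b) * of_int m \<ge> (t - b) * (- 1)"
      using Q[OF QQ(1)] Q[OF QQ(2)] e n by (simp_all add: algebra_simps)
    moreover have "0 < t - b" using b by simp
    ultimately have "real_of_int m \<le> 1" "real_of_int m \<ge> - 1" by (simp_all only: mult_le_cancel_left_pos)
    then have "m = 0 \<or> m = 1 \<or> m = - 1" by linarith
    then show "z = 0 \<or> z = d \<and> orient (?n (a, b) + iv d) (?n (s, t) + iv d) p = 0 \<and> orient (?n (s, t)) (?n (a, b)) q = 0
        \<or> z = - d \<and> orient (?n (s, t)) (?n (a, b)) p = 0 \<and> orient (?n (a, b) + iv d) (?n (s, t) + iv d) q = 0"
      unfolding P P' nd orient_nrm Qo
    proof (elim disjE)
      assume "m = 0"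
      then have "z = 0" unfolding z n by (simp add: zero_prod_def)
      then show "z = 0 \<or> z = d \<and> (s - a) * (Y - b) - (t - b) * (X - a - 1) = 0 \<and> (t - b) * (X' - a) - (s - a) * (Y' - b) = 0 \<or> z = - d \<and> (t - b) * (X - a) - (s - a) * (Y - b) = 0 \<and> (s - a) * (Y' - b) - (t - b) * (X' - a - 1) = 0" by simp
    next
      assume m: "m = 1"
      have "z = d" unfolding z n m by (simp add: prod_eq_iff)
      moreover have "((s - a) * (Y - b) - (t - b) * (X - a - 1)) + ((t - b) * (X' - a) - (s - a) * (Y' - b)) = 0"
        unfolding e n m by (simp add: algebra_simps)
      moreover have "0 \<le> (s - a) * (Y - b) - (t - b) * (X - a - 1)" "0 \<le> (t - b) * (X' - a) - (s - a) * (Y' - b)" using Q[OF QQ(1)] Q[OF QQ(2)] by simp_all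
      ultimately have "z = d \<and> (s - a) * (Y - b) - (t - b) * (X - a - 1) = 0 \<and> (t - b) * (X' - a) - (s - a) * (Y' - b) = 0" using add_nonneg_eq_0_iff by blast
      then show "z = 0 \<or> z = d \<and> (s - a) * (Y - b) - (t - b) * (X - a - 1) = 0 \<and> (t - b) * (X' - a) - (s - a) * (Y' - b) = 0 \<or> z = - d \<and> (t - b) * (X - a) - (s - a) * (Y - b) = 0 \<and> (s - a) * (Y' - b) - (t - b) * (X' - a - 1) = 0"
        by blast
    next
      assume m: "m = - 1"
      have "z = - d" unfolding z n m by (simp add: prod_eq_iff)
      moreover have "((t - b) * (X - a) - (s - a) * (Y - b)) + ((s - a) * (Y' - b) - (t - b) * (X' - a - 1)) = 0"
        unfolding e n m by (simp add: algebra_simps)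
      moreover have "0 \<le> (t - b) * (X - a) - (s - a) * (Y - b)" "0 \<le> (s - a) * (Y' - b) - (t - b) * (X' - a - 1)" using Q[OF QQ(1)] Q[OF QQ(2)] by simp_all
      ultimately have "z = - d \<and> (t - b) * (X - a) - (s - a) * (Y - b) = 0 \<and> (s - a) * (Y' - b) - (t - b) * (X' - a - 1) = 0" using add_nonneg_eq_0_iff by blast
      then show "z = 0 \<or> z = d \<and> (s - a) * (Y - b) - (t - b) * (X - a - 1) = 0 \<and> (t - b) * (X' - a) - (s - a) * (Y' - b) = 0 \<or> z = - d \<and> (t - b) * (X - a) - (s - a) * (Y - b) = 0 \<and> (s - a) * (Y' - b) - (t - b) * (X' - a - 1) = 0"
        by blast
    qed
  next
    fix p q z assume pq: "p \<in> hexagon ?p" "q \<in> hexagon ?p" "p + q = iv z"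
    obtain X Y where P: "p = ?n (X, Y)" using surj[of p] by auto
    obtain X' Y' where P': "q = ?n (X', Y')" using surj[of q] by auto
    have QQ: "(X, Y) \<in> ?Q" "(X', Y') \<in> ?Q" using pq H P P' by simp_all
    obtain m n where z: "z - e1 = (m * fst d + n * fst e, m * snd d + n * snd e)" using ints[of "z - e1"] by blast
    have z': "z = e1 + (m * fst d + n * fst e, m * snd d + n * snd e)" using z by (simp add: algebra_simps)
    have "?n (X, Y) = ?n (of_int m - X', of_int n - Y')"
      using pq(3) unfolding P P' nrm' z' iv_simps iv_def d1_def d2_def f1_def f2_def by (simp add: algebra_simps)
    then have e: "X = of_int m - X'" "Y = of_int n - Y'" using inj by auto
    have "real_of_int n < 2" "real_of_int n > - 1" using Yb[OF QQ(1)] Yb[OF QQ(2)] e b by linarith+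
    then have n: "n = 0 \<or> n = 1" by linarith
    have m: "m = 0 \<or> m = 1"
    proof -
      have "real_of_int m \<ge> 0 \<and> real_of_int m \<le> 1"
        using n
      proof
        assume n: "n = 0"
        have "b * of_int m \<ge> b * 0" "b * of_int m \<le> b * 1" using Q[OF QQ(1)] Q[OF QQ(2)] e n by (simp_all add: algebra_simps)
        then show ?thesis using b(1) by (simp only: mult_le_cancel_left_pos)
      next
        assume n: "n = 1"
        have "(1 - 2 * t) * of_int m \<ge> (1 - 2 * t) * 0" "(1 - 2 * t) * of_int m \<le> (1 - 2 * t) * 1"
          using Q[OF QQ(1)] Q[OF QQ(2)] e n by (simp_all add: algebra_simps)
        moreover have "0 < 1 - 2 * t" using b by simp
        ultimately show ?thesis by (simp only: mult_le_cancel_left_pos)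
      qed
      then show ?thesis by linarith
    qed
    consider "m = 0" "n = 0" | "m = 1" "n = 0" | "m = 0" "n = 1" | "m = 1" "n = 1" using m n by blast
    then have "z = e1 \<and> orient (a, b) (- a, - b) (X, Y) = 0 \<and> orient (a, b) (- a, - b) (X', Y') = 0
      \<or> z = e1 + d \<and> orient (- a, - b) (a + 1, b) (X, Y) = 0 \<and> orient (- a, - b) (a + 1, b) (X', Y') = 0
      \<or> z = e1 + e \<and> orient (- s, 1 - t) (s, t) (X, Y) = 0 \<and> orient (- s, 1 - t) (s, t) (X', Y') = 0
      \<or> z = e1 + e + d \<and> orient (s + 1, t) (- s, 1 - t) (X, Y) = 0 \<and> orient (s + 1, t) (- s, 1 - t) (X', Y') = 0"
    proof cases
      case mn: 1
      have "z = e1" unfolding z' mn by (simp add: prod_eq_iff)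
      moreover have "(2 * (b * X - a * Y)) + (2 * (b * X' - a * Y')) = 0" unfolding e mn by (simp add: algebra_simps)
      moreover have "0 \<le> 2 * (b * X - a * Y)" "0 \<le> 2 * (b * X' - a * Y')" using Q[OF QQ(1)] Q[OF QQ(2)] by simp_all
      ultimately have "z = e1 \<and> 2 * (b * X - a * Y) = 0 \<and> 2 * (b * X' - a * Y') = 0" using add_nonneg_eq_0_iff by blast
      then show ?thesis unfolding Qo by blast
    next
      case mn: 2
      have "z = e1 + d" unfolding z' mn by (simp add: prod_eq_iff)
      moreover have "((1 + 2 * a) * Y - 2 * b * X + b) + ((1 + 2 * a) * Y' - 2 * b * X' + b) = 0" unfolding e mn by (simp add: algebra_simps)
      moreover have "0 \<le> (1 + 2 * a) * Y - 2 * b * X + b" "0 \<le> (1 + 2 * a) * Y' - 2 * b * X' + b" using Q[OF QQ(1)] Q[OF QQ(2)] by simp_all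
      ultimately have "z = e1 + d \<and> (1 + 2 * a) * Y - 2 * b * X + b = 0 \<and> (1 + 2 * a) * Y' - 2 * b * X' + b = 0" using add_nonneg_eq_0_iff by blast
      then show ?thesis unfolding Qo by blast
    next
      case mn: 3
      have "z = e1 + e" unfolding z' mn by (simp add: prod_eq_iff)
      moreover have "(- 2 * s * (1/2 - Y) + (1 - 2 * t) * X) + (- 2 * s * (1/2 - Y') + (1 - 2 * t) * X') = 0" unfolding e mn by (simp add: algebra_simps)
      moreover have "0 \<le> - 2 * s * (1/2 - Y) + (1 - 2 * t) * X" "0 \<le> - 2 * s * (1/2 - Y') + (1 - 2 * t) * X'" using Q[OF QQ(1)] Q[OF QQ(2)] by simp_all
      ultimately have "z = e1 + e \<and> - 2 * s * (1/2 - Y) + (1 - 2 * t) * X = 0 \<and> - 2 * s * (1/2 - Y') + (1 - 2 * t) * X' = 0" using add_nonneg_eq_0_iff by blast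
      then show ?thesis unfolding Qo by blast
    next
      case mn: 4
      have "z = e1 + e + d" unfolding z' mn by (simp add: prod_eq_iff)
      moreover have "((1 + 2 * s) * (1/2 - Y) - (1 - 2 * t) * (X - 1/2)) + ((1 + 2 * s) * (1/2 - Y') - (1 - 2 * t) * (X' - 1/2)) = 0" unfolding e mn by (simp add: algebra_simps)
      moreover have "0 \<le> (1 + 2 * s) * (1/2 - Y) - (1 - 2 * t) * (X - 1/2)" "0 \<le> (1 + 2 * s) * (1/2 - Y') - (1 - 2 * t) * (X' - 1/2)" using Q[OF QQ(1)] Q[OF QQ(2)] by simp_all
      ultimately have "z = e1 + e + d \<and> (1 + 2 * s) * (1/2 - Y) - (1 - 2 * t) * (X - 1/2) = 0 \<and> (1 + 2 * s) * (1/2 - Y') - (1 - 2 * t) * (X' - 1/2) = 0" using add_nonneg_eq_0_iff by blast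
      then show ?thesis unfolding Qo by blast
    qed
    then show "z = e1 \<and> orient (?n (a, b)) (iv e1 - ?n (a, b)) p = 0 \<and> orient (?n (a, b)) (iv e1 - ?n (a, b)) q = 0
      \<or> z = e1 + d \<and> orient (iv e1 - ?n (a, b)) (?n (a, b) + iv d) p = 0 \<and> orient (iv e1 - ?n (a, b)) (?n (a, b) + iv d) q = 0
      \<or> z = e1 + e \<and> orient (iv (e1 + e) - ?n (s, t)) (?n (s, t)) p = 0 \<and> orient (iv (e1 + e) - ?n (s, t)) (?n (s, t)) q = 0
      \<or> z = e1 + e + d \<and> orient (?n (s, t) + iv d) (iv (e1 + e) - ?n (s, t)) p = 0 \<and> orient (?n (s, t) + iv d) (iv (e1 + e) - ?n (s, t)) q = 0"
      unfolding P P' nd orient_nrm .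
  next
    fix x
    obtain X Y where x: "x = ?n (X, Y)" using surj[of x] by auto
    \<comment> \<open>A vertical shift, after a half turn if necessary, brings the second coordinate
      between 0 and \<open>1/2\<close>. The horizontal shift by \<open>\<lfloor>g\<rfloor>\<close>
      below then moves the point between the lines of the edges 50 and 23, whose horizontal distance
      is 1.\<close>
    obtain \<sigma> j where j: "\<sigma> = 1 \<or> \<sigma> = - 1" "0 \<le> \<sigma> * Y - of_int j" "\<sigma> * Y - of_int j \<le> 1/2"
    proof (cases "frac Y \<le> 1/2")
      case True
      then show ?thesis using that[of 1 "\<lfloor>Y\<rfloor>"] by (simp add: frac_def)
    next
      case False
      then show ?thesis using that[of "- 1" "- \<lfloor>Y\<rfloor> - 1"] frac_lt_1[of Y] by (simp add: frac_def)
    qed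
    define V where "V = \<sigma> * Y - of_int j"
    define g where "g = \<sigma> * X - a - (s - a) * (V - b) / (t - b)"
    define U where "U = \<sigma> * X - of_int \<lfloor>g\<rfloor>"
    have tb: "t - b > 0" using b by simp
    have "U - a - (s - a) * (V - b) / (t - b) = frac g" unfolding U_def g_def frac_def by simp
    then have fr: "(t - b) * (U - a - (s - a) * (V - b) / (t - b)) = (t - b) * frac g" by simp
    have "(t - b) * ((s - a) * (V - b) / (t - b)) = (s - a) * (V - b)"
      using tb by (metis less_irrefl nonzero_mult_div_cancel_left times_divide_eq_right)
    note fr[unfolded right_diff_distrib[of "t - b" "U - a"] this]
    moreover have "0 \<le> (t - b) * frac g" "(t - b) * frac g \<le> (t - b) * 1" using tb less_imp_le[OF frac_lt_1[of g]] by (auto intro!: mult_left_mono)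
    ultimately have "orient (s, t) (a, b) (U, V) \<ge> 0" "orient (a + 1, b) (s + 1, t) (U, V) \<ge> 0"
      unfolding Qo by (simp_all add: algebra_simps)
    from slab[OF j(2,3)[folded V_def] this]
    have Hn: "?n (U, V) \<in> hexagon ?p \<or> (\<exists>r. iv r - ?n (U, V) \<in> hexagon ?p)"
    proof (elim disjE)
      assume "(U, V) \<in> ?Q" then show ?thesis using H by simp
    next
      assume "(- U, - V) \<in> ?Q"
      then have "iv e1 - ?n (U, V) \<in> hexagon ?p" using H n1(1)[of "(U, V)"] by simp
      then show ?thesis by blast
    next
      assume "(1 - U, - V) \<in> ?Q"
      then have "iv (e1 + d) - ?n (U, V) \<in> hexagon ?p" using H n1(2)[of "(U, V)"] by simp
      then show ?thesis by blast
    next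
      assume "(- U, 1 - V) \<in> ?Q"
      then have "iv (e1 + e) - ?n (U, V) \<in> hexagon ?p" using H n1(3)[of "(U, V)"] by simp
      then show ?thesis by blast
    next
      assume "(1 - U, 1 - V) \<in> ?Q"
      then have "iv (e1 + e + d) - ?n (U, V) \<in> hexagon ?p" using H n1(4)[of "(U, V)"] by simp
      then show ?thesis by blast
    qed
    define w where "w = (\<lfloor>g\<rfloor> * fst d + j * fst e, \<lfloor>g\<rfloor> * snd d + j * snd e)"
    have "?n (U, V) = x - iv w \<or> ?n (U, V) = iv (e1 - w) - x"
      using j(1)
    proof
      assume "\<sigma> = 1"
      then have "?n (U, V) = x - iv w" unfolding x U_def V_def w_def nrm' iv_def d1_def d2_def f1_def f2_def by (simp add: algebra_simps)
      then show ?thesis ..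
    next
      assume "\<sigma> = - 1"
      then have "?n (U, V) = iv (e1 - w) - x" unfolding x U_def V_def w_def nrm' iv_def d1_def d2_def f1_def f2_def by (simp add: algebra_simps)
      then show ?thesis ..
    qed
    then show "\<exists>v. x - iv v \<in> hexagon ?p \<or> iv v - x \<in> hexagon ?p"
    proof
      assume *: "?n (U, V) = x - iv w"
      have "iv r - ?n (U, V) = iv (r + w) - x" for r unfolding * iv_simps by simp
      then show ?thesis using Hn * by metis
    next
      assume *: "?n (U, V) = iv (e1 - w) - x"
      have "iv r - ?n (U, V) = x - iv (e1 - w - r)" for r unfolding * iv_simps by simp
      then show ?thesis using Hn * by metis
    qed
  qed
qed

section \<open>The tiles for B = 2 and B = 3\<close>

lemma two_tiling: "hex_tiling (1/5, -7/20) (-1/20, -7/20) (-1, 1) (0, 0) (-1, 0)"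
proof -
  have "hex_tiling (nrm (0, 0) (-1, 1) (-1, 0) (-7/20, 3/20)) (nrm (0, 0) (-1, 1) (-1, 0) (-7/20, 2/5)) (-1, 1) (0, 0) ((0, 0) + (-1, 0))"
  proof (rule std_hex_tiling)
    show "convex6 (stdpts (-7/20) (3/20) (-7/20) (2/5))" by (rule convex6I) (simp add: stdpts_def orient_def)
  next
    fix X Y :: real
    assume h: "0 \<le> Y" "Y \<le> 1/2" "orient (-7/20, 2/5) (-7/20, 3/20) (X, Y) \<ge> 0" "orient (-7/20 + 1, 3/20) (-7/20 + 1, 2/5) (X, Y) \<ge> 0"
    have mem: "(x, y) \<in> hexagon (stdpts (-7/20) (3/20) (-7/20) (2/5)) \<longleftrightarrow> 0 \<le> 3 * x + 7 * y + 0 \<and> 0 \<le> - 2 * x + 2 * y + 1 \<and> 0 \<le> - 20 * x + 0 * y + 13 \<and> 0 \<le> - 4 * x - 6 * y + 5 \<and> 0 \<le> 4 * x - 14 * y + 7 \<and> 0 \<le> 20 * x + 0 * y + 7" for x y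
      unfolding hexagon_def by (simp add: stdpts_def orient_def) argo
    have h': "0 \<le> 20 * X + 0 * Y + 7" "0 \<le> - 20 * X + 0 * Y + 13" using h(3,4) by (simp_all add: orient_def)
    show "(X, Y) \<in> hexagon (stdpts (-7/20) (3/20) (-7/20) (2/5)) \<or> (- X, - Y) \<in> hexagon (stdpts (-7/20) (3/20) (-7/20) (2/5)) \<or> (1 - X, - Y) \<in> hexagon (stdpts (-7/20) (3/20) (-7/20) (2/5)) \<or> (- X, 1 - Y) \<in> hexagon (stdpts (-7/20) (3/20) (-7/20) (2/5)) \<or> (1 - X, 1 - Y) \<in> hexagon (stdpts (-7/20) (3/20) (-7/20) (2/5))"
      unfolding mem using h(1,2) h' by argo
  qed simp_all
  then show ?thesis by (simp add: nrm_def iv_def)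
qed

text \<open>Rational arithmetic on the four triangles of both tiles shows contraction by
  \<open>19/20\<close>, and deviation at most \<open>4/5\<close> from one common similarity whose
  ratio is at least \<open>21/25\<close>. The second fact gives injectivity.\<close>

lemma disk_like_two: "disk_like (tile (- 2) 2)"
proof -
  define \<alpha> \<beta> \<tau> where "\<alpha> = qext 2 (\<lambda>k. [(-17/25, 7/50), (11/25, -47/100)] ! nat k)"
    and "\<beta> = qext 2 (\<lambda>k. [(-19/20, 7/20), (1/5, -7/20)] ! nat k)"
    and "\<tau> = (\<lambda>k. [TF, TB] ! nat (k mod 2))"
  define S where "S = shear (4/5) (9/10)"
  define f where "f = pts (1/5, -7/20) (-1/20, -7/20) (-1, 1) (0, 0) (-1, 0)"
  define g where "g = vls 2 \<alpha> \<beta> (-1, 1) (0, 0) (-1, 0)"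
  have f: "f = (!) [(1/5, -7/20), (-1/5, 7/20), (-4/5, 13/20), (-21/20, 13/20), (-19/20, 7/20), (-1/20, -7/20)]"
    unfolding f_def by (rule ext) (simp add: pts_def iv_def)
  have g0: "g (0, 0) = (!) [(-17/25, 7/50), (-11/25, 47/100), (-14/25, 53/100), (-4/5, 13/20), (-21/20, 13/20), (-19/20, 7/20)]"
    unfolding g_def by (rule ext) (simp add: vls_def av_def \<alpha>_def \<beta>_def qext_def iv_def)
  have g1: "g (1, 0) = (!) [(11/25, -47/100), (17/25, -7/50), (8/25, 7/50), (1/20, 7/20), (-1/5, 7/20), (1/5, -7/20)]"
    unfolding g_def by (rule ext) (simp add: vls_def av_def \<alpha>_def \<beta>_def qext_def iv_def)
  have cases: "k = 0 \<or> k = 1" if "0 \<le> k" "k < 2" for k :: int using that by auto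
  have lip: "lipT S (19/20) f (g (k, 0)) t" if "0 \<le> k" "k < 2" "t \<in> set (\<tau> k)" for k t
    using cases[OF that(1,2)] that(3) unfolding S_def
    by (elim disjE) (auto simp: \<tau>_def T_defs f g0 g1 gram_ok_def bil_def intro!: lipT_gram)
  have lipJ: "lipT S (4/5) f (\<lambda>i. g (k, 0) i - rotS (12/25) (-7/10) (4/5) (9/10) (f i)) t" if "0 \<le> k" "k < 2" "t \<in> set (\<tau> k)" for k t
    using cases[OF that(1,2)] that(3) unfolding S_def
    by (elim disjE) (auto simp: \<tau>_def T_defs f g0 g1 gram_ok_def bil_def rotS_def intro!: lipT_gram)
  have H: "hexagon f = {x. \<forall>(a, b)\<in>{((1/5, -7/20), (-1/5, 7/20)), ((-1/5, 7/20), (-4/5, 13/20)), ((-4/5, 13/20), (-21/20, 13/20)), ((-21/20, 13/20), (-19/20, 7/20)), ((-19/20, 7/20), (-1/20, -7/20)), ((-1/20, -7/20), (1/5, -7/20))}. orient a b x \<ge> 0}"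
    unfolding hexagon_def f by auto
  interpret hex_model "(1/5, -7/20)" "(-1/20, -7/20)" "(-1, 1)" "(0, 0)" "(-1, 0)" 2 \<alpha> \<beta> \<tau> S "19/20"
  proof (intro hex_model.intro hex_model_axioms.intro)
    show "hex_tiling (1/5, -7/20) (-1/20, -7/20) (-1, 1) (0, 0) (-1, 0)" by (rule two_tiling)
    show "linear S" "inj S" unfolding S_def by (simp_all add: linear_shear inj_shear)
    show "\<alpha> (k + 2) = \<alpha> k + (2, - 1)" "\<beta> (k + 2) = \<beta> k + (2, - 1)" "\<tau> (k + 2) = \<tau> k" for k
      unfolding \<alpha>_def \<beta>_def \<tau>_def by (simp_all add: qext_period)
    show "\<tau> k \<in> {T0, T1, TF, TA, TB}" for k
    proof -
      have "k mod 2 \<ge> 0" "k mod 2 < 2" by simp_all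
      from cases[OF this] show ?thesis unfolding \<tau>_def by auto
    qed
    show "lipT S (19/20) (pts (1/5, -7/20) (-1/20, -7/20) (-1, 1) (0, 0) (-1, 0)) (vls 2 \<alpha> \<beta> (-1, 1) (0, 0) (-1, 0) (k, 0)) t"
      if "0 \<le> k" "k < 2" "t \<in> set (\<tau> k)" for k t using lip[OF that] unfolding f_def g_def .
    show "vls 2 \<alpha> \<beta> (-1, 1) (0, 0) (-1, 0) (k, 0) i \<in> hexagon (pts (1/5, -7/20) (-1/20, -7/20) (-1, 1) (0, 0) (-1, 0))" if "0 \<le> k" "k \<le> 2 - 2" "i < 6" for k i
    proof -
      from that(2) have "k < 2" by simp
      from cases[OF that(1) this] have "\<forall>i<6. g (k, 0) i \<in> hexagon f"
        using that(2) unfolding all_less_6 H by (elim disjE) (auto simp: g0 g1 orient_def)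
      then show ?thesis using that(3) unfolding f_def g_def by blast
    qed
    show "- vls 2 \<alpha> \<beta> (-1, 1) (0, 0) (-1, 0) (2 - 1, 0) i \<in> hexagon (pts (1/5, -7/20) (-1/20, -7/20) (-1, 1) (0, 0) (-1, 0))" if "i < 6" for i
    proof -
      have "\<forall>i<6. - g (1, 0) i \<in> hexagon f" unfolding all_less_6 H by (simp add: g1 orient_def)
      then show ?thesis using that unfolding f_def g_def by simp
    qed
  qed simp_all
  have "inj psi"
  proof (rule inj_criterion[OF linear_rotS])
    show "21/25 * norm (S z) \<le> norm (S (rotS (12/25) (-7/10) (4/5) (9/10) z))" for z
      unfolding S_def by (rule norm_shear_rotS) simp_all
    show "lipT S (4/5) (pts (1/5, -7/20) (-1/20, -7/20) (-1, 1) (0, 0) (-1, 0)) (\<lambda>i. vls 2 \<alpha> \<beta> (-1, 1) (0, 0) (-1, 0) (k, 0) i - rotS (12/25) (-7/10) (4/5) (9/10) (pts (1/5, -7/20) (-1/20, -7/20) (-1, 1) (0, 0) (-1, 0) i)) t"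
      if "0 \<le> k" "k < 2" "t \<in> set (\<tau> k)" for k t using lipJ[OF that] unfolding f_def g_def .
  qed simp_all
  then show ?thesis by (rule disk_like_if_inj)
qed

lemma three_tiling: "hex_tiling (-9/10, 1/10) (-6/5, 2/5) (1, 0) (-1, 0) (-2, 1)"
proof -
  have "hex_tiling (nrm (-1, 0) (1, 0) (-1, 1) (-3/10, 1/10)) (nrm (-1, 0) (1, 0) (-1, 1) (-3/10, 2/5)) (1, 0) (-1, 0) ((-1, 0) + (-1, 1))"
  proof (rule std_hex_tiling)
    show "convex6 (stdpts (-3/10) (1/10) (-3/10) (2/5))" by (rule convex6I) (simp add: stdpts_def orient_def)
  next
    fix X Y :: real
    assume h: "0 \<le> Y" "Y \<le> 1/2" "orient (-3/10, 2/5) (-3/10, 1/10) (X, Y) \<ge> 0" "orient (-3/10 + 1, 1/10) (-3/10 + 1, 2/5) (X, Y) \<ge> 0"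
    have mem: "(x, y) \<in> hexagon (stdpts (-3/10) (1/10) (-3/10) (2/5)) \<longleftrightarrow> 0 \<le> 1 * x + 3 * y + 0 \<and> 0 \<le> - 2 * x + 4 * y + 1 \<and> 0 \<le> - 10 * x + 0 * y + 7 \<and> 0 \<le> - 2 * x - 4 * y + 3 \<and> 0 \<le> 2 * x - 6 * y + 3 \<and> 0 \<le> 10 * x + 0 * y + 3" for x y
      unfolding hexagon_def by (simp add: stdpts_def orient_def) argo
    have h': "0 \<le> 10 * X + 0 * Y + 3" "0 \<le> - 10 * X + 0 * Y + 7" using h(3,4) by (simp_all add: orient_def)
    show "(X, Y) \<in> hexagon (stdpts (-3/10) (1/10) (-3/10) (2/5)) \<or> (- X, - Y) \<in> hexagon (stdpts (-3/10) (1/10) (-3/10) (2/5)) \<or> (1 - X, - Y) \<in> hexagon (stdpts (-3/10) (1/10) (-3/10) (2/5)) \<or> (- X, 1 - Y) \<in> hexagon (stdpts (-3/10) (1/10) (-3/10) (2/5)) \<or> (1 - X, 1 - Y) \<in> hexagon (stdpts (-3/10) (1/10) (-3/10) (2/5))"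
      unfolding mem using h(1,2) h' by argo
  qed simp_all
  then show ?thesis by (simp add: nrm_def iv_def)
qed

text \<open>Three tiles, with contraction by \<open>24/25\<close> and deviation
  \<open>83/100\<close> from a similarity of ratio at least \<open>43/50\<close>.\<close>

lemma disk_like_three: "disk_like (tile (- 2) 3)"
proof -
  define \<alpha> \<beta> \<tau> where "\<alpha> = qext 3 (\<lambda>k. [(-24/25, 13/25), (-3/5, 2/5), (1/50, 1/50)] ! nat k)"
    and "\<beta> = qext 3 (\<lambda>k. [(-4/5, 3/5), (-11/25, 12/25), (1/10, 1/10)] ! nat k)"
    and "\<tau> = (\<lambda>k. [TA, TB, T1] ! nat (k mod 3))"
  define S where "S = shear (11/10) (6/5)"
  define f where "f = pts (-9/10, 1/10) (-6/5, 2/5) (1, 0) (-1, 0) (-2, 1)"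
  define g where "g = vls 3 \<alpha> \<beta> (1, 0) (-1, 0) (-2, 1)"
  have f: "f = (!) [(-9/10, 1/10), (-1/10, -1/10), (1/10, 1/10), (-1/5, 2/5), (-4/5, 3/5), (-6/5, 2/5)]"
    unfolding f_def by (rule ext) (simp add: pts_def iv_def)
  have g0: "g (0, 0) = (!) [(-24/25, 13/25), (-26/25, 12/25), (-3/5, 2/5), (-11/25, 12/25), (-14/25, 13/25), (-4/5, 3/5)]"
    unfolding g_def by (rule ext) (simp add: vls_def av_def \<alpha>_def \<beta>_def qext_def iv_def)
  have g1: "g (1, 0) = (!) [(-3/5, 2/5), (-1/50, -1/50), (1/50, 1/50), (1/10, 1/10), (-1/5, 2/5), (-11/25, 12/25)]"
    unfolding g_def by (rule ext) (simp add: vls_def av_def \<alpha>_def \<beta>_def qext_def iv_def)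
  have g2: "g (2, 0) = (!) [(1/50, 1/50), (3/5, -2/5), (26/25, -12/25), (6/5, -2/5), (9/10, -1/10), (1/10, 1/10)]"
    unfolding g_def by (rule ext) (simp add: vls_def av_def \<alpha>_def \<beta>_def qext_def iv_def)
  have cases: "k = 0 \<or> k = 1 \<or> k = 2" if "0 \<le> k" "k < 3" for k :: int using that by auto
  have lip: "lipT S (24/25) f (g (k, 0)) t" if "0 \<le> k" "k < 3" "t \<in> set (\<tau> k)" for k t
    using cases[OF that(1,2)] that(3) unfolding S_def
    by (elim disjE) (auto simp: \<tau>_def T_defs f g0 g1 g2 gram_ok_def bil_def intro!: lipT_gram)
  have lipJ: "lipT S (83/100) f (\<lambda>i. g (k, 0) i - rotS (8/25) (-4/5) (11/10) (6/5) (f i)) t" if "0 \<le> k" "k < 3" "t \<in> set (\<tau> k)" for k t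
    using cases[OF that(1,2)] that(3) unfolding S_def
    by (elim disjE) (auto simp: \<tau>_def T_defs f g0 g1 g2 gram_ok_def bil_def rotS_def intro!: lipT_gram)
  have H: "hexagon f = {x. \<forall>(a, b)\<in>{((-9/10, 1/10), (-1/10, -1/10)), ((-1/10, -1/10), (1/10, 1/10)), ((1/10, 1/10), (-1/5, 2/5)), ((-1/5, 2/5), (-4/5, 3/5)), ((-4/5, 3/5), (-6/5, 2/5)), ((-6/5, 2/5), (-9/10, 1/10))}. orient a b x \<ge> 0}"
    unfolding hexagon_def f by auto
  interpret hex_model "(-9/10, 1/10)" "(-6/5, 2/5)" "(1, 0)" "(-1, 0)" "(-2, 1)" 3 \<alpha> \<beta> \<tau> S "24/25"
  proof (intro hex_model.intro hex_model_axioms.intro)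
    show "hex_tiling (-9/10, 1/10) (-6/5, 2/5) (1, 0) (-1, 0) (-2, 1)" by (rule three_tiling)
    show "linear S" "inj S" unfolding S_def by (simp_all add: linear_shear inj_shear)
    show "\<alpha> (k + 3) = \<alpha> k + (2, - 1)" "\<beta> (k + 3) = \<beta> k + (2, - 1)" "\<tau> (k + 3) = \<tau> k" for k
      unfolding \<alpha>_def \<beta>_def \<tau>_def by (simp_all add: qext_period)
    show "\<tau> k \<in> {T0, T1, TF, TA, TB}" for k
    proof -
      have "k mod 3 \<ge> 0" "k mod 3 < 3" by simp_all
      from cases[OF this] show ?thesis unfolding \<tau>_def by auto
    qed
    show "lipT S (24/25) (pts (-9/10, 1/10) (-6/5, 2/5) (1, 0) (-1, 0) (-2, 1)) (vls 3 \<alpha> \<beta> (1, 0) (-1, 0) (-2, 1) (k, 0)) t"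
      if "0 \<le> k" "k < 3" "t \<in> set (\<tau> k)" for k t using lip[OF that] unfolding f_def g_def .
    show "vls 3 \<alpha> \<beta> (1, 0) (-1, 0) (-2, 1) (k, 0) i \<in> hexagon (pts (-9/10, 1/10) (-6/5, 2/5) (1, 0) (-1, 0) (-2, 1))" if "0 \<le> k" "k \<le> 3 - 2" "i < 6" for k i
    proof -
      from that(2) have "k < 3" by simp
      from cases[OF that(1) this] have "\<forall>i<6. g (k, 0) i \<in> hexagon f"
        using that(2) unfolding all_less_6 H by (elim disjE) (auto simp: g0 g1 g2 orient_def)
      then show ?thesis using that(3) unfolding f_def g_def by blast
    qed
    show "- vls 3 \<alpha> \<beta> (1, 0) (-1, 0) (-2, 1) (3 - 1, 0) i \<in> hexagon (pts (-9/10, 1/10) (-6/5, 2/5) (1, 0) (-1, 0) (-2, 1))" if "i < 6" for i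
    proof -
      have "\<forall>i<6. - g (2, 0) i \<in> hexagon f" unfolding all_less_6 H by (simp add: g2 orient_def)
      then show ?thesis using that unfolding f_def g_def by simp
    qed
  qed simp_all
  have "inj psi"
  proof (rule inj_criterion[OF linear_rotS])
    show "43/50 * norm (S z) \<le> norm (S (rotS (8/25) (-4/5) (11/10) (6/5) z))" for z
      unfolding S_def by (rule norm_shear_rotS) simp_all
    show "lipT S (83/100) (pts (-9/10, 1/10) (-6/5, 2/5) (1, 0) (-1, 0) (-2, 1)) (\<lambda>i. vls 3 \<alpha> \<beta> (1, 0) (-1, 0) (-2, 1) (k, 0) i - rotS (8/25) (-4/5) (11/10) (6/5) (pts (-9/10, 1/10) (-6/5, 2/5) (1, 0) (-1, 0) (-2, 1) i)) t"
      if "0 \<le> k" "k < 3" "t \<in> set (\<tau> k)" for k t using lipJ[OF that] unfolding f_def g_def .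
  qed simp_all
  then show ?thesis by (rule disk_like_if_inj)
qed

section \<open>Injectivity of the model map for strips\<close>

lemma iv_00 [simp]: "iv (0, 0) = 0"
  by (simp add: iv_def zero_prod_def)

lemma orient_neg: "orient (- a) (- b) (- p) = orient a b p"
  by (simp add: orient_def algebra_simps)

lemma peel_neg: "peel ts f \<Longrightarrow> peel ts (\<lambda>i. - f i)"
  by (induction ts f rule: peel.induct) (auto simp: orient_neg)

lemma polyline_connected:
  fixes x :: "nat \<Rightarrow> 'a::real_normed_vector"
  shows "connected (\<Union>i\<in>{..n}. closed_segment (x i) (x (Suc i)))"
proof (induction n)
  case 0
  then show ?case by simp
next
  case (Suc n)
  have eq: "(\<Union>i\<in>{..Suc n}. closed_segment (x i) (x (Suc i)))
     = closed_segment (x (Suc n)) (x (Suc (Suc n))) \<union> (\<Union>i\<in>{..n}. closed_segment (x i) (x (Suc i)))"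
    by (simp add: atMost_Suc)
  have "x (Suc n) \<in> closed_segment (x (Suc n)) (x (Suc (Suc n)))" "x (Suc n) \<in> (\<Union>i\<in>{..n}. closed_segment (x i) (x (Suc i)))"
    by auto
  then show ?case unfolding eq by (intro connected_Un Suc) auto
qed

lemma convex_comb_in_segment: "0 \<le> s \<Longrightarrow> s \<le> 1 \<Longrightarrow> (1 - s) *\<^sub>R u + s *\<^sub>R v \<in> closed_segment u v"
  unfolding in_segment by blast

text \<open>An intermediate value argument: the image of the connected set \<open>C\<close> stays on
  the line through \<open>A\<close> and \<open>A'\<close> and contains both ends.\<close>

lemma edge_reached:
  fixes f :: "real \<times> real \<Rightarrow> real \<times> real"
  assumes f: "continuous_on C f" and C: "connected C" "a \<in> C" "b \<in> C" and AB: "f a = A" "f b = A'" "A \<noteq> A'"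
    and line: "\<And>x. x \<in> C \<Longrightarrow> orient A A' (f x) = 0"
    and p: "p = (1 - s) *\<^sub>R A + s *\<^sub>R A'" "0 \<le> s" "s \<le> 1"
  shows "\<exists>x\<in>C. f x = p"
proof -
  define u1 u2 where "u1 = fst A' - fst A" and "u2 = snd A' - snd A"
  define N where "N = u1 * u1 + u2 * u2"
  have "u1 \<noteq> 0 \<or> u2 \<noteq> 0" using AB(3) unfolding u1_def u2_def by (auto simp: prod_eq_iff)
  then have N: "N > 0" unfolding N_def by (metis sum_squares_gt_zero_iff)
  define \<phi> where "\<phi> = (\<lambda>v. (fst v - fst A) * u1 + (snd v - snd A) * u2)"
  have "connected ((\<lambda>x. \<phi> (f x)) ` C)"
    unfolding \<phi>_def by (intro connected_continuous_image C continuous_intros f)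
  moreover have "0 \<in> (\<lambda>x. \<phi> (f x)) ` C" using C(2) AB(1) by (force simp: \<phi>_def)
  moreover have "N \<in> (\<lambda>x. \<phi> (f x)) ` C" using C(3) AB(2) by (force simp: \<phi>_def N_def u1_def u2_def)
  ultimately have "{0..N} \<subseteq> (\<lambda>x. \<phi> (f x)) ` C" using connected_contains_Icc by blast
  moreover have "s * N \<in> {0..N}" using p(2,3) N by (simp add: mult_left_le_one_le)
  ultimately obtain x where x: "x \<in> C" "\<phi> (f x) = s * N" by auto
  define w1 w2 where "w1 = fst (f x) - fst A" and "w2 = snd (f x) - snd A"
  have 1: "u1 * w2 - u2 * w1 = 0" using line[OF x(1)] unfolding orient_def u1_def u2_def w1_def w2_def by simp
  have 2: "w1 * u1 + w2 * u2 = s * N" using x(2) unfolding \<phi>_def w1_def w2_def .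
  have "N * w1 = u1 * (w1 * u1 + w2 * u2) - u2 * (u1 * w2 - u2 * w1)" unfolding N_def by (simp add: algebra_simps)
  then have "w1 = s * u1" using N unfolding 1 2 by simp
  moreover have "N * w2 = u2 * (w1 * u1 + w2 * u2) + u1 * (u1 * w2 - u2 * w1)" unfolding N_def by (simp add: algebra_simps)
  then have "w2 = s * u2" using N unfolding 1 2 by simp
  ultimately have "f x = p" unfolding p(1) w1_def w2_def u1_def u2_def by (simp add: prod_eq_iff algebra_simps)
  then show ?thesis using x(1) by blast
qed

context hex_model
begin

lemma vertex_weight:
  assumes "i < 6"
  shows "adm (\<tau> k) (\<lambda>l. if l = i then 1 else 0)" "comb (\<lambda>l. if l = i then 1 else 0) f = f i"
proof -
  have w: "wts (\<lambda>l. if l = i then 1 else 0)" unfolding wts_def using assms by simp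
  have "\<forall>ts\<in>{T0, T1, TF, TA, TB}. \<forall>i<6. \<exists>(p, q, r)\<in>set ts. i \<in> {p, q, r}"
    unfolding all_less_6 by (simp add: T_defs)
  then obtain p q r where "(p, q, r) \<in> set (\<tau> k)" "i \<in> {p, q, r}" using tau[of k] assms by blast
  then show "adm (\<tau> k) (\<lambda>l. if l = i then 1 else 0)" using w unfolding adm_def sup_on_def by force
  show "comb (\<lambda>l. if l = i then 1 else 0) f = f i"
    unfolding comb_def using assms by (simp add: if_distrib[of "\<lambda>c. c *\<^sub>R _"] cong: if_cong)
qed

lemma psi_vertex: "i < 6 \<Longrightarrow> psi (pt i + iv v) = vl v i"
  using psi_tile[OF vertex_weight(1), of i v] by (simp only: vertex_weight(2))

lemma segment_H:
  assumes "u \<in> H" "v \<in> H"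
  shows "closed_segment u v \<subseteq> H"
  using closed_segment_subset[OF assms convex_hexagon] .

lemma segment_row_shift:
  assumes "u - iv (k, 0) \<in> H" "v - iv (k, 0) \<in> H" "0 \<le> k" "k \<le> B - 2"
  shows "closed_segment u v \<subseteq> row"
proof
  fix x assume "x \<in> closed_segment u v"
  then obtain s where s: "x = (1 - s) *\<^sub>R u + s *\<^sub>R v" "0 \<le> s" "s \<le> 1" by (auto simp: in_segment)
  have "x - iv (k, 0) = (1 - s) *\<^sub>R (u - iv (k, 0)) + s *\<^sub>R (v - iv (k, 0))" unfolding s(1) by (simp add: algebra_simps)
  also have "\<dots> \<in> H" using segment_H[OF assms(1,2)] convex_comb_in_segment[OF s(2,3)] by blast
  finally have "x - iv (k, 0) \<in> H" .
  from row_tile[OF this assms(3,4)] show "x \<in> row" by simp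
qed

lemma segment_row_shift':
  assumes "p \<in> H" "q \<in> H" "u = p + iv (k, 0)" "v = q + iv (k, 0)" "0 \<le> k" "k \<le> B - 2"
  shows "closed_segment u v \<subseteq> row"
  using segment_row_shift[of u k v] assms by simp

lemma segment_row_neg:
  assumes "- u \<in> H" "- v \<in> H"
  shows "closed_segment u v \<subseteq> row"
proof
  fix x assume "x \<in> closed_segment u v"
  then obtain s where s: "x = (1 - s) *\<^sub>R u + s *\<^sub>R v" "0 \<le> s" "s \<le> 1" by (auto simp: in_segment)
  have "- x = (1 - s) *\<^sub>R (- u) + s *\<^sub>R (- v)" unfolding s(1) by (simp add: algebra_simps)
  also have "\<dots> \<in> H" using segment_H[OF assms(1,2)] convex_comb_in_segment[OF s(2,3)] by blast
  finally have "- x \<in> H" .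
  from row_neg[OF this] show "x \<in> row" by simp
qed

lemma edge_point:
  assumes "p \<in> H" "hedge i j" "orient (pt i) (pt j) p = 0"
  obtains s where "p = (1 - s) *\<^sub>R pt i + s *\<^sub>R pt j" "0 \<le> s" "s \<le> 1"
proof -
  obtain c where c: "adm T0 c" "p = comb c pt" using hexagon_cover[OF conv assms(1), of T0] by auto
  have w: "wts c" using c(1) unfolding adm_def by simp
  note l = hedge_less[OF assms(2)]
  note E = edge_comb[OF w _ _ _ edge_sup[OF w assms(2) assms(3)[unfolded c(2)]]]
  have "c i + c j = 1" "comb c pt = c i *\<^sub>R pt i + c j *\<^sub>R pt j" using E l by auto
  moreover have "c i \<ge> 0" "c j \<ge> 0" using w l unfolding wts_def by auto
  moreover have "c i = 1 - c j" using calculation(1) by simp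
  ultimately show ?thesis using that[of "c j"] c(2) by simp
qed

text \<open>The path runs in the row and is reversed by a half turn of the group. At each of its
  points \<open>y\<close>, both \<open>psi y\<close> and the image of the rotated point lie in
  \<open>H\<close> and have a lattice vector as sum, which forces \<open>psi y\<close> onto the line
  of one edge. As the ends of the path go to the ends of that edge, every point of the edge is the
  image of some \<open>y\<close> whose rotated partner is also in the row.\<close>

lemma boundary_reflect:
  assumes seg: "\<And>i. i \<le> n \<Longrightarrow> closed_segment (x i) (x (Suc i)) \<subseteq> row"
    and sym: "\<And>i. i \<le> Suc n \<Longrightarrow> x (Suc n - i) = iv (bd + (j * B, m)) - x i"
    and e: "hedge i' j'" "psi (x 0) = pt i'" "psi (x (Suc n)) = pt j'"
    and edge: "\<And>p q. p \<in> H \<Longrightarrow> q \<in> H \<Longrightarrow> p + q = iv (2 * j + m, - j) \<Longrightarrow> orient (pt i') (pt j') p = 0"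
    and p: "p \<in> H" "orient (pt i') (pt j') p = 0"
  shows "\<exists>y\<in>row. iv (bd + (j * B, m)) - y \<in> row \<and> psi y = p"
proof -
  define C where "C = (\<Union>i\<in>{..n}. closed_segment (x i) (x (Suc i)))"
  have C: "y \<in> row \<and> iv (bd + (j * B, m)) - y \<in> row" if yC: "y \<in> C" for y
  proof -
    obtain i s where i: "i \<le> n" "y = (1 - s) *\<^sub>R x i + s *\<^sub>R x (Suc i)" "0 \<le> s" "s \<le> 1"
      using yC unfolding C_def by (auto simp: in_segment)
    have "iv (bd + (j * B, m)) - y = (1 - s) *\<^sub>R x (Suc n - i) + s *\<^sub>R x (Suc n - Suc i)"
    proof -
      have "x (Suc n - i) = iv (bd + (j * B, m)) - x i" "x (Suc n - Suc i) = iv (bd + (j * B, m)) - x (Suc i)"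
        using sym[of i] sym[of "Suc i"] i(1) by (simp_all del: diff_Suc_Suc)
      moreover have "X - ((1 - s) *\<^sub>R u + s *\<^sub>R v) = (1 - s) *\<^sub>R (X - u) + s *\<^sub>R (X - v)" for X u v :: "real \<times> real"
        by (simp add: algebra_simps)
      ultimately show ?thesis using i(2) by metis
    qed
    also have "\<dots> = (1 - (1 - s)) *\<^sub>R x (n - i) + (1 - s) *\<^sub>R x (Suc (n - i))"
      using i(1) by (simp add: Suc_diff_le)
    also have "\<dots> \<in> closed_segment (x (n - i)) (x (Suc (n - i)))"
      using i(3,4) by (intro convex_comb_in_segment) auto
    finally have "iv (bd + (j * B, m)) - y \<in> row" using seg[of "n - i"] by auto
    moreover have "y \<in> row" using seg[OF i(1)] convex_comb_in_segment[OF i(3,4)] i(2) by auto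
    ultimately show ?thesis by blast
  qed
  have "orient (pt i') (pt j') (psi y) = 0" if "y \<in> C" for y
  proof (rule edge)
    show "psi y \<in> H" "psi (iv (bd + (j * B, m)) - y) \<in> H" using C[OF that] psi_row_subset by auto
    have eq: "iv (bd + (j * B, m)) - y = (iv bd - y) + iv (j * B, m)" unfolding iv_simps by simp
    show "psi y + psi (iv (bd + (j * B, m)) - y) = iv (2 * j + m, - j)"
      unfolding eq psi_shift psi_reflect by simp
  qed
  moreover obtain s where s: "p = (1 - s) *\<^sub>R pt i' + s *\<^sub>R pt j'" "0 \<le> s" "s \<le> 1" using edge_point[OF p(1) e(1) p(2)] by blast
  moreover have "x 0 \<in> C" "x (Suc n) \<in> C" unfolding C_def by auto
  moreover have "connected C" unfolding C_def by (rule polyline_connected)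
  ultimately obtain y where "y \<in> C" "psi y = p"
    using edge_reached[OF psi_cont, of C "x 0" "x (Suc n)" "pt i'" "pt j'" p s] e pt_distinct[OF e(1)] by blast
  then show ?thesis using C by blast
qed

text \<open>The analogue for an edge glued by a translation: the path and its shifted copy both run
  in the row.\<close>

lemma boundary_shift:
  assumes seg: "\<And>i. i \<le> n \<Longrightarrow> closed_segment (x i) (x (Suc i)) \<subseteq> row"
    and seg': "\<And>i. i \<le> n \<Longrightarrow> closed_segment (x i - iv (j * B, m)) (x (Suc i) - iv (j * B, m)) \<subseteq> row"
    and e: "hedge i' j'" "psi (x 0) = pt i'" "psi (x (Suc n)) = pt j'"
    and edge: "\<And>p q. p \<in> H \<Longrightarrow> q \<in> H \<Longrightarrow> p - q = iv (2 * j + m, - j) \<Longrightarrow> orient (pt i') (pt j') p = 0"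
    and p: "p \<in> H" "orient (pt i') (pt j') p = 0"
  shows "\<exists>y\<in>row. y - iv (j * B, m) \<in> row \<and> psi y = p"
proof -
  define C where "C = (\<Union>i\<in>{..n}. closed_segment (x i) (x (Suc i)))"
  have C: "y \<in> row \<and> y - iv (j * B, m) \<in> row" if yC: "y \<in> C" for y
  proof -
    obtain i s where i: "i \<le> n" "y = (1 - s) *\<^sub>R x i + s *\<^sub>R x (Suc i)" "0 \<le> s" "s \<le> 1"
      using yC unfolding C_def by (auto simp: in_segment)
    have "y - iv (j * B, m) = (1 - s) *\<^sub>R (x i - iv (j * B, m)) + s *\<^sub>R (x (Suc i) - iv (j * B, m))"
      unfolding i(2) by (simp add: algebra_simps)
    then have "y - iv (j * B, m) \<in> row" using seg'[OF i(1)] convex_comb_in_segment[OF i(3,4)] by auto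
    moreover have "y \<in> row" using seg[OF i(1)] convex_comb_in_segment[OF i(3,4)] i(2) by auto
    ultimately show ?thesis by blast
  qed
  have "orient (pt i') (pt j') (psi y) = 0" if "y \<in> C" for y
  proof (rule edge)
    show "psi y \<in> H" "psi (y - iv (j * B, m)) \<in> H" using C[OF that] psi_row_subset by auto
    show "psi y - psi (y - iv (j * B, m)) = iv (2 * j + m, - j)"
      using psi_shift[of "y - iv (j * B, m)" j m] by simp
  qed
  moreover obtain s where s: "p = (1 - s) *\<^sub>R pt i' + s *\<^sub>R pt j'" "0 \<le> s" "s \<le> 1" using edge_point[OF p(1) e(1) p(2)] by blast
  moreover have "x 0 \<in> C" "x (Suc n) \<in> C" unfolding C_def by auto
  moreover have "connected C" unfolding C_def by (rule polyline_connected)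
  ultimately obtain y where "y \<in> C" "psi y = p"
    using edge_reached[OF psi_cont, of C "x 0" "x (Suc n)" "pt i'" "pt j'" p s] e pt_distinct[OF e(1)] by blast
  then show ?thesis using C by blast
qed

text \<open>The row contains a representative of every tile modulo periods, vertical shifts and half
  turns.\<close>

lemma row_cover:
  obtains y j n where "y \<in> row" "x = y + iv (j * B, n)" | y j n where "y \<in> row" "x = iv bd - y + iv (j * B, n)"
proof -
  have dec: "\<exists>k j. 0 \<le> k \<and> k < B \<and> v = (k, 0) + (j * B, snd v)" for v :: "int \<times> int"
    using B2 by (intro exI[of _ "fst v mod B"] exI[of _ "fst v div B"]) (auto simp: prod_eq_iff)
  obtain v where "x - iv v \<in> H \<or> iv v - x \<in> H" using cover by blast
  then show ?thesis
  proof
    assume h: "x - iv v \<in> H"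
    obtain k j where k: "0 \<le> k" "k < B" "v = (k, 0) + (j * B, snd v)" using dec by blast
    show ?thesis
    proof (cases "k \<le> B - 2")
      case True
      show ?thesis
      proof (rule that(1)[OF row_tile[OF h k(1) True]])
        have "iv v = iv (k, 0) + iv (j * B, snd v)" using k(3) by (metis iv_simps(1))
        then show "x = x - iv v + iv (k, 0) + iv (j * B, snd v)" by simp
      qed
    next
      case False
      then have "k = B - 1" using k(2) by simp
      then have "iv v = iv bd + iv (j * B, snd v)" using k(3) by (metis iv_simps(1))
      then show ?thesis using that(2)[OF row_neg[OF h], of j "snd v"] by simp
    qed
  next
    assume h: "iv v - x \<in> H"
    obtain k j where k: "0 \<le> k" "k < B" "bd - v = (k, 0) + (j * B, snd (bd - v))" using dec by blast
    define n where "n = snd (bd - v)"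
    have "iv (bd - v) = iv (k, 0) + iv (j * B, n)" using k(3) unfolding n_def by (metis iv_simps(1))
    then have v: "iv v = iv bd - iv (k, 0) - iv (j * B, n)" unfolding iv_simps by (simp add: algebra_simps)
    have neg: "iv (- j * B, - n) = - iv (j * B, n)" by (simp add: iv_def)
    show ?thesis
    proof (cases "k \<le> B - 2")
      case True
      show ?thesis
      proof (rule that(2)[OF row_tile[OF h k(1) True], of "- j" "- n"])
        show "x = iv bd - (iv v - x + iv (k, 0)) + iv (- j * B, - n)" unfolding neg v by simp
      qed
    next
      case False
      then have "k = B - 1" using k(2) by simp
      then show ?thesis using that(1)[OF row_neg[OF h], of "- j" "- n"] v unfolding neg by simp
    qed
  qed
qed

end

text \<open>Data that make \<open>psi\<close> injective. \<open>peel\<close> keeps the images of the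
  triangles of one tile from overlapping. \<open>first\<close> and \<open>chain\<close> separate the
  image of each tile of the row from those of all later ones by the line through the image of the
  edge it shares with its successor. \<open>ends\<close> lets corners of the row go to vertices of
  the hexagon.\<close>

locale strip_model = hex_model w0 u0 "(1, 0)" "(0, 0)" "(- 2, 1)" B \<alpha> \<beta> \<tau> S lam
  for w0 u0 B \<alpha> \<beta> \<tau> S lam +
  assumes B4: "B \<ge> 4"
    and peel: "\<And>k. 0 \<le> k \<Longrightarrow> k < B \<Longrightarrow> peel (\<tau> k) (vls B \<alpha> \<beta> (1, 0) (0, 0) (- 2, 1) (k, 0))"
    and ends: "\<beta> (B - 1) = - w0" "\<beta> 0 = iv (- 2, 1) - u0"
    and first: "\<And>l. l \<in> {2, 3, 4, 5} \<Longrightarrow> orient (- \<alpha> (B - 1)) (\<alpha> 0) (- vls B \<alpha> \<beta> (1, 0) (0, 0) (- 2, 1) (B - 1, 0) l) > 0"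
      "\<And>k l. 0 \<le> k \<Longrightarrow> k \<le> B - 2 \<Longrightarrow> l < 6 \<Longrightarrow> orient (- \<alpha> (B - 1)) (\<alpha> 0) (vls B \<alpha> \<beta> (1, 0) (0, 0) (- 2, 1) (k, 0) l) \<le> 0"
    and chain: "\<And>k l. 0 \<le> k \<Longrightarrow> k < B - 2 \<Longrightarrow> l \<in> {0, 1, 4, 5} \<Longrightarrow> orient (\<alpha> (k + 1)) (\<beta> (k + 1)) (vls B \<alpha> \<beta> (1, 0) (0, 0) (- 2, 1) (k, 0) l) > 0"
      "\<And>k m l. 0 \<le> k \<Longrightarrow> k < m \<Longrightarrow> m \<le> B - 2 \<Longrightarrow> l < 6 \<Longrightarrow> orient (\<alpha> (k + 1)) (\<beta> (k + 1)) (vls B \<alpha> \<beta> (1, 0) (0, 0) (- 2, 1) (m, 0) l) \<le> 0"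
begin

text \<open>The index \<open>- 1\<close> stands for the copy \<open>- H\<close>, placed before the
  tiles \<open>0, ..., B - 2\<close>. \<open>V\<close>, \<open>R\<close> and \<open>emb\<close> give
  the vertex images, the point set and the parametrisation of a copy.\<close>

definition V :: "int \<Rightarrow> nat \<Rightarrow> real \<times> real" where
  "V j i = (if j = - 1 then - vl bd i else vl (j, 0) i)"

definition R :: "int \<Rightarrow> (real \<times> real) set" where
  "R j = (if j = - 1 then uminus ` H else (\<lambda>p. p + iv (j, 0)) ` H)"

definition emb :: "int \<Rightarrow> real \<times> real \<Rightarrow> real \<times> real" where
  "emb j p = (if j = - 1 then - p else p + iv (j, 0))"

lemma av0: "av \<alpha> (k, 0) = \<alpha> k" "av \<beta> (k, 0) = \<beta> k"
  by (simp_all add: av_def flip: zero_prod_def)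

lemma av00: "av \<alpha> 0 = \<alpha> 0" "av \<beta> 0 = \<beta> 0"
  by (simp_all add: av_def flip: zero_prod_def)

lemma R_weights:
  assumes "x \<in> R j" "- 1 \<le> j"
  obtains c where "adm (\<tau> j) c" "x = emb j (comb c pt)" "psi x = comb c (V j)"
proof (cases "j = - 1")
  case True
  have \<tau>1: "\<tau> (- 1) = \<tau> (B - 1)" using per(3)[of "- 1"] by simp
  obtain p where p: "p \<in> H" "x = - p" using assms(1) True unfolding R_def by auto
  obtain c where c: "adm (\<tau> (fst bd)) c" "p = comb c pt" using hexagon_cover[OF conv p(1) tau] by blast
  have "x = iv bd - (comb c pt + iv bd)" using p c by simp
  then have "psi x = comb c (V j)" using psi_tile_reflect[OF c(1)] unfolding V_def True by (simp add: comb_neg)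
  then show ?thesis using that[of c] c p unfolding True emb_def \<tau>1 by simp
next
  case False
  obtain p where p: "p \<in> H" "x = p + iv (j, 0)" using assms(1) False unfolding R_def by auto
  obtain c where c: "adm (\<tau> (fst (j, 0 :: int))) c" "p = comb c pt" using hexagon_cover[OF conv p(1) tau] by blast
  have "psi x = comb c (V j)" using psi_tile[OF c(1)] p c False unfolding V_def by simp
  then show ?thesis using that[of c] c p False unfolding emb_def by simp
qed

lemma peel_V: "- 1 \<le> j \<Longrightarrow> j \<le> B - 2 \<Longrightarrow> peel (\<tau> j) (V j)"
proof (cases "j = - 1")
  case True
  have "\<tau> (- 1) = \<tau> (B - 1)" using per(3)[of "- 1"] by simp
  moreover have "V j = (\<lambda>i. - vl bd i)" unfolding V_def True by auto
  ultimately show ?thesis using peel_neg[OF peel[of "B - 1"]] B4 True by simp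
next
  case False
  assume "- 1 \<le> j" "j \<le> B - 2"
  then have "peel (\<tau> j) (vl (j, 0))" using False peel[of j] by simp
  moreover have "V j = vl (j, 0)" unfolding V_def using False by auto
  ultimately show ?thesis by simp
qed

lemma V_chain:
  assumes "- 1 \<le> j" "j < m" "m \<le> B - 2"
  obtains p q where "p < 6" "q < 6" "p \<noteq> q" "\<And>l. l < 6 \<Longrightarrow> l \<noteq> p \<Longrightarrow> l \<noteq> q \<Longrightarrow> orient (V j p) (V j q) (V j l) > 0"
    "\<And>l. l < 6 \<Longrightarrow> orient (V j p) (V j q) (V m l) \<le> 0" "\<And>s t. s + t = 1 \<Longrightarrow> 0 \<le> s \<Longrightarrow> 0 \<le> t \<Longrightarrow> emb j (s *\<^sub>R pt p + t *\<^sub>R pt q) \<in> R (j + 1)"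
proof (cases "j = - 1")
  case True
  have V01: "V j 0 = - \<alpha> (B - 1)" "V j 1 = \<alpha> 0" unfolding V_def True using av0(1)[of "B - 1"] by (simp_all add: av00)
  show ?thesis
  proof (rule that[of 0 1])
    fix l :: nat assume "l < 6" "l \<noteq> 0" "l \<noteq> 1"
    then have "l \<in> {2, 3, 4, 5}" by auto
    from first(1)[OF this] show "orient (V j 0) (V j 1) (V j l) > 0" unfolding V01 by (simp add: V_def True)
  next
    fix l :: nat assume "l < 6"
    then show "orient (V j 0) (V j 1) (V m l) \<le> 0" unfolding V01 using first(2)[of m l] assms True by (simp add: V_def)
  next
    fix s t :: real assume st: "s + t = 1" "0 \<le> s" "0 \<le> t"
    have "- (s *\<^sub>R pt 0 + t *\<^sub>R pt 1) = (1 - t) *\<^sub>R pt 1 + t *\<^sub>R pt 0"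
    proof -
      have "s = 1 - t" using st(1) by simp
      moreover have "pt 1 = - pt 0" by (simp add: iv_def prod_eq_iff)
      ultimately show ?thesis by (simp only:) (simp add: algebra_simps)
    qed
    also have "\<dots> \<in> H" using segment_H[OF vertex_in_hexagon[OF conv] vertex_in_hexagon[OF conv], of 1 0] convex_comb_in_segment[of t "pt 1" "pt 0"] st by auto
    finally show "emb j (s *\<^sub>R pt 0 + t *\<^sub>R pt 1) \<in> R (j + 1)" unfolding emb_def R_def True by simp
  qed auto
next
  case False
  then have j: "0 \<le> j" "j < B - 2" using assms by auto
  have V23: "V j 2 = \<alpha> (j + 1)" "V j 3 = \<beta> (j + 1)" unfolding V_def using False av0(1)[of "j + 1"] av0(2)[of "j + 1"] by simp_all
  show ?thesis
  proof (rule that[of 2 3])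
    fix l :: nat assume "l < 6" "l \<noteq> 2" "l \<noteq> 3"
    then have "l \<in> {0, 1, 4, 5}" by auto
    from chain(1)[OF j this] show "orient (V j 2) (V j 3) (V j l) > 0" unfolding V23 by (simp add: V_def False)
  next
    fix l :: nat assume "l < 6"
    then show "orient (V j 2) (V j 3) (V m l) \<le> 0" unfolding V23 using chain(2)[of j m l] assms j by (simp add: V_def)
  next
    fix s t :: real assume st: "s + t = 1" "0 \<le> s" "0 \<le> t"
    have "s *\<^sub>R pt 2 + t *\<^sub>R pt 3 + iv (j, 0) = ((1 - t) *\<^sub>R pt 0 + t *\<^sub>R pt 5) + iv (j + 1, 0)"
    proof -
      have s: "s = 1 - t" using st(1) by simp
      show ?thesis unfolding s by (simp add: iv_def prod_eq_iff algebra_simps)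
    qed
    moreover have "(1 - t) *\<^sub>R pt 0 + t *\<^sub>R pt 5 \<in> H"
      using segment_H[OF vertex_in_hexagon[OF conv] vertex_in_hexagon[OF conv], of 0 5] convex_comb_in_segment[of t "pt 0" "pt 5"] st by auto
    ultimately show "emb j (s *\<^sub>R pt 2 + t *\<^sub>R pt 3) \<in> R (j + 1)" unfolding emb_def R_def using False j by (auto simp del: pt_simps)
  qed auto
qed

text \<open>Induction on the distance of the two tiles. A common image lies on the chord separating
  tile \<open>i\<close> from the later ones, so \<open>x\<close> is on the edge shared with the next
  tile and may be counted there.\<close>

lemma inj_R:
  assumes "- 1 \<le> i" "j = i + int n" "j \<le> B - 2" "x \<in> R i" "y \<in> R j" "psi x = psi y"
  shows "x = y"
  using assms
proof (induction n arbitrary: i x)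
  case 0
  obtain c where c: "adm (\<tau> i) c" "x = emb i (comb c pt)" "psi x = comb c (V i)" using R_weights[OF 0(4,1)] by blast
  obtain c' where c': "adm (\<tau> i) c'" "y = emb i (comb c' pt)" "psi y = comb c' (V i)" using R_weights[of y i] 0 by auto
  have "\<forall>i<6. c i = c' i"
    by (rule peel_unique[OF peel_V good_tri_T[OF tau] c(1) c'(1)]) (use 0 c c' in auto)
  then have "comb c pt = comb c' pt" by (intro comb_cong) auto
  then show ?case using c c' by simp
next
  case (Suc n)
  obtain c where c: "adm (\<tau> i) c" "x = emb i (comb c pt)" "psi x = comb c (V i)" using R_weights[OF Suc(5,2)] by blast
  have j1: "- 1 \<le> j" using Suc.prems(1,2) by simp
  obtain c' where c': "adm (\<tau> j) c'" "psi y = comb c' (V j)" using R_weights[OF Suc.prems(5) j1] by blast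
  have w: "wts c" "wts c'" using c c' unfolding adm_def by auto
  have ij: "i < j" using Suc.prems(2) by simp
  obtain p q where pq: "p < 6" "q < 6" "p \<noteq> q" "\<And>l. l < 6 \<Longrightarrow> l \<noteq> p \<Longrightarrow> l \<noteq> q \<Longrightarrow> orient (V i p) (V i q) (V i l) > 0"
    "\<And>l. l < 6 \<Longrightarrow> orient (V i p) (V i q) (V j l) \<le> 0"
    "\<And>s t. s + t = 1 \<Longrightarrow> 0 \<le> s \<Longrightarrow> 0 \<le> t \<Longrightarrow> emb i (s *\<^sub>R pt p + t *\<^sub>R pt q) \<in> R (i + 1)"
    using V_chain[OF Suc.prems(1) ij Suc.prems(3)] by blast
  have "orient (V i p) (V i q) (psi y) \<le> 0" unfolding c'(2) orient_comb[OF w(2)]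
    using pq(5) w(2) unfolding wts_def by (intro sum_nonpos) (simp add: mult_nonneg_nonpos)
  then have "orient (V i p) (V i q) (psi x) \<le> 0" using Suc.prems(6) by simp
  then have le: "(\<Sum>l<6. c l * orient (V i p) (V i q) (V i l)) \<le> 0" unfolding c(3) orient_comb[OF w(1)] .
  have nn: "c l * orient (V i p) (V i q) (V i l) \<ge> 0" if "l \<in> {..<6}" for l
    using pq(4)[of l] w(1) that unfolding wts_def by (cases "l = p \<or> l = q") (auto intro: less_imp_le)
  then have "(\<Sum>l<6. c l * orient (V i p) (V i q) (V i l)) \<ge> 0" by (rule sum_nonneg)
  with le have "(\<Sum>l<6. c l * orient (V i p) (V i q) (V i l)) = 0" by simp
  then have z: "\<forall>l\<in>{..<6}. c l * orient (V i p) (V i q) (V i l) = 0" using nn by (subst (asm) sum_nonneg_eq_0_iff) auto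
  have c0: "\<forall>l<6. l \<noteq> p \<and> l \<noteq> q \<longrightarrow> c l = 0"
  proof (intro allI impI)
    fix l assume l: "l < (6::nat)" "l \<noteq> p \<and> l \<noteq> q"
    then have "orient (V i p) (V i q) (V i l) > 0" using pq(4) by blast
    then show "c l = 0" using z l by auto
  qed
  have "comb c pt = c p *\<^sub>R pt p + c q *\<^sub>R pt q" "c p + c q = 1" using edge_comb[OF w(1) pq(1-3) c0] by auto
  then have "x \<in> R (i + 1)" using pq(6)[of "c p" "c q"] c(2) w(1) pq(1,2) unfolding wts_def by simp
  then show ?case using Suc.IH[of "i + 1" x] Suc.prems by simp
qed

lemma row_R:
  assumes "x \<in> row"
  obtains j where "- 1 \<le> j" "j \<le> B - 2" "x \<in> R j"
  using assms
proof (cases rule: row_cases)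
  case (1 k p)
  then show ?thesis using that[of k] unfolding R_def by auto
next
  case (2 p)
  then show ?thesis using that[of "- 1"] B4 unfolding R_def by auto
qed

lemma inj_row:
  assumes "x \<in> row" "y \<in> row" "psi x = psi y"
  shows "x = y"
proof -
  obtain i j where i: "- 1 \<le> i" "i \<le> B - 2" "x \<in> R i" and j: "- 1 \<le> j" "j \<le> B - 2" "y \<in> R j"
    using row_R assms by metis
  show ?thesis
  proof (cases "i \<le> j")
    case True
    then show ?thesis using inj_R[of i j "nat (j - i)" x y] i j assms by simp
  next
    case False
    then show ?thesis using inj_R[of j i "nat (i - j)" y x] i j assms by simp
  qed
qed

lemma pt_H: "i < 6 \<Longrightarrow> pt i \<in> H"
  by (rule vertex_in_hexagon[OF conv])

lemma H_points: "w0 \<in> H" "- w0 \<in> H" "w0 + iv (1, 0) \<in> H" "u0 + iv (1, 0) \<in> H" "iv (- 2, 1) - u0 \<in> H" "u0 \<in> H"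
  using pt_H[of 0] pt_H[of 1] pt_H[of 2] pt_H[of 3] pt_H[of 4] pt_H[of 5] by simp_all

lemma pt_1: "pt 1 = - w0"
  by (simp add: iv_def prod_eq_iff)

lemma beta_B: "\<beta> B = - u0"
  using per(2)[of 0] ends(2) by (simp add: iv_def prod_eq_iff)

text \<open>The corners of the row that go to the six vertices of the hexagon. They cut the boundary
  of the row into six arcs, one for each edge.\<close>

lemma psi_ends:
  "psi (- u0) = w0" "psi (u0 + iv bd) = - w0" "psi (u0) = iv (- 2, 1) - u0" "psi (- u0 - iv (1, 0)) = u0"
  "psi (iv (- 2, 1) - u0 + iv (1, 0)) = u0 + iv (1, 0)" "psi (iv (- 2, 1) - u0 + iv (2, 0)) = w0 + iv (1, 0)"
proof -
  have b: "av \<beta> (B - 1, - 1) = - w0 - iv (1, 0)" "av \<beta> (B, - 1) = - u0 - iv (1, 0)"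
    unfolding av_def using ends beta_B by (simp_all add: iv_def prod_eq_iff)
  show 2: "psi (u0 + iv bd) = - w0" using psi_vertex[of 5 bd] ends av0(2)[of "B - 1"] by simp
  show "psi (- u0) = w0" using psi_reflect[of "u0 + iv bd"] 2 by simp
  show "psi u0 = iv (- 2, 1) - u0" using psi_vertex[of 5 0] ends av00 by (simp add: iv_simps)
  have "psi (u0 + iv (B, 0)) = - u0" using psi_vertex[of 5 "(B, 0)"] beta_B av0(2)[of B] by simp
  then have "psi (iv bd - (u0 + iv (B, 0))) = u0" using psi_reflect[of "u0 + iv (B, 0)"] by simp
  moreover have "iv bd - (u0 + iv (B, 0)) = - u0 - iv (1, 0)" by (simp add: iv_def prod_eq_iff)
  ultimately show "psi (- u0 - iv (1, 0)) = u0" by simp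
  have "bd - (- 2, 1) - (1, 0) = (B, - 1)" "bd - (- 2, 1) - (2, 0) = (B - 1, - 1)" by simp_all
  then show "psi (iv (- 2, 1) - u0 + iv (1, 0)) = u0 + iv (1, 0)" "psi (iv (- 2, 1) - u0 + iv (2, 0)) = w0 + iv (1, 0)"
    using psi_vertex[of 4 "(1, 0)"] psi_vertex[of 4 "(2, 0)"] b by simp_all
qed

text \<open>The path is the long zigzag from \<open>- u0\<close> to \<open>u0 + iv bd\<close>
  through the translates of \<open>- w0\<close> and \<open>w0\<close> in turn; it is symmetric about
  \<open>((B - 1) / 2, 0)\<close>.\<close>

lemma boundary_01:
  assumes "p \<in> H" "orient (pt 0) (pt 1) p = 0"
  shows "\<exists>y\<in>row. iv (bd + (0 * B, 0)) - y \<in> row \<and> psi y = p"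
proof -
  define N where "N = nat (B - 1)"
  have N: "int N = B - 1" "N \<ge> 3" unfolding N_def using B4 by auto
  define x where "x = (\<lambda>i. if i = 0 then - u0 else if i = Suc (2 * N) then u0 + iv bd
    else if even i then w0 + iv (int (i div 2), 0) else iv (int (i div 2), 0) - w0)"
  have xe: "x (2 * k) = w0 + iv (int k, 0)" if "1 \<le> k" for k
  proof -
    have "2 * k \<noteq> Suc (2 * N)" by presburger
    then show ?thesis using that unfolding x_def by simp
  qed
  have xo: "x (Suc (2 * k)) = iv (int k, 0) - w0" if "k < N" for k using that unfolding x_def by auto
  have x0: "x 0 = - u0" "x (Suc (2 * N)) = u0 + iv bd" unfolding x_def by auto
  show ?thesis
  proof (rule boundary_reflect[where n = "2 * N" and x = x and i' = 0 and j' = 1, OF _ _ _ _ _ _ assms])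
    fix i assume i: "i \<le> 2 * N"
    show "closed_segment (x i) (x (Suc i)) \<subseteq> row"
    proof (cases "even i")
      case True
      then obtain k where k: "i = 2 * k" by blast
      consider "k = 0" | "k = N" | "1 \<le> k" "k < N" using i k by linarith
      then show ?thesis
      proof cases
        case 1
        have "x (Suc 0) = - w0" using xo[of 0] N by (simp add: iv_def prod_eq_iff)
        then show ?thesis using segment_row_neg[of "- u0" "- w0"] H_points x0 1 k by simp
      next
        case 2
        have "x (2 * N) = w0 + iv bd" using xe[of N] N by simp
        then show ?thesis unfolding k 2 x0
          by (simp only:) (rule segment_row_shift'[OF H_points(3,4), of _ "B - 2"], use B4 in \<open>auto simp: iv_def prod_eq_iff\<close>)
      next
        case 3
        have "w0 + iv (int k, 0) - iv (int k, 0) = w0" "iv (int k, 0) - w0 - iv (int k, 0) = - w0" by simp_all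
        then show ?thesis using segment_row_shift[of "w0 + iv (int k, 0)" "int k" "iv (int k, 0) - w0"] H_points 3 k xe[of k] xo[of k] N by simp
      qed
    next
      case False
      then obtain k where k: "i = Suc (2 * k)" by (metis oddE Suc_eq_plus1)
      have kN: "k < N" using k i by linarith
      have "x (Suc i) = w0 + iv (int (Suc k), 0)" using xe[of "Suc k"] k by simp
      then show ?thesis unfolding k xo[OF kN]
        by (simp only:) (rule segment_row_shift'[OF H_points(2,3), of _ "int k"], use kN N in \<open>auto simp: iv_def prod_eq_iff\<close>)
    qed
  next
    fix i assume i: "i \<le> Suc (2 * N)"
    have c: "iv (bd + (0 * B, 0)) = iv (int N, 0)" using N by (simp add: iv_def)
    have ub: "u0 + iv bd = u0 + iv (int N, 0)" using N by simp
    show "x (Suc (2 * N) - i) = iv (bd + (0 * B, 0)) - x i"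
    proof (cases "i = 0 \<or> i = Suc (2 * N)")
      case True
      then show ?thesis using x0 unfolding c ub by auto
    next
      case F: False
      show ?thesis
      proof (cases "even i")
        case True
        then obtain k where k: "i = 2 * k" by blast
        have kN: "1 \<le> k" "k \<le> N" using F i k by linarith+
        have "Suc (2 * N) - i = Suc (2 * (N - k))" using kN k by simp
        then show ?thesis using xo[of "N - k"] xe[of k] kN k unfolding c by (simp add: iv_def prod_eq_iff of_nat_diff)
      next
        case False
        then obtain k where k: "i = Suc (2 * k)" by (metis oddE Suc_eq_plus1)
        have kN: "k < N" using F i k by linarith
        have "Suc (2 * N) - i = 2 * (N - k)" using kN k by simp
        then show ?thesis using xe[of "N - k"] xo[of k] kN k unfolding c by (simp add: iv_def prod_eq_iff of_nat_diff)
      qed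
    qed
  next
    show "hedge 0 1" unfolding hedge_def by simp
    show "psi (x 0) = pt 0" "psi (x (Suc (2 * N))) = pt 1" unfolding x0 psi_ends pt_1 by simp_all
    show "orient (pt 0) (pt 1) p = 0" if "p \<in> H" "q \<in> H" "p + q = iv (2 * 0 + 0, - 0)" for p q
      using sum_int[OF that] by (auto simp: iv_def)
  qed
qed

text \<open>The other long side of the row, traversed backwards from \<open>u0 + iv bd\<close> in
  \<open>2 (B - 4) + 1\<close> segments; this is where \<open>B \<ge> 4\<close> fixes the shape of
  the path.\<close>

lemma boundary_12:
  assumes "p \<in> H" "orient (pt 1) (pt 2) p = 0"
  shows "\<exists>y\<in>row. iv (bd + (0 * B, 1)) - y \<in> row \<and> psi y = p"
proof -
  define M where "M = nat (B - 4)"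
  have M: "int M = B - 4" unfolding M_def using B4 by auto
  define u1 where "u1 = iv (- 2, 1) - u0"
  define x where "x = (\<lambda>i. if even i then u0 + iv (B - 1 - int (i div 2), 0) else u1 + iv (B - 2 - int (i div 2), 0))"
  have xe: "x (2 * k) = u0 + iv (B - 1 - int k, 0)" for k unfolding x_def by auto
  have xo: "x (Suc (2 * k)) = u1 + iv (B - 2 - int k, 0)" for k unfolding x_def by auto
  show ?thesis
  proof (rule boundary_reflect[where n = "2 * M" and x = x and i' = 1 and j' = 2, OF _ _ _ _ _ _ assms])
    fix i assume i: "i \<le> 2 * M"
    show "closed_segment (x i) (x (Suc i)) \<subseteq> row"
    proof (cases "even i")
      case True
      then obtain k where k: "i = 2 * k" by blast
      show ?thesis unfolding k xe xo
        by (rule segment_row_shift'[OF H_points(4,5), of _ "B - 2 - int k"])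
          (use k i M in \<open>auto simp: iv_def prod_eq_iff u1_def\<close>)
    next
      case False
      then obtain k where k: "i = Suc (2 * k)" by (metis oddE Suc_eq_plus1)
      have "u0 + iv (B - 2 - int k, 0) - iv (B - 2 - int k, 0) = u0" "u1 + iv (B - 2 - int k, 0) - iv (B - 2 - int k, 0) = u1" by simp_all
      moreover have "x (Suc i) = u0 + iv (B - 2 - int k, 0)" using xe[of "Suc k"] k by (simp add: algebra_simps)
      ultimately show ?thesis using segment_row_shift[of "u1 + iv (B - 2 - int k, 0)" "B - 2 - int k" "u0 + iv (B - 2 - int k, 0)"]
          H_points xo[of k] k i M unfolding u1_def by simp
    qed
  next
    fix i assume i: "i \<le> Suc (2 * M)"
    show "x (Suc (2 * M) - i) = iv (bd + (0 * B, 1)) - x i"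
    proof (cases "even i")
      case True
      then obtain k where k: "i = 2 * k" by blast
      have kM: "k \<le> M" using i k by linarith
      have "Suc (2 * M) - i = Suc (2 * (M - k))" using kM k by simp
      then show ?thesis using xo[of "M - k"] xe[of k] kM k M by (simp add: iv_def prod_eq_iff of_nat_diff u1_def)
    next
      case False
      then obtain k where k: "i = Suc (2 * k)" by (metis oddE Suc_eq_plus1)
      have kM: "k \<le> M" using i k by linarith
      have "Suc (2 * M) - i = 2 * (M - k)" using kM k by simp
      then show ?thesis using xe[of "M - k"] xo[of k] kM k M by (simp add: iv_def prod_eq_iff of_nat_diff u1_def)
    qed
  next
    show "hedge 1 2" unfolding hedge_def by simp
    have "x 0 = u0 + iv bd" using xe[of 0] by simp
    then show "psi (x 0) = pt 1" unfolding pt_1 using psi_ends by simp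
    have "x (Suc (2 * M)) = u1 + iv (2, 0)" using xo[of M] M by simp
    then show "psi (x (Suc (2 * M))) = pt 2" using psi_ends unfolding u1_def by simp
    show "orient (pt 1) (pt 2) p = 0" if "p \<in> H" "q \<in> H" "p + q = iv (2 * 0 + 1, - 0)" for p q
      using sum_int[OF that] by (auto simp: iv_def)
  qed
qed

lemma boundary_45:
  assumes "p \<in> H" "orient (pt 4) (pt 5) p = 0"
  shows "\<exists>y\<in>row. iv (bd + (- 1 * B, 0)) - y \<in> row \<and> psi y = p"
proof -
  define x where "x = (\<lambda>i. [u0, w0, - w0 - iv (1, 0), - u0 - iv (1, 0)] ! i)"
  have x: "x 0 = u0" "x (Suc 0) = w0" "x (Suc (Suc 0)) = - w0 - iv (1, 0)" "x (Suc (Suc (Suc 0))) = - u0 - iv (1, 0)"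
    unfolding x_def by simp_all
  show ?thesis
  proof (rule boundary_reflect[where n = 2 and x = x and i' = 4 and j' = 5, OF _ _ _ _ _ _ assms])
    fix i :: nat assume "i \<le> 2"
    then consider "i = 0" | "i = Suc 0" | "i = Suc (Suc 0)" by linarith
    then show "closed_segment (x i) (x (Suc i)) \<subseteq> row"
    proof cases
      case 1
      then show ?thesis using segment_row_shift[of u0 0 w0] H_points B4 x by simp
    next
      case 2
      then show ?thesis using segment_row_neg[of w0 "- w0 - iv (1, 0)"] H_points x by (simp add: add.commute)
    next
      case 3
      then show ?thesis using segment_row_neg[of "- w0 - iv (1, 0)" "- u0 - iv (1, 0)"] H_points x by (simp add: add.commute)
    qed
  next
    fix i :: nat assume "i \<le> Suc 2"
    then consider "i = 0" | "i = Suc 0" | "i = Suc (Suc 0)" | "i = Suc (Suc (Suc 0))" by linarith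
    then show "x (Suc 2 - i) = iv (bd + (- 1 * B, 0)) - x i"
      by cases (simp_all add: x numeral_2_eq_2, simp_all add: iv_def prod_eq_iff)
  next
    show "hedge 4 5" unfolding hedge_def by simp
    show "psi (x 0) = pt 4" "psi (x (Suc 2)) = pt 5" using psi_ends x by (simp_all add: numeral_2_eq_2)
    show "orient (pt 4) (pt 5) p = 0" if "p \<in> H" "q \<in> H" "p + q = iv (2 * - 1 + 0, - (- 1))" for p q
      using sum_int[OF that] by (auto simp: iv_def)
  qed
qed

lemma boundary_34:
  assumes "p \<in> H" "orient (pt 3) (pt 4) p = 0"
  shows "\<exists>y\<in>row. iv (bd + (- 1 * B, 1)) - y \<in> row \<and> psi y = p"
proof -
  define u1 where "u1 = iv (- 2, 1) - u0"
  define x where "x = (\<lambda>i. [u1 + iv (1, 0), u0 + iv (1, 0), u1, u0] ! i)"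
  have x: "x 0 = u1 + iv (1, 0)" "x (Suc 0) = u0 + iv (1, 0)" "x (Suc (Suc 0)) = u1" "x (Suc (Suc (Suc 0))) = u0"
    unfolding x_def by simp_all
  show ?thesis
  proof (rule boundary_reflect[where n = 2 and x = x and i' = 3 and j' = 4, OF _ _ _ _ _ _ assms])
    fix i :: nat assume "i \<le> 2"
    then consider "i = 0" | "i = Suc 0" | "i = Suc (Suc 0)" by linarith
    then show "closed_segment (x i) (x (Suc i)) \<subseteq> row"
    proof cases
      case 1
      then show ?thesis using segment_row_shift[of "u1 + iv (1, 0)" 1 "u0 + iv (1, 0)"] H_points B4 x unfolding u1_def by simp
    next
      case 2
      then show ?thesis using segment_row_shift[of "u0 + iv (1, 0)" 0 u1] H_points B4 x unfolding u1_def by simp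
    next
      case 3
      then show ?thesis using segment_row_shift[of u1 0 u0] H_points B4 x unfolding u1_def by simp
    qed
  next
    fix i :: nat assume "i \<le> Suc 2"
    then consider "i = 0" | "i = Suc 0" | "i = Suc (Suc 0)" | "i = Suc (Suc (Suc 0))" by linarith
    then show "x (Suc 2 - i) = iv (bd + (- 1 * B, 1)) - x i"
      by cases (simp_all add: x numeral_2_eq_2, simp_all add: u1_def iv_def prod_eq_iff)
  next
    show "hedge 3 4" unfolding hedge_def by simp
    show "psi (x 0) = pt 3" "psi (x (Suc 2)) = pt 4" using psi_ends x unfolding u1_def by (simp_all add: numeral_2_eq_2)
    show "orient (pt 3) (pt 4) p = 0" if "p \<in> H" "q \<in> H" "p + q = iv (2 * - 1 + 1, - (- 1))" for p q
      using sum_int[OF that] by (auto simp: iv_def)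
  qed
qed

lemma boundary_23:
  assumes "p \<in> H" "orient (pt 2) (pt 3) p = 0"
  shows "\<exists>y\<in>row. y - iv (0 * B, 1) \<in> row \<and> psi y = p"
proof -
  define u1 where "u1 = iv (- 2, 1) - u0"
  define x where "x = (\<lambda>i. [u1 + iv (2, 0), u0 + iv (2, 0), u1 + iv (1, 0)] ! i)"
  have x: "x 0 = u1 + iv (2, 0)" "x (Suc 0) = u0 + iv (2, 0)" "x (Suc (Suc 0)) = u1 + iv (1, 0)"
    unfolding x_def by simp_all
  have y: "- (x 0 - iv (0 * B, 1)) = u0" "- (x (Suc 0) - iv (0 * B, 1)) = u1" "- (x (Suc (Suc 0)) - iv (0 * B, 1)) = u0 + iv (1, 0)"
    unfolding x u1_def by (simp_all add: iv_def prod_eq_iff)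
  show ?thesis
  proof (rule boundary_shift[where n = 1 and x = x and i' = 2 and j' = 3, OF _ _ _ _ _ _ assms])
    fix i :: nat assume "i \<le> 1"
    then consider "i = 0" | "i = Suc 0" by linarith
    then show "closed_segment (x i) (x (Suc i)) \<subseteq> row"
    proof cases
      case 1
      then show ?thesis using segment_row_shift[of "u1 + iv (2, 0)" 2 "u0 + iv (2, 0)"] H_points B4 x unfolding u1_def by simp
    next
      case 2
      show ?thesis unfolding 2 x
        by (rule segment_row_shift'[OF H_points(4,5), of _ 1]) (use B4 in \<open>auto simp: iv_def prod_eq_iff u1_def\<close>)
    qed
  next
    fix i :: nat assume "i \<le> 1"
    then consider "i = 0" | "i = Suc 0" by linarith
    then show "closed_segment (x i - iv (0 * B, 1)) (x (Suc i) - iv (0 * B, 1)) \<subseteq> row"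
    proof cases
      case 1
      show ?thesis unfolding 1 by (rule segment_row_neg) (use y H_points in \<open>simp_all only: u1_def\<close>)
    next
      case 2
      show ?thesis unfolding 2 by (rule segment_row_neg) (use y H_points in \<open>simp_all only: u1_def\<close>)
    qed
  next
    show "hedge 2 3" unfolding hedge_def by simp
    show "psi (x 0) = pt 2" "psi (x (Suc 1)) = pt 3" using psi_ends x unfolding u1_def by simp_all
    show "orient (pt 2) (pt 3) p = 0" if "p \<in> H" "q \<in> H" "p - q = iv (2 * 0 + 1, - 0)" for p q
      using diff_int[OF that] by (auto simp: iv_def zero_prod_def)
  qed
qed

text \<open>A nonzero lattice vector puts the images on glued edges. The boundary lemma gives a
  preimage in the row whose shifted partner is in the row too, and injectivity on the row identifies
  the two with \<open>x\<close> and \<open>y\<close>. Edge 50 is edge 23 with the roles of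
  \<open>x\<close> and \<open>y\<close> exchanged.\<close>

lemma inj_shift:
  assumes x: "x \<in> row" "y \<in> row" and eq: "psi x = psi y + iv (2 * j + n, - j)"
  shows "x = y + iv (j * B, n)"
proof -
  have H: "psi x \<in> H" "psi y \<in> H" using x psi_row_subset by auto
  have main: "x = y + iv (0 * B, 1)" if x: "x \<in> row" "y \<in> row" and eq: "psi x = psi y + iv (1, 0)" and o: "orient (pt 2) (pt 3) (psi x) = 0" for x y
  proof -
    have "psi x \<in> H" using x psi_row_subset by auto
    from boundary_23[OF this o] obtain x' where x': "x' \<in> row" "x' - iv (0 * B, 1) \<in> row" "psi x' = psi x" by blast
    have "x' = x" using inj_row x' x by blast
    then have "psi (x - iv (0 * B, 1)) = psi y" using psi_shift[of "x - iv (0 * B, 1)" 0 1] eq by simp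
    then have "x - iv (0 * B, 1) = y" using inj_row x x' \<open>x' = x\<close> by blast
    then show ?thesis by (simp add: algebra_simps)
  qed
  have "psi x - psi y = iv (2 * j + n, - j)" using eq by simp
  from diff_int[OF H this] show ?thesis
  proof (elim disjE conjE)
    assume "(2 * j + n, - j) = 0"
    then have "j = 0" "n = 0" by (auto simp: zero_prod_def)
    then show ?thesis using inj_row[OF x] eq by simp
  next
    assume *: "(2 * j + n, - j) = (1, 0)" "orient (w0 + iv (1, 0)) (u0 + iv (1, 0)) (psi x) = 0"
    then have "j = 0" "n = 1" by auto
    then show ?thesis using main[OF x] eq * by simp
  next
    assume *: "(2 * j + n, - j) = - (1, 0)" "orient (w0 + iv (1, 0)) (u0 + iv (1, 0)) (psi y) = 0"
    then have jn: "j = 0" "n = - 1" by auto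
    have "iv (2 * j + n, - j) = - iv (1, 0)" using jn by (simp add: iv_def)
    then have "psi y = psi x + iv (1, 0)" using eq by simp
    then have "y = x + iv (0 * B, 1)" using main[OF x(2,1)] * by simp
    then show ?thesis using jn by (simp add: iv_def prod_eq_iff)
  qed
qed

lemma inj_reflect:
  assumes x: "x \<in> row" "y \<in> row" and eq: "psi x = - psi y + iv (2 * j + n, - j)"
  shows "x = iv bd - y + iv (j * B, n)"
proof -
  have H: "psi x \<in> H" "psi y \<in> H" using x psi_row_subset by auto
  have main: ?thesis if h: "\<exists>x'\<in>row. iv (bd + (j * B, n)) - x' \<in> row \<and> psi x' = psi x"
  proof -
    obtain x' where x': "x' \<in> row" "iv (bd + (j * B, n)) - x' \<in> row" "psi x' = psi x" using h by blast
    have xx: "x' = x" using inj_row x' x by blast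
    have e: "iv (bd + (j * B, n)) - x = (iv bd - x) + iv (j * B, n)" unfolding iv_simps by simp
    have "psi (iv (bd + (j * B, n)) - x) = psi y" unfolding e psi_shift psi_reflect eq by simp
    then have "iv (bd + (j * B, n)) - x = y" using inj_row x x' xx by blast
    then show ?thesis unfolding iv_simps by (simp add: algebra_simps)
  qed
  have "psi x + psi y = iv (2 * j + n, - j)" using eq by simp
  from sum_int[OF H this] show ?thesis
  proof (elim disjE conjE)
    assume *: "(2 * j + n, - j) = (0, 0)" "orient w0 (iv (0, 0) - w0) (psi x) = 0"
    then have jn: "j = 0" "n = 0" by auto
    show ?thesis by (rule main) (use boundary_01[OF H(1)] * in \<open>simp add: jn\<close>)
  next
    assume *: "(2 * j + n, - j) = (0, 0) + (1, 0)" "orient (iv (0, 0) - w0) (w0 + iv (1, 0)) (psi x) = 0"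
    then have jn: "j = 0" "n = 1" by auto
    show ?thesis by (rule main) (use boundary_12[OF H(1)] * in \<open>simp add: jn\<close>)
  next
    assume *: "(2 * j + n, - j) = (- 2, 1)" "orient (iv (- 2, 1) - u0) u0 (psi x) = 0"
    then have jn: "j = - 1" "n = 0" by auto
    show ?thesis by (rule main) (use boundary_45[OF H(1)] * in \<open>simp add: jn\<close>)
  next
    assume *: "(2 * j + n, - j) = (- 2, 1) + (1, 0)" "orient (u0 + iv (1, 0)) (iv (- 2, 1) - u0) (psi x) = 0"
    then have jn: "j = - 1" "n = 1" by auto
    show ?thesis by (rule main) (use boundary_34[OF H(1)] * in \<open>simp add: jn\<close>)
  qed
qed

theorem inj_psi: "inj psi"
proof (rule injI)
  fix x y assume eq: "psi x = psi y"
  have d: "iv (2 * j + n, - j) - iv (2 * j' + n', - j') = iv (2 * (j - j') + (n - n'), - (j - j'))" for j j' n n' :: int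
    by (simp add: iv_def)
  have d': "iv ((j - j') * B, n - n') = iv (j * B, n) - iv (j' * B, n')" for j j' n n' :: int
    by (simp add: iv_def algebra_simps)
  show "x = y"
  proof (cases rule: row_cover[of x])
    case x: (1 x0 j n)
    show ?thesis
    proof (cases rule: row_cover[of y])
      case y: (1 y0 j' n')
      have "psi x0 = psi y0 + iv (2 * (j' - j) + (n' - n), - (j' - j))"
        unfolding d[symmetric] using eq unfolding x(2) y(2) psi_shift by (simp add: algebra_simps)
      from inj_shift[OF x(1) y(1) this] show ?thesis unfolding d' x(2) y(2) by simp
    next
      case y: (2 y0 j' n')
      have "psi x0 = - psi y0 + iv (2 * (j' - j) + (n' - n), - (j' - j))"
        unfolding d[symmetric] using eq unfolding x(2) y(2) psi_shift psi_reflect by (simp add: algebra_simps)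
      from inj_reflect[OF x(1) y(1) this] show ?thesis unfolding d' x(2) y(2) by simp
    qed
  next
    case x: (2 x0 j n)
    show ?thesis
    proof (cases rule: row_cover[of y])
      case y: (1 y0 j' n')
      have "psi y0 = - psi x0 + iv (2 * (j - j') + (n - n'), - (j - j'))"
        unfolding d[symmetric] using eq unfolding x(2) y(2) psi_shift psi_reflect by (simp add: algebra_simps)
      from inj_reflect[OF y(1) x(1) this] show ?thesis unfolding d' x(2) y(2) by simp
    next
      case y: (2 y0 j' n')
      have "psi x0 = psi y0 + iv (2 * (j - j') + (n - n'), - (j - j'))"
        unfolding d[symmetric] using eq unfolding x(2) y(2) psi_shift psi_reflect by (simp add: algebra_simps)
      from inj_shift[OF x(1) y(1) this] show ?thesis unfolding d' x(2) y(2) by simp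
    qed
  qed
qed

end

section \<open>The tiles for B at least 4\<close>

lemma family_tiling: "hex_tiling (-12/25, 1/20) (-11/10, 9/20) (1, 0) (0, 0) (-2, 1)"
proof -
  have "hex_tiling (nrm (0, 0) (1, 0) (-2, 1) (-19/50, 1/20)) (nrm (0, 0) (1, 0) (-2, 1) (-1/5, 9/20)) (1, 0) (0, 0) ((0, 0) + (-2, 1))"
  proof (rule std_hex_tiling)
    show "convex6 (stdpts (-19/50) (1/20) (-1/5) (9/20))" by (rule convex6I) (simp add: stdpts_def orient_def)
  next
    fix X Y :: real
    assume h: "0 \<le> Y" "Y \<le> 1/2" "orient (-1/5, 9/20) (-19/50, 1/20) (X, Y) \<ge> 0" "orient (-19/50 + 1, 1/20) (-1/5 + 1, 9/20) (X, Y) \<ge> 0"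
    have mem: "(x, y) \<in> hexagon (stdpts (-19/50) (1/20) (-1/5) (9/20)) \<longleftrightarrow> 0 \<le> 5 * x + 38 * y + 0 \<and> 0 \<le> - 10 * x + 24 * y + 5 \<and> 0 \<le> - 400 * x + 180 * y + 239 \<and> 0 \<le> - 2 * x - 12 * y + 7 \<and> 0 \<le> 1 * x - 4 * y + 2 \<and> 0 \<le> 400 * x - 180 * y + 161" for x y
      unfolding hexagon_def by (simp add: stdpts_def orient_def) argo
    have h': "0 \<le> 400 * X - 180 * Y + 161" "0 \<le> - 400 * X + 180 * Y + 239" using h(3,4) by (simp_all add: orient_def)
    show "(X, Y) \<in> hexagon (stdpts (-19/50) (1/20) (-1/5) (9/20)) \<or> (- X, - Y) \<in> hexagon (stdpts (-19/50) (1/20) (-1/5) (9/20)) \<or> (1 - X, - Y) \<in> hexagon (stdpts (-19/50) (1/20) (-1/5) (9/20)) \<or> (- X, 1 - Y) \<in> hexagon (stdpts (-19/50) (1/20) (-1/5) (9/20)) \<or> (1 - X, 1 - Y) \<in> hexagon (stdpts (-19/50) (1/20) (-1/5) (9/20))"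
      unfolding mem using h(1,2) h' by argo
  qed simp_all
  then show ?thesis by (simp add: nrm_def iv_def)
qed

text \<open>For fixed coefficients the norm on the left is convex in each of the three image points,
  so it suffices to test the ends of the segments in which they vary. This settles all values of
  \<open>B\<close> at once.\<close>

lemma lipT_segments:
  assumes L: "L \<ge> 0" and corners: "\<forall>P\<in>{P0, P1}. \<forall>Q\<in>{Q0, Q1}. \<forall>R\<in>{R0, R1}. gram_ok s t L (f q - f p) (f r - f p) (Q - P) (R - P)"
    and g: "g p \<in> closed_segment P0 P1" "g q \<in> closed_segment Q0 Q1" "g r \<in> closed_segment R0 R1"
  shows "lipT (shear s t) L f g (p, q, r)"
proof -
  define K where "K = (\<lambda>P Q R. \<forall>b c. norm (shear s t (b *\<^sub>R (Q - P) + c *\<^sub>R (R - P))) \<le> L * norm (shear s t (b *\<^sub>R (f q - f p) + c *\<^sub>R (f r - f p))))"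
  have K0: "K P Q R" if "P \<in> {P0, P1}" "Q \<in> {Q0, Q1}" "R \<in> {R0, R1}" for P Q R
  proof -
    have "lipT (shear s t) L (\<lambda>i. if i = (0::nat) then f p else if i = 1 then f q else f r) (\<lambda>i. if i = (0::nat) then P else if i = 1 then Q else R) (0, 1, 2)"
      by (rule lipT_gram[OF L]) (use corners that in auto)
    then show ?thesis unfolding lipT_def K_def by simp
  qed
  have mix: "norm (shear s t ((1 - u) *\<^sub>R x + u *\<^sub>R y)) \<le> M" if "norm (shear s t x) \<le> M" "norm (shear s t y) \<le> M" "0 \<le> u" "u \<le> 1" for x y u M
  proof -
    have "norm (shear s t ((1 - u) *\<^sub>R x + u *\<^sub>R y)) \<le> norm ((1 - u) *\<^sub>R shear s t x) + norm (u *\<^sub>R shear s t y)"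
      using norm_triangle_ineq linear_add[OF linear_shear] linear_cmul[OF linear_shear] by metis
    also have "\<dots> = (1 - u) * norm (shear s t x) + u * norm (shear s t y)" using that by simp
    also have "\<dots> \<le> (1 - u) * M + u * M" using that by (intro add_mono mult_left_mono) auto
    finally show ?thesis by (simp add: algebra_simps)
  qed
  have K1: "K P Q R" if h: "K P0 Q R" "K P1 Q R" "P \<in> closed_segment P0 P1" for P Q R
    unfolding K_def
  proof (intro allI)
    fix b c
    obtain u where u: "P = (1 - u) *\<^sub>R P0 + u *\<^sub>R P1" "0 \<le> u" "u \<le> 1" using h(3) unfolding in_segment by blast
    have e: "b *\<^sub>R (Q - P) + c *\<^sub>R (R - P) = (1 - u) *\<^sub>R (b *\<^sub>R (Q - P0) + c *\<^sub>R (R - P0)) + u *\<^sub>R (b *\<^sub>R (Q - P1) + c *\<^sub>R (R - P1))"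
      unfolding u(1) by (simp add: algebra_simps)
    show "norm (shear s t (b *\<^sub>R (Q - P) + c *\<^sub>R (R - P))) \<le> L * norm (shear s t (b *\<^sub>R (f q - f p) + c *\<^sub>R (f r - f p)))"
      unfolding e by (rule mix) (use h u in \<open>auto simp: K_def\<close>)
  qed
  have K2: "K P Q R" if h: "K P Q0 R" "K P Q1 R" "Q \<in> closed_segment Q0 Q1" for P Q R
    unfolding K_def
  proof (intro allI)
    fix b c
    obtain u where u: "Q = (1 - u) *\<^sub>R Q0 + u *\<^sub>R Q1" "0 \<le> u" "u \<le> 1" using h(3) unfolding in_segment by blast
    have e: "b *\<^sub>R (Q - P) + c *\<^sub>R (R - P) = (1 - u) *\<^sub>R (b *\<^sub>R (Q0 - P) + c *\<^sub>R (R - P)) + u *\<^sub>R (b *\<^sub>R (Q1 - P) + c *\<^sub>R (R - P))"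
      unfolding u(1) by (simp add: algebra_simps)
    show "norm (shear s t (b *\<^sub>R (Q - P) + c *\<^sub>R (R - P))) \<le> L * norm (shear s t (b *\<^sub>R (f q - f p) + c *\<^sub>R (f r - f p)))"
      unfolding e by (rule mix) (use h u in \<open>auto simp: K_def\<close>)
  qed
  have K3: "K P Q R" if h: "K P Q R0" "K P Q R1" "R \<in> closed_segment R0 R1" for P Q R
    unfolding K_def
  proof (intro allI)
    fix b c
    obtain u where u: "R = (1 - u) *\<^sub>R R0 + u *\<^sub>R R1" "0 \<le> u" "u \<le> 1" using h(3) unfolding in_segment by blast
    have e: "b *\<^sub>R (Q - P) + c *\<^sub>R (R - P) = (1 - u) *\<^sub>R (b *\<^sub>R (Q - P) + c *\<^sub>R (R0 - P)) + u *\<^sub>R (b *\<^sub>R (Q - P) + c *\<^sub>R (R1 - P))"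
      unfolding u(1) by (simp add: algebra_simps)
    show "norm (shear s t (b *\<^sub>R (Q - P) + c *\<^sub>R (R - P))) \<le> L * norm (shear s t (b *\<^sub>R (f q - f p) + c *\<^sub>R (f r - f p)))"
      unfolding e by (rule mix) (use h u in \<open>auto simp: K_def\<close>)
  qed
  have "K P Q (g r)" if "P \<in> {P0, P1}" "Q \<in> {Q0, Q1}" for P Q using K3[OF K0 K0 g(3)] that by blast
  then have "K P (g q) (g r)" if "P \<in> {P0, P1}" for P using K2[OF _ _ g(2)] that by blast
  then have "K (g p) (g q) (g r)" using K1[OF _ _ g(1)] by blast
  then show ?thesis unfolding K_def lipT_def by simp
qed

text \<open>\<open>cl\<close> parametrises the line through the edge \<open>[w0, - w0]\<close> of the hexagon and \<open>ca\<close> the line through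
  \<open>[- w0, w0 + (1, 0)]\<close>. The boundaries between the tiles \<open>2, \<dots>, B - 2\<close> of the row are mapped to short
  chords from the one edge to the other, close to their midpoints.\<close>

definition cl :: "real \<Rightarrow> real \<times> real" where "cl x = (12/25 * x, - 1/20 * x)"
definition ca :: "real \<Rightarrow> real \<times> real" where "ca x = (1/2 + 1/50 * x, 1/20 * x)"

lemma cl_segment: "\<bar>x\<bar> \<le> 1/100 \<Longrightarrow> cl x \<in> closed_segment (- 3/625, 1/2000) (3/625, - 1/2000)"
  unfolding in_segment cl_def by (intro exI[of _ "50 * x + 1/2"]) (auto simp: abs_le_iff field_simps)

lemma ca_segment: "\<bar>x\<bar> \<le> 1/100 \<Longrightarrow> ca x \<in> closed_segment (2499/5000, - 1/2000) (2501/5000, 1/2000)"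
  unfolding in_segment ca_def by (intro exI[of _ "50 * x + 1/2"]) (auto simp: abs_le_iff field_simps)

lemma orient_cl_ca:
  "orient (cl a) (cl b) (ca c) = (b - a) * (1 + c) / 40" "orient (ca c) (cl a) (cl b) = (b - a) * (1 + c) / 40"
  "orient (cl a) (ca c) (cl b) = (a - b) * (1 + c) / 40"
  "orient (ca b) (ca c) (cl a) = (c - b) * (1 - a) / 40" "orient (cl a) (ca b) (ca c) = (c - b) * (1 - a) / 40"
  "orient (ca b) (cl a) (ca c) = (b - c) * (1 - a) / 40"
  "orient (cl a) (cl b) (cl c) = 0" "orient (ca a) (ca b) (ca c) = 0"
  by (simp_all add: orient_def cl_def ca_def field_simps)

text \<open>This and the following lemmas treat the kinds of tiles one by one: index 1, index 2, the
  middle indices, \<open>B - 2\<close>, the coincidence \<open>2 = B - 2\<close> for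
  \<open>B = 4\<close>, and the indices 0 and \<open>B - 1\<close>. Image points that depend on
  \<open>B\<close> are confined to short segments around two edge midpoints.\<close>

lemma lip_one:
  assumes "\<bar>x\<bar> \<le> 1/100" "\<bar>y\<bar> \<le> 1/100" "t \<in> set T1"
  shows "lipT (shear (9/20) (8/5)) (97/100) ((!) [(-12/25, 1/20), (12/25, -1/20), (13/25, 1/20), (-1/10, 9/20), (-9/10, 11/20), (-11/10, 9/20)]) ((!) [(-36/125, 3/100), cl x, cl y, (303/1000, 19/100), (-1/10, 9/20), (-13/50, 47/100)]) t" (is "lipT ?S ?L ?f ?g t")
proof -
  have "lipT ?S ?L ?f ?g (1, 2, 3)"
    by (rule lipT_segments[of _ "(- 3/625, 1/2000)" "(3/625, - 1/2000)" "(- 3/625, 1/2000)" "(3/625, - 1/2000)" "(303/1000, 19/100)" "(303/1000, 19/100)"]) (use cl_segment[OF assms(1)] cl_segment[OF assms(2)] in \<open>simp_all add: gram_ok_def bil_def\<close>)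
  moreover have "lipT ?S ?L ?f ?g (0, 1, 3)"
    by (rule lipT_segments[of _ "(-36/125, 3/100)" "(-36/125, 3/100)" "(- 3/625, 1/2000)" "(3/625, - 1/2000)" "(303/1000, 19/100)" "(303/1000, 19/100)"]) (use cl_segment[OF assms(1)] cl_segment[OF assms(2)] in \<open>simp_all add: gram_ok_def bil_def\<close>)
  moreover have "lipT ?S ?L ?f ?g (0, 3, 4)"
    by (rule lipT_segments[of _ "(-36/125, 3/100)" "(-36/125, 3/100)" "(303/1000, 19/100)" "(303/1000, 19/100)" "(-1/10, 9/20)" "(-1/10, 9/20)"]) (use cl_segment[OF assms(1)] cl_segment[OF assms(2)] in \<open>simp_all add: gram_ok_def bil_def\<close>)
  moreover have "lipT ?S ?L ?f ?g (0, 4, 5)"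
    by (rule lipT_segments[of _ "(-36/125, 3/100)" "(-36/125, 3/100)" "(-1/10, 9/20)" "(-1/10, 9/20)" "(-13/50, 47/100)" "(-13/50, 47/100)"]) (use cl_segment[OF assms(1)] cl_segment[OF assms(2)] in \<open>simp_all add: gram_ok_def bil_def\<close>)
  ultimately show ?thesis using assms(3) unfolding T1_def by auto
qed

lemma lip_two:
  assumes "\<bar>a\<bar> \<le> 1/100" "\<bar>b\<bar> \<le> 1/100" "\<bar>c\<bar> \<le> 1/100" "\<bar>x\<bar> \<le> 1/100" "t \<in> set TF"
  shows "lipT (shear (9/20) (8/5)) (97/100) ((!) [(-12/25, 1/20), (12/25, -1/20), (13/25, 1/20), (-1/10, 9/20), (-9/10, 11/20), (-11/10, 9/20)]) ((!) [cl a, cl b, cl c, ca x, (13/25, 1/20), (303/1000, 19/100)]) t" (is "lipT ?S ?L ?f ?g t")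
proof -
  have "lipT ?S ?L ?f ?g (2, 3, 4)"
    by (rule lipT_segments[of _ "(- 3/625, 1/2000)" "(3/625, - 1/2000)" "(2499/5000, - 1/2000)" "(2501/5000, 1/2000)" "(13/25, 1/20)" "(13/25, 1/20)"]) (use cl_segment[OF assms(1)] cl_segment[OF assms(2)] cl_segment[OF assms(3)] ca_segment[OF assms(4)] in \<open>simp_all add: gram_ok_def bil_def\<close>)
  moreover have "lipT ?S ?L ?f ?g (1, 2, 4)"
    by (rule lipT_segments[of _ "(- 3/625, 1/2000)" "(3/625, - 1/2000)" "(- 3/625, 1/2000)" "(3/625, - 1/2000)" "(13/25, 1/20)" "(13/25, 1/20)"]) (use cl_segment[OF assms(1)] cl_segment[OF assms(2)] cl_segment[OF assms(3)] ca_segment[OF assms(4)] in \<open>simp_all add: gram_ok_def bil_def\<close>)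
  moreover have "lipT ?S ?L ?f ?g (0, 1, 4)"
    by (rule lipT_segments[of _ "(- 3/625, 1/2000)" "(3/625, - 1/2000)" "(- 3/625, 1/2000)" "(3/625, - 1/2000)" "(13/25, 1/20)" "(13/25, 1/20)"]) (use cl_segment[OF assms(1)] cl_segment[OF assms(2)] cl_segment[OF assms(3)] ca_segment[OF assms(4)] in \<open>simp_all add: gram_ok_def bil_def\<close>)
  moreover have "lipT ?S ?L ?f ?g (0, 4, 5)"
    by (rule lipT_segments[of _ "(- 3/625, 1/2000)" "(3/625, - 1/2000)" "(13/25, 1/20)" "(13/25, 1/20)" "(303/1000, 19/100)" "(303/1000, 19/100)"]) (use cl_segment[OF assms(1)] cl_segment[OF assms(2)] cl_segment[OF assms(3)] ca_segment[OF assms(4)] in \<open>simp_all add: gram_ok_def bil_def\<close>)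
  ultimately show ?thesis using assms(5) unfolding TF_def by auto
qed

lemma lip_mid:
  assumes "\<bar>a\<bar> \<le> 1/100" "\<bar>b\<bar> \<le> 1/100" "\<bar>c\<bar> \<le> 1/100" "\<bar>x\<bar> \<le> 1/100" "\<bar>y\<bar> \<le> 1/100" "\<bar>z\<bar> \<le> 1/100" "t \<in> set TF"
  shows "lipT (shear (9/20) (8/5)) (97/100) ((!) [(-12/25, 1/20), (12/25, -1/20), (13/25, 1/20), (-1/10, 9/20), (-9/10, 11/20), (-11/10, 9/20)]) ((!) [cl a, cl b, cl c, ca x, ca y, ca z]) t" (is "lipT ?S ?L ?f ?g t")
proof -
  have "lipT ?S ?L ?f ?g (2, 3, 4)"
    by (rule lipT_segments[of _ "(- 3/625, 1/2000)" "(3/625, - 1/2000)" "(2499/5000, - 1/2000)" "(2501/5000, 1/2000)" "(2499/5000, - 1/2000)" "(2501/5000, 1/2000)"]) (use cl_segment[OF assms(1)] cl_segment[OF assms(2)] cl_segment[OF assms(3)] ca_segment[OF assms(4)] ca_segment[OF assms(5)] ca_segment[OF assms(6)] in \<open>simp_all add: gram_ok_def bil_def\<close>)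
  moreover have "lipT ?S ?L ?f ?g (1, 2, 4)"
    by (rule lipT_segments[of _ "(- 3/625, 1/2000)" "(3/625, - 1/2000)" "(- 3/625, 1/2000)" "(3/625, - 1/2000)" "(2499/5000, - 1/2000)" "(2501/5000, 1/2000)"]) (use cl_segment[OF assms(1)] cl_segment[OF assms(2)] cl_segment[OF assms(3)] ca_segment[OF assms(4)] ca_segment[OF assms(5)] ca_segment[OF assms(6)] in \<open>simp_all add: gram_ok_def bil_def\<close>)
  moreover have "lipT ?S ?L ?f ?g (0, 1, 4)"
    by (rule lipT_segments[of _ "(- 3/625, 1/2000)" "(3/625, - 1/2000)" "(- 3/625, 1/2000)" "(3/625, - 1/2000)" "(2499/5000, - 1/2000)" "(2501/5000, 1/2000)"]) (use cl_segment[OF assms(1)] cl_segment[OF assms(2)] cl_segment[OF assms(3)] ca_segment[OF assms(4)] ca_segment[OF assms(5)] ca_segment[OF assms(6)] in \<open>simp_all add: gram_ok_def bil_def\<close>)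
  moreover have "lipT ?S ?L ?f ?g (0, 4, 5)"
    by (rule lipT_segments[of _ "(- 3/625, 1/2000)" "(3/625, - 1/2000)" "(2499/5000, - 1/2000)" "(2501/5000, 1/2000)" "(2499/5000, - 1/2000)" "(2501/5000, 1/2000)"]) (use cl_segment[OF assms(1)] cl_segment[OF assms(2)] cl_segment[OF assms(3)] ca_segment[OF assms(4)] ca_segment[OF assms(5)] ca_segment[OF assms(6)] in \<open>simp_all add: gram_ok_def bil_def\<close>)
  ultimately show ?thesis using assms(7) unfolding TF_def by auto
qed

lemma lip_last:
  assumes "\<bar>a\<bar> \<le> 1/100" "\<bar>y\<bar> \<le> 1/100" "\<bar>z\<bar> \<le> 1/100" "t \<in> set TF"
  shows "lipT (shear (9/20) (8/5)) (97/100) ((!) [(-12/25, 1/20), (12/25, -1/20), (13/25, 1/20), (-1/10, 9/20), (-9/10, 11/20), (-11/10, 9/20)]) ((!) [cl a, (36/125, -3/100), (57/125, -19/400), (12/25, -1/20), ca y, ca z]) t" (is "lipT ?S ?L ?f ?g t")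
proof -
  have "lipT ?S ?L ?f ?g (2, 3, 4)"
    by (rule lipT_segments[of _ "(57/125, -19/400)" "(57/125, -19/400)" "(12/25, -1/20)" "(12/25, -1/20)" "(2499/5000, - 1/2000)" "(2501/5000, 1/2000)"]) (use cl_segment[OF assms(1)] ca_segment[OF assms(2)] ca_segment[OF assms(3)] in \<open>simp_all add: gram_ok_def bil_def\<close>)
  moreover have "lipT ?S ?L ?f ?g (1, 2, 4)"
    by (rule lipT_segments[of _ "(36/125, -3/100)" "(36/125, -3/100)" "(57/125, -19/400)" "(57/125, -19/400)" "(2499/5000, - 1/2000)" "(2501/5000, 1/2000)"]) (use cl_segment[OF assms(1)] ca_segment[OF assms(2)] ca_segment[OF assms(3)] in \<open>simp_all add: gram_ok_def bil_def\<close>)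
  moreover have "lipT ?S ?L ?f ?g (0, 1, 4)"
    by (rule lipT_segments[of _ "(- 3/625, 1/2000)" "(3/625, - 1/2000)" "(36/125, -3/100)" "(36/125, -3/100)" "(2499/5000, - 1/2000)" "(2501/5000, 1/2000)"]) (use cl_segment[OF assms(1)] ca_segment[OF assms(2)] ca_segment[OF assms(3)] in \<open>simp_all add: gram_ok_def bil_def\<close>)
  moreover have "lipT ?S ?L ?f ?g (0, 4, 5)"
    by (rule lipT_segments[of _ "(- 3/625, 1/2000)" "(3/625, - 1/2000)" "(2499/5000, - 1/2000)" "(2501/5000, 1/2000)" "(2499/5000, - 1/2000)" "(2501/5000, 1/2000)"]) (use cl_segment[OF assms(1)] ca_segment[OF assms(2)] ca_segment[OF assms(3)] in \<open>simp_all add: gram_ok_def bil_def\<close>)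
  ultimately show ?thesis using assms(4) unfolding TF_def by auto
qed

lemma lip_four:
  assumes "\<bar>a\<bar> \<le> 1/100" "t \<in> set TF"
  shows "lipT (shear (9/20) (8/5)) (97/100) ((!) [(-12/25, 1/20), (12/25, -1/20), (13/25, 1/20), (-1/10, 9/20), (-9/10, 11/20), (-11/10, 9/20)]) ((!) [cl a, (36/125, -3/100), (57/125, -19/400), (12/25, -1/20), (13/25, 1/20), (303/1000, 19/100)]) t" (is "lipT ?S ?L ?f ?g t")
proof -
  have "lipT ?S ?L ?f ?g (2, 3, 4)"
    by (rule lipT_segments[of _ "(57/125, -19/400)" "(57/125, -19/400)" "(12/25, -1/20)" "(12/25, -1/20)" "(13/25, 1/20)" "(13/25, 1/20)"]) (use cl_segment[OF assms(1)] in \<open>simp_all add: gram_ok_def bil_def\<close>)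
  moreover have "lipT ?S ?L ?f ?g (1, 2, 4)"
    by (rule lipT_segments[of _ "(36/125, -3/100)" "(36/125, -3/100)" "(57/125, -19/400)" "(57/125, -19/400)" "(13/25, 1/20)" "(13/25, 1/20)"]) (use cl_segment[OF assms(1)] in \<open>simp_all add: gram_ok_def bil_def\<close>)
  moreover have "lipT ?S ?L ?f ?g (0, 1, 4)"
    by (rule lipT_segments[of _ "(- 3/625, 1/2000)" "(3/625, - 1/2000)" "(36/125, -3/100)" "(36/125, -3/100)" "(13/25, 1/20)" "(13/25, 1/20)"]) (use cl_segment[OF assms(1)] in \<open>simp_all add: gram_ok_def bil_def\<close>)
  moreover have "lipT ?S ?L ?f ?g (0, 4, 5)"
    by (rule lipT_segments[of _ "(- 3/625, 1/2000)" "(3/625, - 1/2000)" "(13/25, 1/20)" "(13/25, 1/20)" "(303/1000, 19/100)" "(303/1000, 19/100)"]) (use cl_segment[OF assms(1)] in \<open>simp_all add: gram_ok_def bil_def\<close>)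
  ultimately show ?thesis using assms(2) unfolding TF_def by auto
qed

lemma lip_zero:
  assumes "t \<in> set T0"
  shows "lipT (shear (9/20) (8/5)) (97/100) ((!) [(-12/25, 1/20), (12/25, -1/20), (13/25, 1/20), (-1/10, 9/20), (-9/10, 11/20), (-11/10, 9/20)]) ((!) [(-49/50, 51/100), (-57/125, 19/400), (-36/125, 3/100), (-13/50, 47/100), (-37/50, 53/100), (-9/10, 11/20)]) t" (is "lipT ?S ?L ?f ?g t")
proof -
  have "lipT ?S ?L ?f ?g (0, 1, 2)"
    by (rule lipT_segments[of _ "(-49/50, 51/100)" "(-49/50, 51/100)" "(-57/125, 19/400)" "(-57/125, 19/400)" "(-36/125, 3/100)" "(-36/125, 3/100)"]) (simp_all add: gram_ok_def bil_def)
  moreover have "lipT ?S ?L ?f ?g (0, 2, 3)"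
    by (rule lipT_segments[of _ "(-49/50, 51/100)" "(-49/50, 51/100)" "(-36/125, 3/100)" "(-36/125, 3/100)" "(-13/50, 47/100)" "(-13/50, 47/100)"]) (simp_all add: gram_ok_def bil_def)
  moreover have "lipT ?S ?L ?f ?g (0, 3, 4)"
    by (rule lipT_segments[of _ "(-49/50, 51/100)" "(-49/50, 51/100)" "(-13/50, 47/100)" "(-13/50, 47/100)" "(-37/50, 53/100)" "(-37/50, 53/100)"]) (simp_all add: gram_ok_def bil_def)
  moreover have "lipT ?S ?L ?f ?g (0, 4, 5)"
    by (rule lipT_segments[of _ "(-49/50, 51/100)" "(-49/50, 51/100)" "(-37/50, 53/100)" "(-37/50, 53/100)" "(-9/10, 11/20)" "(-9/10, 11/20)"]) (simp_all add: gram_ok_def bil_def)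
  ultimately show ?thesis using assms(1) unfolding T0_def by auto
qed

lemma lip_end:
  assumes "t \<in> set T0"
  shows "lipT (shear (9/20) (8/5)) (97/100) ((!) [(-12/25, 1/20), (12/25, -1/20), (13/25, 1/20), (-1/10, 9/20), (-9/10, 11/20), (-11/10, 9/20)]) ((!) [(57/125, -19/400), (49/50, -51/100), (51/50, -49/100), (11/10, -9/20), (697/1000, -19/100), (12/25, -1/20)]) t" (is "lipT ?S ?L ?f ?g t")
proof -
  have "lipT ?S ?L ?f ?g (0, 1, 2)"
    by (rule lipT_segments[of _ "(57/125, -19/400)" "(57/125, -19/400)" "(49/50, -51/100)" "(49/50, -51/100)" "(51/50, -49/100)" "(51/50, -49/100)"]) (simp_all add: gram_ok_def bil_def)
  moreover have "lipT ?S ?L ?f ?g (0, 2, 3)"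
    by (rule lipT_segments[of _ "(57/125, -19/400)" "(57/125, -19/400)" "(51/50, -49/100)" "(51/50, -49/100)" "(11/10, -9/20)" "(11/10, -9/20)"]) (simp_all add: gram_ok_def bil_def)
  moreover have "lipT ?S ?L ?f ?g (0, 3, 4)"
    by (rule lipT_segments[of _ "(57/125, -19/400)" "(57/125, -19/400)" "(11/10, -9/20)" "(11/10, -9/20)" "(697/1000, -19/100)" "(697/1000, -19/100)"]) (simp_all add: gram_ok_def bil_def)
  moreover have "lipT ?S ?L ?f ?g (0, 4, 5)"
    by (rule lipT_segments[of _ "(57/125, -19/400)" "(57/125, -19/400)" "(697/1000, -19/100)" "(697/1000, -19/100)" "(12/25, -1/20)" "(12/25, -1/20)"]) (simp_all add: gram_ok_def bil_def)
  ultimately show ?thesis using assms(1) unfolding T0_def by auto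
qed

section \<open>The model map for an arbitrary \<open>B \<ge> 4\<close>\<close>

locale family =
  fixes B :: int
  assumes B4: "B \<ge> 4"
begin

text \<open>Chord ends are spaced by \<open>ep\<close>, small enough to keep all parameters of
  modulus at most \<open>1/100\<close>. The offsets \<open>1/4\<close> and \<open>3/4\<close> in
  \<open>sg\<close> and \<open>tg\<close> make the half turn of a chord end fall halfway between two
  others, see \<open>sg_simps\<close>.\<close>

definition ep :: real where "ep = 1 / (50 * of_int B)"
definition sg :: "int \<Rightarrow> real" where "sg k = ep * (of_int k - of_int B / 2 + 1/4)"
definition tg :: "int \<Rightarrow> real" where "tg k = ep * (of_int B / 2 - of_int k + 3/4)"

text \<open>Generic indices lie on the edge \<open>[w0, - w0]\<close>, close to its midpoint. The
  exceptional values near the ends of the row do not depend on \<open>B\<close>.\<close>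

definition \<alpha> :: "int \<Rightarrow> real \<times> real" where
  "\<alpha> = qext B (\<lambda>k. if k = 0 then (-49/50, 51/100) else if k = 1 then (-36/125, 3/100) else if k = B - 1 then (57/125, -19/400) else cl (sg k))"

definition \<beta> :: "int \<Rightarrow> real \<times> real" where
  "\<beta> = qext B (\<lambda>k. if k = 0 then (-9/10, 11/20) else if k = 1 then (-13/50, 47/100) else if k = 2 then (303/1000, 19/100)
     else if k = B - 1 then (12/25, -1/20) else ca (tg k))"

definition \<tau> :: "int \<Rightarrow> (nat \<times> nat \<times> nat) list" where
  "\<tau> k = (if k mod B = 0 \<or> k mod B = B - 1 then T0 else if k mod B = 1 then T1 else TF)"

abbreviation "g k \<equiv> vls B \<alpha> \<beta> (1, 0) (0, 0) (- 2, 1) (k, 0)"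
abbreviation "f \<equiv> pts (-12/25, 1/20) (-11/10, 9/20) (1, 0) (0, 0) (- 2, 1)"

lemma ep: "ep > 0" "ep * of_int B = 1/50"
  unfolding ep_def using B4 by (auto simp: field_simps)

lemma sg_simps: "- sg (B - 1 - k) = sg k + ep / 2" "sg (k + 1) = sg k + ep" "- tg (B + 1 - k) = tg k - ep / 2" "tg (k + 1) = tg k - ep"
  unfolding sg_def tg_def by (simp_all add: field_simps)

lemma ep_mult_bound: "\<bar>c\<bar> \<le> of_int B / 2 \<Longrightarrow> \<bar>ep * c\<bar> \<le> 1/100"
proof -
  assume "\<bar>c\<bar> \<le> of_int B / 2"
  then have "ep * \<bar>c\<bar> \<le> ep * (of_int B / 2)" using ep(1) by (intro mult_left_mono) auto
  also have "\<dots> = (ep * of_int B) / 2" by simp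
  finally show ?thesis using ep by (simp add: abs_mult)
qed

lemma sg_bound: "0 \<le> k \<Longrightarrow> k \<le> B - 1 \<Longrightarrow> \<bar>sg k\<bar> \<le> 1/100 \<and> \<bar>sg k + ep / 2\<bar> \<le> 1/100"
proof -
  assume "0 \<le> k" "k \<le> B - 1"
  then have k: "0 \<le> real_of_int k" "real_of_int k \<le> of_int B - 1" by simp_all
  have e: "sg k + ep / 2 = ep * (of_int k - of_int B / 2 + 3/4)" unfolding sg_def by (simp add: field_simps)
  have "\<bar>of_int k - of_int B / 2 + 1/4\<bar> \<le> real_of_int B / 2" "\<bar>of_int k - of_int B / 2 + 3/4\<bar> \<le> real_of_int B / 2" using k by linarith+
  from this[THEN ep_mult_bound] show ?thesis unfolding e unfolding sg_def by blast
qed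

lemma tg_bound: "1 \<le> k \<Longrightarrow> k \<le> B \<Longrightarrow> \<bar>tg k\<bar> \<le> 1/100 \<and> \<bar>tg k - ep / 2\<bar> \<le> 1/100"
proof -
  assume "1 \<le> k" "k \<le> B"
  then have k: "1 \<le> real_of_int k" "real_of_int k \<le> of_int B" by simp_all
  have e: "tg k - ep / 2 = ep * (of_int B / 2 - of_int k + 1/4)" unfolding tg_def by (simp add: field_simps)
  have "\<bar>of_int B / 2 - of_int k + 3/4\<bar> \<le> real_of_int B / 2" "\<bar>of_int B / 2 - of_int k + 1/4\<bar> \<le> real_of_int B / 2" using k by linarith+
  from this[THEN ep_mult_bound] show ?thesis unfolding e unfolding tg_def by blast
qed

lemma sg_mono: "k \<le> m \<Longrightarrow> sg k \<le> sg m" "k \<le> m \<Longrightarrow> tg m \<le> tg k"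
  unfolding sg_def tg_def using ep(1) by auto

lemma cl_neg: "- cl x = cl (- x)"
  by (simp add: cl_def)

lemma ca_refl: "(1, 0) - ca x = ca (- x)"
  by (simp add: ca_def)

lemma \<alpha>_val: "\<alpha> 0 = (-49/50, 51/100)" "\<alpha> 1 = (-36/125, 3/100)" "\<alpha> (B - 1) = (57/125, -19/400)" "2 \<le> k \<Longrightarrow> k \<le> B - 2 \<Longrightarrow> \<alpha> k = cl (sg k)" "\<alpha> B = (-49/50, 51/100) + (2, - 1)"
  unfolding \<alpha>_def using B4 by (simp_all add: qext_id) (simp add: qext_def iv_def)

lemma \<beta>_val: "\<beta> 0 = (-9/10, 11/20)" "\<beta> 1 = (-13/50, 47/100)" "\<beta> 2 = (303/1000, 19/100)" "\<beta> (B - 1) = (12/25, -1/20)"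
  "3 \<le> k \<Longrightarrow> k \<le> B - 2 \<Longrightarrow> \<beta> k = ca (tg k)" "\<beta> B = (-9/10, 11/20) + (2, - 1)" "\<beta> (B + 1) = (-13/50, 47/100) + (2, - 1)"
  unfolding \<beta>_def using B4 by (simp_all add: qext_id) (simp_all add: qext_def iv_def)

lemma g_list: "g k = (!) [\<alpha> k, - \<alpha> (B - 1 - k), \<alpha> (k + 1), \<beta> (k + 1), (1, 0) - \<beta> (B + 1 - k), \<beta> k]"
  by (rule ext) (simp add: vls_def av_def algebra_simps flip: zero_prod_def)

lemma g_0: "g 0 = (!) [(-49/50, 51/100), (-57/125, 19/400), (-36/125, 3/100), (-13/50, 47/100), (-37/50, 53/100), (-9/10, 11/20)]"
  unfolding g_list using \<alpha>_val \<beta>_val by simp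

lemma g_1: "g 1 = (!) [(-36/125, 3/100), cl (sg 1 + ep / 2), cl (sg 2), (303/1000, 19/100), (-1/10, 9/20), (-13/50, 47/100)]"
  unfolding g_list using \<alpha>_val(4)[of "B - 2"] \<alpha>_val(4)[of 2] B4 sg_simps(1)[of 1] by (simp add: \<alpha>_val \<beta>_val cl_neg)

lemma g_end: "g (B - 1) = (!) [(57/125, -19/400), (49/50, -51/100), (51/50, -49/100), (11/10, -9/20), (697/1000, -19/100), (12/25, -1/20)]"
  unfolding g_list using \<alpha>_val \<beta>_val by simp

text \<open>Parameters of the vertex images of the tiles \<open>2, ..., B - 2\<close>. The first and
  the last of these tiles also use exceptional values of \<open>\<alpha>\<close> and
  \<open>\<beta>\<close>; all of them except the one in \<open>v5\<close> still lie on the two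
  lines, at \<open>3/5\<close>, \<open>19/20\<close>, \<open>- 1\<close> and
  \<open>1\<close>.\<close>

definition a1 where "a1 k = (if k = B - 2 then 3/5 else sg k + ep / 2)"
definition a2 where "a2 k = (if k = B - 2 then 19/20 else sg k + ep)"
definition b3 where "b3 k = (if k = B - 2 then - 1 else tg k - ep)"
definition b4 where "b4 k = (if k = 2 then 1 else tg k - ep / 2)"
definition v5 where "v5 k = (if k = 2 then (303/1000, 19/100) else ca (tg k))"

lemma g_finger:
  assumes "2 \<le> k" "k \<le> B - 2"
  shows "g k = (!) [cl (sg k), cl (a1 k), cl (a2 k), ca (b3 k), ca (b4 k), v5 k]"
proof -
  have "- \<alpha> (B - 1 - k) = cl (a1 k)"
    using \<alpha>_val(2) \<alpha>_val(4)[of "B - 1 - k"] assms sg_simps(1)[of k] unfolding a1_def by (simp add: cl_neg) (simp add: cl_def)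
  moreover have "\<alpha> (k + 1) = cl (a2 k)"
    using \<alpha>_val(3) \<alpha>_val(4)[of "k + 1"] assms sg_simps(2)[of k] unfolding a2_def by (cases "k = B - 2") (simp_all, simp add: cl_def)
  moreover have "\<beta> (k + 1) = ca (b3 k)"
    using \<beta>_val(4) \<beta>_val(5)[of "k + 1"] assms sg_simps(4)[of k] unfolding b3_def by (cases "k = B - 2") (simp_all, simp add: ca_def)
  moreover have "(1, 0) - \<beta> (B + 1 - k) = ca (b4 k)"
    using \<beta>_val(4) \<beta>_val(5)[of "B + 1 - k"] assms sg_simps(3)[of k] unfolding b4_def by (cases "k = 2") (simp_all add: ca_refl, simp add: ca_def)
  moreover have "\<beta> k = v5 k" using \<beta>_val(3) \<beta>_val(5)[of k] assms unfolding v5_def by simp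
  ultimately show ?thesis unfolding g_list using \<alpha>_val(4)[OF assms] by simp
qed

lemma finger_params:
  assumes "2 \<le> k" "k \<le> B - 2"
  shows "sg k < a1 k" "a1 k < a2 k" "a2 k \<le> 19/20" "- 1 \<le> b3 k" "b3 k < b4 k" "b4 k \<le> 1" "k \<noteq> 2 \<Longrightarrow> b4 k < tg k"
    "- 1/100 \<le> sg k" "sg k \<le> 1/100" "\<bar>tg k\<bar> \<le> 1/100"
proof -
  have s: "\<bar>sg k\<bar> \<le> 1/100" "\<bar>sg k + ep / 2\<bar> \<le> 1/100" "\<bar>tg k\<bar> \<le> 1/100" "\<bar>tg k - ep / 2\<bar> \<le> 1/100"
    using sg_bound[of k] tg_bound[of k] assms by auto
  have s': "\<bar>sg k + ep\<bar> \<le> 1/100" "\<bar>tg k - ep\<bar> \<le> 1/100"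
    using sg_bound[of "k + 1"] tg_bound[of "k + 1"] assms unfolding sg_simps by auto
  show "sg k < a1 k" "a1 k < a2 k" "a2 k \<le> 19/20" "- 1 \<le> b3 k" "b3 k < b4 k" "b4 k \<le> 1" "k \<noteq> 2 \<Longrightarrow> b4 k < tg k"
    "- 1/100 \<le> sg k" "sg k \<le> 1/100" "\<bar>tg k\<bar> \<le> 1/100"
    using s s' ep(1) unfolding a1_def a2_def b3_def b4_def abs_le_iff by (auto simp: add_strict_increasing)
qed

lemma tile_cases:
  assumes "0 \<le> k" "k < B"
  obtains "k = 0" | "k = 1" | "2 \<le> k" "k \<le> B - 2" | "k = B - 1"
  using assms by linarith

lemma f_list: "f = (!) [(-12/25, 1/20), (12/25, -1/20), (13/25, 1/20), (-1/10, 9/20), (-9/10, 11/20), (-11/10, 9/20)]"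
  by (rule ext) (simp add: pts_def iv_def)

lemma H_eq: "hexagon f = {x. \<forall>(a, b)\<in>{((-12/25, 1/20), (12/25, -1/20)), ((12/25, -1/20), (13/25, 1/20)), ((13/25, 1/20), (-1/10, 9/20)), ((-1/10, 9/20), (-9/10, 11/20)), ((-9/10, 11/20), (-11/10, 9/20)), ((-11/10, 9/20), (-12/25, 1/20))}. orient a b x \<ge> 0}"
  unfolding hexagon_def f_list by auto

lemma cl_H: "- 1 \<le> x \<Longrightarrow> x \<le> 1 \<Longrightarrow> cl x \<in> hexagon f"
  unfolding H_eq by (simp add: orient_def cl_def field_simps)

lemma ca_H: "- 1 \<le> x \<Longrightarrow> x \<le> 1 \<Longrightarrow> ca x \<in> hexagon f"
  unfolding H_eq by (simp add: orient_def ca_def field_simps)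

lemma R1_H: "(303/1000, 19/100) \<in> hexagon f"
  unfolding H_eq by (simp add: orient_def)

lemma sg_small: "\<bar>sg 1 + ep / 2\<bar> \<le> 1/100" "\<bar>sg 2\<bar> \<le> 1/100" "sg 1 + ep / 2 < sg 2"
  using sg_bound[of 1] sg_bound[of 2] sg_simps(2)[of 1] ep(1) B4 by auto

lemma sg_small': "- 1/100 \<le> sg 1 + ep / 2" "sg 1 + ep / 2 \<le> 1/100" "- 1/100 \<le> sg 2" "sg 2 \<le> 1/100"
  using sg_small(1,2) unfolding abs_le_iff by linarith+

text \<open>The point is \<open>\<beta> 2\<close>, the only vertex image of the tiles
  \<open>2, ..., B - 2\<close> that lies off the two lines.\<close>

lemma orient_R1:
  assumes "\<bar>a\<bar> \<le> 1/100" "\<bar>b\<bar> \<le> 1"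
  shows "orient (cl a) (ca b) (303/1000, 19/100) > 0"
proof -
  have "\<bar>a * b\<bar> \<le> 1/100 * 1" unfolding abs_mult using assms by (intro mult_mono) auto
  then have ab: "a * b \<ge> - 1/100" by (auto simp: abs_le_iff)
  have bd: "- 1/100 \<le> a" "a \<le> 1/100" "- 1 \<le> b" "b \<le> 1" using assms by (auto simp: abs_le_iff)
  have "orient (cl a) (ca b) (303/1000, 19/100) = a * b / 40 + 19/200 + 19/5000 * b - 331/5000 * a - 303/20000 * a - 303/20000 * b"
    by (simp add: orient_def cl_def ca_def field_simps)
  then show ?thesis using ab bd by linarith
qed

lemma orient_R1': "- 1 \<le> a \<Longrightarrow> a \<le> 1 \<Longrightarrow> orient (cl a) (ca 1) (303/1000, 19/100) > 0"
  by (simp add: orient_def cl_def ca_def field_simps)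

lemma \<tau>_val: "\<tau> 0 = T0" "\<tau> 1 = T1" "\<tau> (B - 1) = T0" "2 \<le> k \<Longrightarrow> k \<le> B - 2 \<Longrightarrow> \<tau> k = TF"
proof -
  have "(B - 1) mod B = B - 1" "1 mod B = 1" by (rule mod_pos_pos_trivial; use B4 in linarith)+
  then show "\<tau> 0 = T0" "\<tau> 1 = T1" "\<tau> (B - 1) = T0" unfolding \<tau>_def using B4 by (simp_all only:) simp_all
  show "2 \<le> k \<Longrightarrow> k \<le> B - 2 \<Longrightarrow> \<tau> k = TF" unfolding \<tau>_def by simp
qed

lemma peel_g:
  assumes "0 \<le> k" "k < B"
  shows "peel (\<tau> k) (g k)"
proof (rule tile_cases[OF assms])
  assume k: "k = 0"
  show ?thesis unfolding k g_0 \<tau>_val by (simp add: T0_def orient_def)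
next
  assume k: "k = B - 1"
  show ?thesis unfolding k g_end \<tau>_val by (simp add: T0_def orient_def)
next
  assume k: "k = 1"
  show ?thesis unfolding k g_1 \<tau>_val using sg_small' sg_small(3) by (simp add: T1_def orient_def cl_def field_simps)
next
  assume k: "2 \<le> k" "k \<le> B - 2"
  note t = \<tau>_val(4)[OF k]
  note p = finger_params[OF k]
  have o5: "orient (cl a) (ca (b4 k)) (v5 k) > 0" if "sg k \<le> a" "a \<le> a2 k" for a
  proof (cases "k = 2")
    case True
    then show ?thesis using orient_R1'[of a] that p unfolding b4_def v5_def by simp
  next
    case False
    then show ?thesis using that p(3,7) unfolding v5_def by (simp add: orient_cl_ca)
  qed
  note o = o5[THEN less_imp_le]
  show ?thesis unfolding t g_finger[OF k] TF_def
    using p o5[of "sg k"] o[of "sg k"] o[of "a1 k"] o[of "a2 k"] by (simp add: orient_cl_ca)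
qed

lemma lip_g:
  assumes "0 \<le> k" "k < B" "t \<in> set (\<tau> k)"
  shows "lipT (shear (9/20) (8/5)) (97/100) f (g k) t"
proof (rule tile_cases[OF assms(1,2)])
  assume k: "k = 0"
  show ?thesis using lip_zero[OF assms(3)[unfolded k \<tau>_val]] unfolding k g_0 f_list .
next
  assume k: "k = B - 1"
  show ?thesis using lip_end[OF assms(3)[unfolded k \<tau>_val]] unfolding k g_end f_list .
next
  assume k: "k = 1"
  show ?thesis using lip_one[OF sg_small(1,2) assms(3)[unfolded k \<tau>_val]] unfolding k g_1 f_list .
next
  assume k: "2 \<le> k" "k \<le> B - 2"
  note t = assms(3)[unfolded \<tau>_val(4)[OF k]]
  have s: "\<bar>sg k\<bar> \<le> 1/100" "\<bar>sg k + ep / 2\<bar> \<le> 1/100" "\<bar>tg k\<bar> \<le> 1/100" "\<bar>tg k - ep / 2\<bar> \<le> 1/100"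
    using sg_bound[of k] tg_bound[of k] k by auto
  have s': "\<bar>sg k + ep\<bar> \<le> 1/100" "\<bar>tg k - ep\<bar> \<le> 1/100"
    using sg_bound[of "k + 1"] tg_bound[of "k + 1"] k unfolding sg_simps by auto
  have fixed: "cl (3/5) = (36/125, -3/100)" "cl (19/20) = (57/125, -19/400)" "ca (- 1) = (12/25, -1/20)" "ca 1 = (13/25, 1/20)"
    by (simp_all add: cl_def ca_def)
  show ?thesis unfolding g_finger[OF k] f_list a1_def a2_def b3_def b4_def v5_def
    using lip_four[OF s(1) t] lip_two[OF s(1,2) s'(1,2) t] lip_last[OF s(1) s(4,3) t] lip_mid[OF s(1,2) s'(1,2) s(4,3) t]
    by (cases "k = 2"; cases "k = B - 2") (simp_all only: if_True if_False fixed simp_thms)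
qed

text \<open>For \<open>k = 2\<close> vertex 4 goes to \<open>ca 1\<close>, beyond
  \<open>ca (tg k)\<close>, which explains the restricted bound on \<open>b\<close>.\<close>

lemma g_finger_props:
  assumes "2 \<le> k" "k \<le> B - 2" "i < 6" "\<And>a. sg k \<le> a \<Longrightarrow> a \<le> 19/20 \<Longrightarrow> Q (cl a)"
    "\<And>b. - 1 \<le> b \<Longrightarrow> b \<le> 1 \<Longrightarrow> (k \<noteq> 2 \<Longrightarrow> b \<le> tg k) \<Longrightarrow> Q (ca b)" "k = 2 \<Longrightarrow> Q (303/1000, 19/100)"
  shows "Q (g k i)"
proof -
  note p = finger_params[OF assms(1,2)]
  have "\<forall>i<6. Q (g k i)"
    unfolding all_less_6 g_finger[OF assms(1,2)]
  proof (simp, intro conjI)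
    show "Q (cl (sg k))" "Q (cl (a1 k))" "Q (cl (a2 k))" using p by (auto intro!: assms(4))
    show "Q (ca (b3 k))" "Q (ca (b4 k))" using p by (auto intro!: assms(5))
    show "Q (v5 k)" unfolding v5_def using p(10) assms(6) by (auto intro!: assms(5) simp: abs_le_iff)
  qed
  then show ?thesis using assms(3) by blast
qed

lemma g_H:
  assumes "0 \<le> k" "k \<le> B - 2" "i < 6"
  shows "g k i \<in> hexagon f"
proof -
  have kB: "k < B" using assms(2) by simp
  show ?thesis
  proof (rule tile_cases[OF assms(1) kB])
    assume k: "k = 0"
    have "\<forall>i<6. g 0 i \<in> hexagon f" unfolding all_less_6 g_0 H_eq by (simp add: orient_def)
    then show ?thesis using assms(3) k by blast
  next
    assume k: "k = 1"
    have "cl (sg 1 + ep / 2) \<in> hexagon f" "cl (sg 2) \<in> hexagon f"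
      by (rule cl_H; use sg_small' in linarith)+
    then have "\<forall>i<6. g 1 i \<in> hexagon f" unfolding all_less_6 g_1 H_eq by (simp add: orient_def)
    then show ?thesis using assms(3) k by blast
  next
    assume k: "2 \<le> k" "k \<le> B - 2"
    show ?thesis
      by (rule g_finger_props[OF k assms(3)]) (use finger_params[OF k] cl_H ca_H R1_H in auto)
  next
    assume "k = B - 1"
    then show ?thesis using assms(2) by simp
  qed
qed

lemma g_end_H: "i < 6 \<Longrightarrow> - g (B - 1) i \<in> hexagon f"
proof -
  assume i: "i < 6"
  have "\<forall>i<6. - g (B - 1) i \<in> hexagon f" unfolding all_less_6 g_end H_eq by (simp add: orient_def)
  then show ?thesis using i by blast
qed

lemma after_first:
  assumes "0 \<le> k" "k \<le> B - 2" "i < 6"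
  shows "orient (- \<alpha> (B - 1)) (\<alpha> 0) (g k i) \<le> 0"
proof -
  have kB: "k < B" using assms(2) by simp
  have cl0: "orient (-57/125, 19/400) (-49/50, 51/100) (cl a) \<le> 0" if "- 3/5 \<le> a" for a using that by (simp add: orient_def cl_def field_simps)
  have ca0: "orient (-57/125, 19/400) (-49/50, 51/100) (ca a) \<le> 0" if "- 1 \<le> a" "a \<le> 1" for a using that by (simp add: orient_def ca_def field_simps)
  have al: "- \<alpha> (B - 1) = (-57/125, 19/400)" "\<alpha> 0 = (-49/50, 51/100)" by (simp_all add: \<alpha>_val)
  show ?thesis unfolding al
  proof (rule tile_cases[OF assms(1) kB])
    assume k: "k = 0"
    have "\<forall>i<6. orient (-57/125, 19/400) (-49/50, 51/100) (g 0 i) \<le> 0" unfolding all_less_6 g_0 by (simp add: orient_def)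
    then show "orient (-57/125, 19/400) (-49/50, 51/100) (g k i) \<le> 0" using assms(3) k by blast
  next
    assume k: "k = 1"
    have "orient (-57/125, 19/400) (-49/50, 51/100) (cl (sg 1 + ep / 2)) \<le> 0" "orient (-57/125, 19/400) (-49/50, 51/100) (cl (sg 2)) \<le> 0"
      by (rule cl0, use sg_small' in linarith)+
    then have "\<forall>i<6. orient (-57/125, 19/400) (-49/50, 51/100) (g 1 i) \<le> 0" unfolding all_less_6 g_1 by (simp add: orient_def)
    then show "orient (-57/125, 19/400) (-49/50, 51/100) (g k i) \<le> 0" using assms(3) k by blast
  next
    assume k: "2 \<le> k" "k \<le> B - 2"
    show "orient (-57/125, 19/400) (-49/50, 51/100) (g k i) \<le> 0"
      by (rule g_finger_props[OF k assms(3)]) (use finger_params[OF k] cl0 ca0 in \<open>auto simp: orient_def\<close>)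
  next
    assume "k = B - 1"
    then show "orient (-57/125, 19/400) (-49/50, 51/100) (g k i) \<le> 0" using assms(2) by simp
  qed
qed

text \<open>For \<open>k \<ge> 2\<close> the signed areas factor by \<open>orient_cl_ca\<close>, and
  their signs reflect the order of the chord ends along the two edges. Only the first two chords and
  the exceptional point need separate numbers.\<close>

lemma before_chord:
  assumes "0 \<le> k" "k < B - 2" "l \<in> {0, 1, 4, 5}"
  shows "orient (\<alpha> (k + 1)) (\<beta> (k + 1)) (g k l) > 0"
proof -
  consider "k = 0" | "k = 1" | "2 \<le> k" using assms(1) by linarith
  then show ?thesis
  proof cases
    case 1
    have "\<forall>l\<in>{0, 1, 4, 5}. orient (-36/125, 3/100) (-13/50, 47/100) (g 0 l) > 0" unfolding g_0 by (simp add: orient_def)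
    moreover have "\<alpha> (k + 1) = (-36/125, 3/100)" "\<beta> (k + 1) = (-13/50, 47/100)" using 1 \<alpha>_val(2) \<beta>_val(2) by simp_all
    ultimately show ?thesis using assms(3) unfolding 1 by (simp only:)
  next
    case 2
    have "\<forall>l\<in>{0, 1, 4, 5}. orient (cl (sg 2)) (303/1000, 19/100) (g 1 l) > 0" unfolding g_1 using sg_small' sg_small(3) by (simp add: orient_def cl_def field_simps)
    moreover have "\<alpha> (k + 1) = cl (sg 2)" "\<beta> (k + 1) = (303/1000, 19/100)" using 2 \<alpha>_val(4)[of 2] \<beta>_val(3) B4 by simp_all
    ultimately show ?thesis using assms(3) unfolding 2 by (simp only:)
  next
    case 3
    have k: "2 \<le> k" "k \<le> B - 2" using 3 assms(2) by auto
    note p = finger_params[OF k]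
    have ab: "\<alpha> (k + 1) = cl (a2 k)" "\<beta> (k + 1) = ca (b3 k)" using fun_cong[OF g_finger[OF k], of 2] fun_cong[OF g_finger[OF k], of 3] unfolding g_list by simp_all
    have small: "\<bar>a2 k\<bar> \<le> 1/100" "\<bar>b3 k\<bar> \<le> 1" using sg_bound[of "k + 1"] tg_bound[of "k + 1"] assms k unfolding sg_simps a2_def b3_def by auto
    have "1 \<le> k + 1" "k + 1 \<le> B" using assms(2) k by auto
    from conjunct1[OF tg_bound[OF this]] have "- 1 < tg k - ep" unfolding sg_simps by linarith
    then have b3: "b3 k > - 1" using assms(2) unfolding b3_def by simp
    have "orient (cl (a2 k)) (ca (b3 k)) (v5 k) > 0"
      using orient_R1[OF small] p small unfolding v5_def by (auto simp: orient_cl_ca abs_le_iff)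
    then have "\<forall>l\<in>{0, 1, 4, 5}. orient (cl (a2 k)) (ca (b3 k)) (g k l) > 0"
      unfolding g_finger[OF k] using p small b3 by (simp add: orient_cl_ca)
    then show ?thesis using assms(3) unfolding ab by blast
  qed
qed

lemma after_chord:
  assumes "0 \<le> k" "k < m" "m \<le> B - 2" "l < 6"
  shows "orient (\<alpha> (k + 1)) (\<beta> (k + 1)) (g m l) \<le> 0"
proof -
  consider "k = 0" "m = 1" | "k = 0" "2 \<le> m" | "k = 1" | "2 \<le> k" using assms(1,2) by linarith
  then show ?thesis
  proof cases
    case 1
    have "\<forall>l<6. orient (-36/125, 3/100) (-13/50, 47/100) (g 1 l) \<le> 0" unfolding all_less_6 g_1 using sg_small' sg_small(3) by (simp add: orient_def cl_def field_simps)
    moreover have "\<alpha> (k + 1) = (-36/125, 3/100)" "\<beta> (k + 1) = (-13/50, 47/100)" using 1 \<alpha>_val(2) \<beta>_val(2) by simp_all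
    ultimately show ?thesis using assms(4) unfolding 1 by (simp only:)
  next
    case 2
    have "orient (-36/125, 3/100) (-13/50, 47/100) (g m l) \<le> 0"
    proof (rule g_finger_props[OF 2(2) assms(3,4)])
      show "orient (-36/125, 3/100) (-13/50, 47/100) (cl a) \<le> 0" if "sg m \<le> a" for a using that finger_params[OF 2(2) assms(3)] by (simp add: orient_def cl_def field_simps)
      show "orient (-36/125, 3/100) (-13/50, 47/100) (ca a) \<le> 0" if "- 1 \<le> a" "a \<le> 1" for a using that by (simp add: orient_def ca_def field_simps)
      show "orient (-36/125, 3/100) (-13/50, 47/100) (303/1000, 19/100) \<le> 0" by (simp add: orient_def)
    qed
    moreover have "\<alpha> (k + 1) = (-36/125, 3/100)" "\<beta> (k + 1) = (-13/50, 47/100)" using 2 \<alpha>_val(2) \<beta>_val(2) by simp_all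
    ultimately show ?thesis by (simp only:)
  next
    case 3
    have m: "2 \<le> m" using 3 assms(2) by simp
    have "orient (cl (sg 2)) (303/1000, 19/100) (g m l) \<le> 0"
    proof (rule g_finger_props[OF m assms(3,4)])
      show "orient (cl (sg 2)) (303/1000, 19/100) (cl a) \<le> 0" if "sg m \<le> a" for a
        using that sg_mono(1)[OF m] by (simp add: orient_def cl_def field_simps)
      show "orient (cl (sg 2)) (303/1000, 19/100) (ca a) \<le> 0" if "- 1 \<le> a" "a \<le> 1" for a
        using orient_R1[of "sg 2" a] that sg_small(2) orient_swap[of "cl (sg 2)" "(303/1000, 19/100)" "ca a"] by (simp add: abs_le_iff)
      show "orient (cl (sg 2)) (303/1000, 19/100) (303/1000, 19/100) \<le> 0" by simp
    qed
    moreover have "\<alpha> (k + 1) = cl (sg 2)" "\<beta> (k + 1) = (303/1000, 19/100)" using 3 \<alpha>_val(4)[of 2] \<beta>_val(3) B4 by simp_all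
    ultimately show ?thesis by (simp only:)
  next
    case 4
    have k: "2 \<le> k" "k \<le> B - 2" "3 \<le> k + 1" "k + 1 \<le> B - 2" and m: "2 \<le> m" "m \<noteq> 2" using 4 assms by auto
    have ab: "\<alpha> (k + 1) = cl (sg (k + 1))" "\<beta> (k + 1) = ca (tg (k + 1))" using \<alpha>_val(4)[of "k + 1"] \<beta>_val(5)[of "k + 1"] k by simp_all
    have s: "\<bar>sg (k + 1)\<bar> \<le> 1/100" "\<bar>tg (k + 1)\<bar> \<le> 1/100" using sg_bound[of "k + 1"] tg_bound[of "k + 1"] k by auto
    have mono: "sg (k + 1) \<le> sg m" "tg m \<le> tg (k + 1)" using sg_mono[of "k + 1" m] assms(2) by simp_all
    show ?thesis unfolding ab
    proof (rule g_finger_props[OF m(1) assms(3,4)])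
      show "orient (cl (sg (k + 1))) (ca (tg (k + 1))) (cl a) \<le> 0" if "sg m \<le> a" for a
        using that mono s unfolding orient_cl_ca by (auto simp: abs_le_iff intro!: mult_nonpos_nonneg)
      show "orient (cl (sg (k + 1))) (ca (tg (k + 1))) (ca b) \<le> 0" if h: "m \<noteq> 2 \<Longrightarrow> b \<le> tg m" for b
      proof -
        have "b \<le> tg m" by (rule h[OF m(2)])
        then show ?thesis using mono s unfolding orient_cl_ca by (auto simp: abs_le_iff intro!: mult_nonpos_nonneg)
      qed
      show "orient (cl (sg (k + 1))) (ca (tg (k + 1))) (303/1000, 19/100) \<le> 0" if "m = 2" using that m by simp
    qed
  qed
qed

lemma first_strict: "l \<in> {2, 3, 4, 5} \<Longrightarrow> orient (- \<alpha> (B - 1)) (\<alpha> 0) (- g (B - 1) l) > 0"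
proof -
  have "\<forall>l\<in>{2, 3, 4, 5}. orient (-57/125, 19/400) (-49/50, 51/100) (- g (B - 1) l) > 0" unfolding g_end by (simp add: orient_def)
  moreover have "- \<alpha> (B - 1) = (-57/125, 19/400)" "\<alpha> 0 = (-49/50, 51/100)" by (simp_all add: \<alpha>_val)
  moreover assume "l \<in> {2, 3, 4, 5}"
  ultimately show "orient (- \<alpha> (B - 1)) (\<alpha> 0) (- g (B - 1) l) > 0" by (simp only:)
qed

theorem disk_like_tile: "disk_like (tile (- 2) B)"
proof -
  interpret hex_model "(-12/25, 1/20)" "(-11/10, 9/20)" "(1, 0)" "(0, 0)" "(- 2, 1)" B \<alpha> \<beta> \<tau> "shear (9/20) (8/5)" "97/100"
  proof (intro hex_model.intro hex_model_axioms.intro)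
    show "hex_tiling (-12/25, 1/20) (-11/10, 9/20) (1, 0) (0, 0) (- 2, 1)" by (rule family_tiling)
    show "2 \<le> B" using B4 by simp
    show "linear (shear (9/20) (8/5))" "inj (shear (9/20) (8/5))" by (simp_all add: linear_shear inj_shear)
    show "\<alpha> (k + B) = \<alpha> k + (2, - 1)" "\<beta> (k + B) = \<beta> k + (2, - 1)" "\<tau> (k + B) = \<tau> k" for k
      unfolding \<alpha>_def \<beta>_def \<tau>_def using B4 by (simp_all add: qext_period)
    show "\<tau> k \<in> {T0, T1, TF, TA, TB}" for k unfolding \<tau>_def by simp
    show "0 \<le> (97/100 :: real)" "(97/100 :: real) < 1" by simp_all
  qed (rule lip_g g_H g_end_H, assumption+)+
  interpret strip_model "(-12/25, 1/20)" "(-11/10, 9/20)" B \<alpha> \<beta> \<tau> "shear (9/20) (8/5)" "97/100"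
  proof (intro strip_model.intro strip_model_axioms.intro)
    show "hex_model (-12/25, 1/20) (-11/10, 9/20) (1, 0) (0, 0) (- 2, 1) B \<alpha> \<beta> \<tau> (shear (9/20) (8/5)) (97/100)" ..
    show "\<beta> (B - 1) = - (-12/25, 1/20)" "\<beta> 0 = iv (- 2, 1) - (-11/10, 9/20)" by (simp_all add: \<beta>_val iv_def)
  qed (rule B4 peel_g first_strict after_first before_chord after_chord; assumption)+
  show ?thesis by (rule disk_like_if_inj[OF inj_psi])
qed

end

theorem theorem6p3:
  fixes A B :: int
  assumes "2 \<le> - A" and "- A \<le> B" and "2 * \<bar>A\<bar> < B + 3"
  shows "(A = -2 \<and> B \<ge> 2 \<longrightarrow> disk_like (tile A B))
       \<and> (A \<le> -3 \<and> B \<ge> 4 \<longrightarrow> \<not> disk_like (tile A B))"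
proof (intro conjI impI)
  assume h: "A = -2 \<and> B \<ge> 2"
  then consider "B = 2" | "B = 3" | "B \<ge> 4" by linarith
  then show "disk_like (tile A B)"
  proof cases
    case 1
    then show ?thesis using disk_like_two h by simp
  next
    case 2
    then show ?thesis using disk_like_three h by simp
  next
    case 3
    then interpret family B by unfold_locales
    show ?thesis using disk_like_tile h by simp
  qed
next
  assume h: "A \<le> -3 \<and> B \<ge> 4"
  then interpret steep_tile "- A" B using assms by unfold_locales auto
  show "\<not> disk_like (tile A B)" using not_disk_like by simp
qed

end
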